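(* Let $n\ge1$ and let $\mathfrak g$ be a finite-dimensional simple complex Lie algebra of type $A_l$ ($l\geq 1$) or of type $C_l$ ($l\geq 2$), with Cartan subalgebra $\mathfrak h$. Then $$\mathcal M(\widetilde{\mathfrak g}_n,\widetilde{\mathfrak h}_n)=\{\widetilde M_{\widetilde{\mathfrak g}_n}(\lambda,M_{\mathfrak g}) : \lambda\in(\mathbb C^* )^n,\ M_{\mathfrak g}\in\mathcal M(\mathfrak g,\mathfrak h)\}.$$
   Context: All vector spaces, algebras and tensor products are over $\mathbb C$. $U(\mathfrak a)$ denotes the universal enveloping algebra of a Lie algebra $\mathfrak a$. Category: for a Lie algebra $\mathfrak a$ and a finite-dimensional abelian subalgebra $\mathfrak b\subseteq\mathfrak a$, $\mathcal M(\mathfrak a,\mathfrak b)$ is the full subcategory of $U(\mathfrak a)$-modules whose restriction to $U(\mathfrak b)$ is free of rank $1$. Each object is identified with the vector space $U(\mathfrak b)$ on which $\mathfrak b$ acts by multiplication (so $1\in U(\mathfrak b)$ is a free generator); equalities of sets of modules are understood under this identification. Notation for $\mathfrak g$: $x_i,y_i,h_i$ ($1\le i\le l$) are Chevalley generators, and $\{H_1,\dots,H_l\}$ is the basis of $\mathfrak h$ with $[H_i,x_j]=\delta_{ij}x_i$, $[H_i,y_j]=-\delta_{ij}y_j$. $(\cdot,\cdot)$ is the Killing form. Toroidal Lie algebra: let $A=\mathbb C[t_1^{\pm1},\dots,t_n^{\pm1}]$, $t^m=t_1^{m_1}\cdots t_n^{m_n}$ for $m\in\mathbb Z^n$; $\Omega_A$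 is the free $A$-module with basis $K_1,\dots,K_n$; $dA\subseteq\Omega_A$ is the span of the elements $\sum_i m_i t^mK_i$, $m\in\mathbb Z^n$; $\mathcal K_A=\Omega_A/dA$; $D=\bigoplus_{i=1}^n\mathbb C d_i$. Write $x(a)=x\otimes t^a$. Then $\widetilde{\mathfrak g}_n=(\mathfrak g\otimes A)\oplus\mathcal K_A\oplus D$ with brackets $[x(a),y(b)]=[x,y](a+b)+(x,y)\sum_{i=1}^n a_i t^{a+b}K_i$, $[\mathfrak g\otimes A,\mathcal K_A]=[\mathcal K_A,\mathcal K_A]=0$, $[d_i,x(a)]=a_ix(a)$, $[d_i,t^aK_j]=a_it^aK_j$, $[d_i,d_j]=0$. Put $\widetilde{\mathfrak h}_n=\mathfrak h\oplus D$, so $U(\widetilde{\mathfrak h}_n)=\mathbb C[H_1,\dots,H_l,d_1,\dots,d_n]\supset U(\mathfrak h)=\mathbb C[H_1,\dots,H_l]$. Automorphisms of $U(\widetilde{\mathfrak h}_n)$: $\sigma_i$ sends $H_i\mapsto H_i-1$ and fixes all other generators; $\tau_j$ sends $d_j\mapsto d_j-1$ and fixes all other generators. For $a\in\mathbb Z^n$, $\tau^a=\tau_1^{a_1}\cdots\tau_n^{a_n}$ and $\lambda^a=\lambda_1^{a_1}\cdots\lambda_n^{a_n}$. The module $\widetilde M_{\widetilde{\mathfrak g}_n}(\lambda,M_{\mathfrak g})$: for $M_{\mathfrak g}\in\mathcal M(\mathfrak g,\mathfrak h)$ (so $M_{\mathfrak g}=U(\mathfrak h)$ as a space) and $\lambda\in(\mathbb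 C^* )^n$, it is the space $U(\widetilde{\mathfrak h}_n)$ with, for $g\in U(\widetilde{\mathfrak h}_n)$, $a\in\mathbb Z^n$, $h\in\mathfrak h$, $1\le i\le l$, $1\le j\le n$: $t^aK_j.g=0$; $d_j.g=d_jg$; $h(a).g=\lambda^a h\,\tau^a(g)$; $x_i(a).g=\lambda^a\sigma_i\tau^a(g)\,(x_i.1)$; $y_i(a).g=\lambda^a\sigma_i^{-1}\tau^a(g)\,(y_i.1)$, where $x_i.1,y_i.1\in U(\mathfrak h)$ are given by the $\mathfrak g$-module structure of $M_{\mathfrak g}$. This defines a $\widetilde{\mathfrak g}_n$-module. *)

theory Defs
  imports "HOL-Analysis.Analysis" "HOL-Library.Poly_Mapping"
begin

section \<open>Complex Lie algebras\<close>

locale lie_algebra = vector_space scale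
  for scale :: "complex \<Rightarrow> 'g::ab_group_add \<Rightarrow> 'g" +
  fixes bracket :: "'g \<Rightarrow> 'g \<Rightarrow> 'g"
  assumes bracket_add_left: "bracket (u + v) w = bracket u w + bracket v w"
    and bracket_add_right: "bracket u (v + w) = bracket u v + bracket u w"
    and bracket_scale_left: "bracket (scale c u) v = scale c (bracket u v)"
    and bracket_scale_right: "bracket u (scale c v) = scale c (bracket u v)"
    and bracket_self: "bracket u u = 0"
    and jacobi: "bracket u (bracket v w) + bracket v (bracket w u) + bracket w (bracket u v) = 0"
begin

definition subalgebra :: "'g set \<Rightarrow> bool" where
  "subalgebra S \<longleftrightarrow> subspace S \<and> (\<forall>u\<in>S. \<forall>v\<in>S. bracket u v \<in> S)"

definition lie_ideal :: "'g set \<Rightarrow> bool" where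
  "lie_ideal S \<longleftrightarrow> subspace S \<and> (\<forall>u. \<forall>v\<in>S. bracket u v \<in> S)"

definition generated_subalgebra :: "'g set \<Rightarrow> 'g set" where
  "generated_subalgebra S = \<Inter>{T. subalgebra T \<and> S \<subseteq> T}"

primrec lower_central :: "'g set \<Rightarrow> nat \<Rightarrow> 'g set" where
  "lower_central S 0 = S"
| "lower_central S (Suc k) = span {bracket u v | u v. u \<in> S \<and> v \<in> lower_central S k}"

definition cartan_subalgebra :: "'g set \<Rightarrow> bool" where
  "cartan_subalgebra S \<longleftrightarrow> subalgebra S \<and> (\<exists>k. lower_central S k = {0}) \<and>
     {u. \<forall>v\<in>S. bracket u v \<in> S} = S"

definition basis_family :: "('i \<Rightarrow> 'g) \<Rightarrow> 'g set \<Rightarrow> bool" where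
  "basis_family b S \<longleftrightarrow> inj b \<and> independent (range b) \<and> span (range b) = S"

text \<open>The trace does not depend on the basis; it is meaningful in finite dimension only.\<close>

definition linear_trace :: "('g \<Rightarrow> 'g) \<Rightarrow> complex" where
  "linear_trace f = (let B = (SOME B. independent B \<and> span B = UNIV) in
     \<Sum>b\<in>B. representation B (f b) b)"

definition killing :: "'g \<Rightarrow> 'g \<Rightarrow> complex" where
  "killing u v = linear_trace (\<lambda>w. bracket u (bracket v w))"

end

locale fd_lie_algebra = lie_algebra +
  assumes finite_dim: "\<exists>B. finite B \<and> span B = UNIV"

locale simple_lie_algebra = fd_lie_algebra +
  assumes nonabelian: "\<exists>u v. bracket u v \<noteq> 0"
    and simple: "lie_ideal S \<Longrightarrow> S = {0} \<or> S = UNIV"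

section \<open>Cartan matrices and Chevalley generators\<close>

text \<open>The convention is \<open>[h\<^sub>i, x\<^sub>j] = A\<^sub>i\<^sub>j x\<^sub>j\<close>, i.e. \<open>A\<^sub>i\<^sub>j = \<alpha>\<^sub>j(h\<^sub>i)\<close>. In type C the last
  simple root is the long one, so \<open>\<alpha>\<^sub>l(h\<^sub>l\<^sub>-\<^sub>1) = -2\<close>.\<close>

definition cartan_A :: "nat \<Rightarrow> nat \<Rightarrow> int" where
  "cartan_A i j = (if i = j then 2 else if j = Suc i \<or> i = Suc j then -1 else 0)"

definition cartan_C :: "nat \<Rightarrow> nat \<Rightarrow> nat \<Rightarrow> int" where
  "cartan_C l i j = (if j = l \<and> i = l - 1 then -2 else cartan_A i j)"

text \<open>Nodes are indexed by a finite type of size \<open>l\<close>, so the type of a Cartan matrix is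
  understood up to a numbering of the nodes by \<open>1, \<dots>, l\<close>.\<close>

definition type_A :: "('l::finite \<Rightarrow> 'l \<Rightarrow> int) \<Rightarrow> bool" where
  "type_A A \<longleftrightarrow> (\<exists>e. bij_betw e UNIV {1..CARD('l)} \<and>
     (\<forall>i j. A i j = cartan_A (e i) (e j)))"

definition type_C :: "('l::finite \<Rightarrow> 'l \<Rightarrow> int) \<Rightarrow> bool" where
  "type_C A \<longleftrightarrow> CARD('l) \<ge> 2 \<and> (\<exists>e. bij_betw e UNIV {1..CARD('l)} \<and>
     (\<forall>i j. A i j = cartan_C CARD('l) (e i) (e j)))"

text \<open>A simple Lie algebra with Cartan subalgebra \<open>cartan\<close> and Cartan matrix \<open>A\<close> (that is, of
  the type given by \<open>A\<close>), Chevalley generators \<open>x\<^sub>i, y\<^sub>i, h\<^sub>i\<close>, and the basis \<open>H\<^sub>i\<close> of \<open>cartan\<close> dual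
  to the simple roots.\<close>

locale chevalley_lie_algebra = simple_lie_algebra scale bracket
  for scale :: "complex \<Rightarrow> 'g::ab_group_add \<Rightarrow> 'g" and bracket +
  fixes cartan :: "'g set"
    and A :: "'l::finite \<Rightarrow> 'l \<Rightarrow> int"
    and x y h H :: "'l \<Rightarrow> 'g"
  assumes cartan: "cartan_subalgebra cartan"
    and h_basis: "basis_family h cartan"
    and h_x: "bracket (h i) (x j) = scale (of_int (A i j)) (x j)"
    and h_y: "bracket (h i) (y j) = scale (- of_int (A i j)) (y j)"
    and x_y: "bracket (x i) (y j) = (if i = j then h i else 0)"
    and generators: "generated_subalgebra (range x \<union> range y) = UNIV"
    and H_basis: "basis_family H cartan"
    and H_x: "bracket (H i) (x j) = (if i = j then x j else 0)"
    and H_y: "bracket (H i) (y j) = (if i = j then - y j else 0)"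

section \<open>Polynomial rings\<close>

text \<open>If \<open>b\<close> is a basis, indexed by the finite type \<open>'v\<close>, of an abelian Lie algebra, then the
  enveloping algebra of the latter is \<open>\<complex>[b\<^sub>v : v]\<close>.\<close>

type_synonym 'v cpoly = "('v \<Rightarrow>\<^sub>0 nat) \<Rightarrow>\<^sub>0 complex"

definition Const :: "complex \<Rightarrow> 'v cpoly" where
  "Const c = Poly_Mapping.single 0 c"

definition Var :: "'v \<Rightarrow> 'v cpoly" where
  "Var v = Poly_Mapping.single (Poly_Mapping.single v 1) 1"

definition poly_scale :: "complex \<Rightarrow> 'v cpoly \<Rightarrow> 'v cpoly" where
  "poly_scale c p = Const c * p"

text \<open>The \<open>\<complex>\<close>-algebra homomorphism with \<open>Var v \<mapsto> f v\<close>.\<close>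

definition poly_subst :: "('v::finite \<Rightarrow> 'w cpoly) \<Rightarrow> 'v cpoly \<Rightarrow> 'w cpoly" where
  "poly_subst f p = (\<Sum>m\<in>Poly_Mapping.keys p.
     Const (Poly_Mapping.lookup p m) * (\<Prod>v\<in>UNIV. f v ^ Poly_Mapping.lookup m v))"

definition sigma :: "'l \<Rightarrow> ('l::finite + 'n::finite) cpoly \<Rightarrow> ('l + 'n) cpoly" where
  "sigma i = poly_subst (\<lambda>v. if v = Inl i then Var v - 1 else Var v)"

text \<open>This is \<open>\<tau>\<^sup>a = \<tau>\<^sub>1\<^bsup>a\<^sub>1\<^esup> \<dots> \<tau>\<^sub>n\<^bsup>a\<^sub>n\<^esup>\<close>, where \<open>\<tau>\<^sub>j\<close> sends \<open>d\<^sub>j\<close> to \<open>d\<^sub>j - 1\<close>.\<close>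

definition tau :: "int^'n \<Rightarrow> ('l::finite + 'n::finite) cpoly \<Rightarrow> ('l + 'n) cpoly" where
  "tau a = poly_subst (case_sum (\<lambda>i. Var (Inl i)) (\<lambda>j. Var (Inr j) - of_int (a $ j)))"

definition embed :: "'l::finite cpoly \<Rightarrow> ('l + 'n::finite) cpoly" where
  "embed = poly_subst (\<lambda>i. Var (Inl i))"

section \<open>Modules and the category M(a, b)\<close>

text \<open>Modules over the enveloping algebra are given by the action of the Lie algebra.\<close>

locale lie_module = lie_algebra scale bracket + V: vector_space scaleV
  for scale :: "complex \<Rightarrow> 'a::ab_group_add \<Rightarrow> 'a" and bracket
    and scaleV :: "complex \<Rightarrow> 'v::ab_group_add \<Rightarrow> 'v" +
  fixes act :: "'a \<Rightarrow> 'v \<Rightarrow> 'v"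
  assumes act_add_left: "act (u + w) p = act u p + act w p"
    and act_add_right: "act u (p + q) = act u p + act u q"
    and act_scale_left: "act (scale c u) p = scaleV c (act u p)"
    and act_scale_right: "act u (scaleV c p) = scaleV c (act u p)"
    and act_bracket: "act (bracket u w) p = act u (act w p) - act w (act u p)"

text \<open>\<open>\<phi>\<close> is an isomorphism of \<open>U(b)\<close>-modules from \<open>U(b)\<close> onto the module, where the
  abelian subalgebra \<open>b\<close> is given by a basis. Such \<open>\<phi>\<close> correspond to free generators
  \<open>\<phi>(1)\<close>.\<close>

definition free_iso ::
  "(complex \<Rightarrow> 'v::ab_group_add \<Rightarrow> 'v) \<Rightarrow> ('a \<Rightarrow> 'v \<Rightarrow> 'v) \<Rightarrow> ('i::finite \<Rightarrow> 'a) \<Rightarrow>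
   ('i cpoly \<Rightarrow> 'v) \<Rightarrow> bool" where
  "free_iso scaleV act b \<phi> \<longleftrightarrow> bij \<phi> \<and>
     (\<forall>p q. \<phi> (p + q) = \<phi> p + \<phi> q) \<and> (\<forall>c p. \<phi> (poly_scale c p) = scaleV c (\<phi> p)) \<and>
     (\<forall>i p. \<phi> (Var i * p) = act (b i) (\<phi> p))"

definition category_M ::
  "(complex \<Rightarrow> 'a::ab_group_add \<Rightarrow> 'a) \<Rightarrow> ('a \<Rightarrow> 'a \<Rightarrow> 'a) \<Rightarrow> ('i::finite \<Rightarrow> 'a) \<Rightarrow>
   (complex \<Rightarrow> 'v::ab_group_add \<Rightarrow> 'v) \<Rightarrow> ('a \<Rightarrow> 'v \<Rightarrow> 'v) \<Rightarrow> bool" where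
  "category_M scl br b scaleV act \<longleftrightarrow>
     lie_module scl br scaleV act \<and> (\<exists>\<phi>. free_iso scaleV act b \<phi>)"

text \<open>The objects of \<open>M(a, b)\<close> after the identification of the space with \<open>U(b)\<close>; for
  \<open>\<phi> = id\<close>, \<open>free_iso\<close> says that \<open>b\<close> acts by multiplication.\<close>

definition objects_M ::
  "(complex \<Rightarrow> 'a::ab_group_add \<Rightarrow> 'a) \<Rightarrow> ('a \<Rightarrow> 'a \<Rightarrow> 'a) \<Rightarrow> ('i::finite \<Rightarrow> 'a) \<Rightarrow>
   ('a \<Rightarrow> 'i cpoly \<Rightarrow> 'i cpoly) set" where
  "objects_M scl br b =
     {act. category_M scl br b poly_scale act \<and> free_iso poly_scale act b id}"

section \<open>The toroidal Lie algebra\<close>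

text \<open>Here \<open>n\<close> is the size of the index type, so \<open>n \<ge> 1\<close>. The free module \<open>\<Omega>\<^sub>A\<close> over the
  Laurent polynomials is \<open>A\<^sup>n\<close>, with \<open>K\<^sub>j\<close> the unit vectors.\<close>

type_synonym 'n laurent = "(int^'n) \<Rightarrow>\<^sub>0 complex"
type_synonym 'n Omega = "'n laurent ^ 'n"

definition Omega_scale :: "complex \<Rightarrow> 'n::finite Omega \<Rightarrow> 'n Omega" where
  "Omega_scale c w = Poly_Mapping.single 0 c *s w"

definition Omega_gen :: "int^'n \<Rightarrow> 'n::finite \<Rightarrow> 'n Omega" where
  "Omega_gen a j = axis j (Poly_Mapping.single a 1)"

definition dA :: "'n::finite Omega set" where
  "dA = module.span Omega_scale
     {w. \<exists>m. w = (\<Sum>i\<in>UNIV. Omega_scale (of_int (m $ i)) (Omega_gen m i))}"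

interpretation Omega: vector_space "Omega_scale :: complex \<Rightarrow> 'n::finite Omega \<Rightarrow> _"
  by unfold_locales
    (simp_all add: Omega_scale_def vec_eq_iff distrib_left distrib_right single_add mult_single
      mult.assoc[symmetric])

lemma subspace_dA: "Omega.subspace dA"
  unfolding dA_def by (rule Omega.subspace_span)

quotient_type 'n KA = "'n::finite Omega" / "\<lambda>u v. u - v \<in> (dA :: 'n Omega set)"
proof (rule equivpI)
  show "reflp (\<lambda>u v. u - v \<in> (dA :: 'n Omega set))"
    using Omega.subspace_0[OF subspace_dA] by (auto intro: reflpI)
  show "symp (\<lambda>u v. u - v \<in> (dA :: 'n Omega set))"
    using Omega.subspace_neg[OF subspace_dA] by (fastforce intro: sympI)
  show "transp (\<lambda>u v. u - v \<in> (dA :: 'n Omega set))"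
    using Omega.subspace_add[OF subspace_dA] by (fastforce intro: transpI)
qed

instantiation KA :: (finite) ab_group_add
begin

lift_definition zero_KA :: "'a KA" is 0 .
lift_definition plus_KA :: "'a KA \<Rightarrow> 'a KA \<Rightarrow> 'a KA" is "(+)"
  using Omega.subspace_add[OF subspace_dA] by (metis add_diff_add)
lift_definition uminus_KA :: "'a KA \<Rightarrow> 'a KA" is uminus
  using Omega.subspace_neg[OF subspace_dA] by (metis minus_diff_minus)
lift_definition minus_KA :: "'a KA \<Rightarrow> 'a KA \<Rightarrow> 'a KA" is "(-)"
proof -
  fix u v w z :: "'a Omega"
  assume "u - v \<in> dA" "w - z \<in> dA"
  then have "(u - v) - (w - z) \<in> dA"
    by (rule Omega.subspace_diff[OF subspace_dA])
  then show "(u - w) - (v - z) \<in> dA"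
    by (simp add: algebra_simps)
qed

instance
  by standard (transfer; simp add: Omega.subspace_0[OF subspace_dA] algebra_simps)+

end

lift_definition KA_scale :: "complex \<Rightarrow> 'n::finite KA \<Rightarrow> 'n KA" is Omega_scale
  using Omega.subspace_scale[OF subspace_dA] by (metis Omega.scale_right_diff_distrib)

text \<open>The class of \<open>t\<^sup>a K\<^sub>j\<close>.\<close>

lift_definition KA_gen :: "int^'n \<Rightarrow> 'n::finite \<Rightarrow> 'n KA" is Omega_gen .

interpretation KA: vector_space "KA_scale :: complex \<Rightarrow> 'n::finite KA \<Rightarrow> _"
  by unfold_locales
    (transfer; simp add: Omega.subspace_0[OF subspace_dA] Omega.scale_right_distrib
      Omega.scale_left_distrib)+

definition pairing :: "complex^'n \<Rightarrow> int^'n \<Rightarrow> complex" where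
  "pairing d a = (\<Sum>i\<in>UNIV. d $ i * of_int (a $ i))"

definition lam_pow :: "complex^'n \<Rightarrow> int^'n \<Rightarrow> complex" where
  "lam_pow lam a = (\<Prod>j\<in>UNIV. (lam $ j) powi (a $ j))"

text \<open>An element of \<open>D\<close> is given by its coordinate vector \<open>c\<close>; it acts by
  \<open>t\<^sup>a K\<^sub>j \<mapsto> (\<Sum>\<^sub>i c\<^sub>i a\<^sub>i) t\<^sup>a K\<^sub>j\<close>.\<close>

definition Omega_deriv :: "complex^'n \<Rightarrow> 'n::finite Omega \<Rightarrow> 'n Omega" where
  "Omega_deriv d w = (\<chi> j. Poly_Mapping.mapp (\<lambda>a c. pairing d a * c) (w $ j))"

lemma lookup_mapp': "f k 0 = 0 \<Longrightarrow>
    Poly_Mapping.lookup (Poly_Mapping.mapp f p) k = f k (Poly_Mapping.lookup p k)"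
  by (simp add: lookup_mapp when_def in_keys_iff)

lemma lookup_map': "f 0 = 0 \<Longrightarrow>
    Poly_Mapping.lookup (Poly_Mapping.map f p) k = f (Poly_Mapping.lookup p k)"
  by (simp add: Poly_Mapping.map.rep_eq when_def)

lemma map_zero [simp]: "Poly_Mapping.map f 0 = 0"
  by (simp add: poly_mapping_eq_iff fun_eq_iff Poly_Mapping.map.rep_eq)

lemma lookup_single_mult: "Poly_Mapping.lookup (Poly_Mapping.single 0 c * p) a =
    c * Poly_Mapping.lookup (p :: 'n::finite laurent) a"
  by (simp flip: mult_map_scale_conv_mult add: lookup_map')

lemma Omega_deriv_add: "Omega_deriv d (u + v) = Omega_deriv d u + Omega_deriv d v"
  by (simp add: Omega_deriv_def vec_eq_iff poly_mapping_eq_iff fun_eq_iff lookup_mapp' lookup_add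
      algebra_simps)

lemma Omega_deriv_scale: "Omega_deriv d (Omega_scale c u) = Omega_scale c (Omega_deriv d u)"
  by (simp add: Omega_deriv_def Omega_scale_def vec_eq_iff poly_mapping_eq_iff fun_eq_iff
      lookup_mapp' lookup_single_mult)

lemma Omega_deriv_0: "Omega_deriv d 0 = 0"
  using Omega_deriv_scale[of d 0 0] by simp

lemma Omega_deriv_gen: "Omega_deriv d (Omega_gen a j) = Omega_scale (pairing d a) (Omega_gen a j)"
  by (auto simp: Omega_deriv_def Omega_scale_def Omega_gen_def vec_eq_iff poly_mapping_eq_iff
      fun_eq_iff lookup_mapp' lookup_single_mult axis_def lookup_single when_def pairing_def)

lemma Omega_deriv_dA:
  assumes "w \<in> dA"
  shows "Omega_deriv d w \<in> dA"
  using assms unfolding dA_def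
proof (induction rule: Omega.span_induct_alt)
  case base
  then show ?case
    by (simp add: Omega_deriv_0 Omega.span_zero)
next
  case (step c u w)
  then obtain m where u: "u = (\<Sum>i\<in>UNIV. Omega_scale (of_int (m $ i)) (Omega_gen m i))"
    by blast
  have *: "Omega_deriv d (sum f S) = (\<Sum>i\<in>S. Omega_deriv d (f i))" for f :: "'a \<Rightarrow> 'a Omega" and S
    by (induction S rule: infinite_finite_induct) (simp_all add: Omega_deriv_add Omega_deriv_0)
  have "Omega_deriv d u = Omega_scale (pairing d m) u"
    by (simp add: u * Omega_deriv_scale Omega_deriv_gen Omega.scale_sum_right mult.commute)
  moreover have "u \<in> Omega.span {w. \<exists>m. w = (\<Sum>i\<in>UNIV. Omega_scale (of_int (m $ i)) (Omega_gen m i))}"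
    using u by (auto intro: Omega.span_base)
  ultimately show ?case
    using step by (simp add: Omega_deriv_add Omega_deriv_scale Omega.span_add Omega.span_scale)
qed

lemma Omega_deriv_diff: "Omega_deriv d (u - v) = Omega_deriv d u - Omega_deriv d v"
  using Omega_deriv_add[of d "u - v" v] by simp

lift_definition KA_deriv :: "complex^'n \<Rightarrow> 'n::finite KA \<Rightarrow> 'n KA" is Omega_deriv
  using Omega_deriv_dA Omega_deriv_diff by metis

text \<open>\<open>(u, k, c)\<close> stands for \<open>\<Sum>\<^sub>a u\<^sub>a \<otimes> t\<^sup>a + k + \<Sum>\<^sub>i c\<^sub>i d\<^sub>i\<close>.\<close>

type_synonym ('g, 'n) toroidal = "((int^'n) \<Rightarrow>\<^sub>0 'g) \<times> 'n KA \<times> (complex^'n)"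

definition loop :: "'g::zero \<Rightarrow> int^'n \<Rightarrow> ('g, 'n::finite) toroidal" where
  "loop z a = (Poly_Mapping.single a z, 0, 0)"

definition central :: "int^'n \<Rightarrow> 'n \<Rightarrow> ('g::zero, 'n::finite) toroidal" where
  "central a j = (0, KA_gen a j, 0)"

definition deg_deriv :: "'n \<Rightarrow> ('g::zero, 'n::finite) toroidal" where
  "deg_deriv j = (0, 0, axis j 1)"

context lie_algebra
begin

definition loop_deriv :: "complex^'n \<Rightarrow> ((int^'n) \<Rightarrow>\<^sub>0 'g) \<Rightarrow> (int^'n) \<Rightarrow>\<^sub>0 'g" where
  "loop_deriv d u = Poly_Mapping.mapp (\<lambda>a. scale (pairing d a)) u"

definition toroidal_scale :: "complex \<Rightarrow> ('g, 'n::finite) toroidal \<Rightarrow> ('g, 'n) toroidal" where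
  "toroidal_scale c = (\<lambda>(u, k, d). (Poly_Mapping.map (scale c) u, KA_scale c k, c *s d))"

definition toroidal_bracket ::
  "('g, 'n::finite) toroidal \<Rightarrow> ('g, 'n) toroidal \<Rightarrow> ('g, 'n) toroidal" where
  "toroidal_bracket = (\<lambda>(u, k, d) (v, l, e).
     ((\<Sum>a\<in>Poly_Mapping.keys u. \<Sum>b\<in>Poly_Mapping.keys v.
         Poly_Mapping.single (a + b)
           (bracket (Poly_Mapping.lookup u a) (Poly_Mapping.lookup v b)))
        + loop_deriv d v - loop_deriv e u,
      (\<Sum>a\<in>Poly_Mapping.keys u. \<Sum>b\<in>Poly_Mapping.keys v.
         KA_scale (killing (Poly_Mapping.lookup u a) (Poly_Mapping.lookup v b))
           (\<Sum>i\<in>UNIV. KA_scale (of_int (a $ i)) (KA_gen (a + b) i)))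
        + KA_deriv d l - KA_deriv e k,
      0))"


end

section \<open>The modules\<close>

context chevalley_lie_algebra
begin

text \<open>\<open>(H\<^sub>1, \<dots>, H\<^sub>l, d\<^sub>1, \<dots>, d\<^sub>n)\<close>, a basis of \<open>cartan \<oplus> D\<close>.\<close>

definition toroidal_basis :: "'l + 'n \<Rightarrow> ('g, 'n::finite) toroidal" where
  "toroidal_basis = case_sum (\<lambda>i. loop (H i) 0) deg_deriv"

text \<open>An element of the Cartan subalgebra as a linear polynomial in \<open>H\<^sub>1, \<dots>, H\<^sub>l\<close>.\<close>

definition cartan_poly :: "'g \<Rightarrow> ('l + 'n::finite) cpoly" where
  "cartan_poly k = (\<Sum>i\<in>UNIV. Const (representation (range H) k (H i)) * Var (Inl i))"

definition is_toroidal_module ::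
  "complex^'n::finite \<Rightarrow> ('g \<Rightarrow> 'l cpoly \<Rightarrow> 'l cpoly) \<Rightarrow>
   (('g, 'n) toroidal \<Rightarrow> ('l + 'n) cpoly \<Rightarrow> ('l + 'n) cpoly) \<Rightarrow> bool" where
  "is_toroidal_module lam M act \<longleftrightarrow>
     lie_module toroidal_scale toroidal_bracket poly_scale act \<and>
     (\<forall>a j p. act (central a j) p = 0) \<and>
     (\<forall>j p. act (deg_deriv j) p = Var (Inr j) * p) \<and>
     (\<forall>k\<in>cartan. \<forall>a p. act (loop k a) p = Const (lam_pow lam a) * cartan_poly k * tau a p) \<and>
     (\<forall>i a p. act (loop (x i) a) p =
        Const (lam_pow lam a) * sigma i (tau a p) * embed (M (x i) 1)) \<and>
     (\<forall>i a p. act (loop (y i) a) p =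
        Const (lam_pow lam a) * inv (sigma i) (tau a p) * embed (M (y i) 1))"

text \<open>The elements whose action is prescribed generate the toroidal Lie algebra, so there is
  at most one such action.\<close>

definition toroidal_module ::
  "complex^'n::finite \<Rightarrow> ('g \<Rightarrow> 'l cpoly \<Rightarrow> 'l cpoly) \<Rightarrow>
   ('g, 'n) toroidal \<Rightarrow> ('l + 'n) cpoly \<Rightarrow> ('l + 'n) cpoly" where
  "toroidal_module lam M = (THE act. is_toroidal_module lam M act)"

end

section \<open>Consequences of the definitions\<close>

text \<open>Every object of \<open>M(a, b)\<close> is isomorphic to one in \<open>objects_M\<close>.\<close>

lemma category_M_transport:
  assumes "category_M scl br b scaleV act"
  obtains act' \<phi> where "act' \<in> objects_M scl br b" "bij \<phi>"
    "\<And>p q. \<phi> (p + q) = \<phi> p + \<phi> q" "\<And>c p. \<phi> (poly_scale c p) = scaleV c (\<phi> p)"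
    "\<And>u p. \<phi> (act' u p) = act u (\<phi> p)"
proof -
  from assms obtain \<phi> where mod: "lie_module scl br scaleV act" and iso: "free_iso scaleV act b \<phi>"
    by (auto simp: category_M_def)
  interpret lie_module scl br scaleV act by (rule mod)
  from iso have bij: "bij \<phi>" and add: "\<And>p q. \<phi> (p + q) = \<phi> p + \<phi> q"
    and sc: "\<And>c p. \<phi> (poly_scale c p) = scaleV c (\<phi> p)"
    and var: "\<And>i p. \<phi> (Var i * p) = act (b i) (\<phi> p)"
    by (auto simp: free_iso_def)
  have surj: "\<phi> (inv \<phi> v) = v" and inj: "\<phi> p = \<phi> q \<longleftrightarrow> p = q" for v p q
    using bij by (simp_all add: bij_def surj_f_inv_f inj_eq)
  have diff: "\<phi> (p - q) = \<phi> p - \<phi> q" for p q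
    using add[of "p - q" q] by simp
  define act' where "act' u p = inv \<phi> (act u (\<phi> p))" for u p
  have act': "\<phi> (act' u p) = act u (\<phi> p)" for u p
    by (simp add: act'_def surj)
  have "lie_module scl br poly_scale act'"
  proof (intro lie_module.intro lie_module_axioms.intro)
    show "lie_algebra scl br" by unfold_locales
    show "vector_space (poly_scale :: complex \<Rightarrow> 'b cpoly \<Rightarrow> _)"
      by unfold_locales
        (simp_all add: poly_scale_def Const_def algebra_simps single_add mult_single
          flip: mult.assoc)
  qed (subst inj[symmetric], simp add: act' add sc diff act_add_left act_add_right
        act_scale_left act_scale_right act_bracket)+
  moreover have iso': "free_iso poly_scale act' b id"
    by (simp add: free_iso_def act'_def flip: var) (metis inj surj)
  ultimately have "act' \<in> objects_M scl br b"
    by (auto simp: objects_M_def category_M_def)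
  from that[OF this bij add sc act'] show ?thesis .
qed

lemma sum_keys_superset:
  assumes "finite K" "Poly_Mapping.keys u \<subseteq> K" "\<And>a. f a 0 = 0"
  shows "(\<Sum>a\<in>Poly_Mapping.keys u. f a (Poly_Mapping.lookup u a)) =
    (\<Sum>a\<in>K. f a (Poly_Mapping.lookup u a))"
  using assms by (intro sum.mono_neutral_left) (auto simp: in_keys_iff)

lemma sum_keys_add:
  fixes u v :: "'i \<Rightarrow>\<^sub>0 'g::ab_group_add" and f :: "'i \<Rightarrow> 'g \<Rightarrow> 'c::ab_group_add"
  assumes add: "\<And>a z w. f a (z + w) = f a z + f a w"
  shows "(\<Sum>a\<in>Poly_Mapping.keys (u + v). f a (Poly_Mapping.lookup (u + v) a)) =
    (\<Sum>a\<in>Poly_Mapping.keys u. f a (Poly_Mapping.lookup u a)) +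
    (\<Sum>a\<in>Poly_Mapping.keys v. f a (Poly_Mapping.lookup v a))"
proof -
  have 0: "f a 0 = 0" for a
    using add[of a 0 0] by simp
  let ?K = "Poly_Mapping.keys u \<union> Poly_Mapping.keys v"
  have *: "(\<Sum>a\<in>Poly_Mapping.keys w. f a (Poly_Mapping.lookup w a)) =
      (\<Sum>a\<in>?K. f a (Poly_Mapping.lookup w a))" if "Poly_Mapping.keys w \<subseteq> ?K" for w
    by (rule sum_keys_superset) (use that 0 in auto)
  show ?thesis
    unfolding *[OF keys_add] *[OF Un_upper1] *[OF Un_upper2]
    by (simp add: lookup_add add sum.distrib)
qed

lemma bisum_add_left:
  fixes u u' v :: "'i \<Rightarrow>\<^sub>0 'g::ab_group_add" and f :: "'i \<Rightarrow> 'i \<Rightarrow> 'g \<Rightarrow> 'g \<Rightarrow> 'c::ab_group_add"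
  assumes "\<And>a b z z' w. f a b (z + z') w = f a b z w + f a b z' w"
  shows "(\<Sum>a\<in>Poly_Mapping.keys (u + u'). \<Sum>b\<in>Poly_Mapping.keys v.
      f a b (Poly_Mapping.lookup (u + u') a) (Poly_Mapping.lookup v b)) =
    (\<Sum>a\<in>Poly_Mapping.keys u. \<Sum>b\<in>Poly_Mapping.keys v.
      f a b (Poly_Mapping.lookup u a) (Poly_Mapping.lookup v b)) +
    (\<Sum>a\<in>Poly_Mapping.keys u'. \<Sum>b\<in>Poly_Mapping.keys v.
      f a b (Poly_Mapping.lookup u' a) (Poly_Mapping.lookup v b))"
  by (rule sum_keys_add[where f = "\<lambda>a z. \<Sum>b\<in>Poly_Mapping.keys v. f a b z (Poly_Mapping.lookup v b)"])
    (simp add: assms sum.distrib)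

lemma bisum_add_right:
  fixes u v v' :: "'i \<Rightarrow>\<^sub>0 'g::ab_group_add" and f :: "'i \<Rightarrow> 'i \<Rightarrow> 'g \<Rightarrow> 'g \<Rightarrow> 'c::ab_group_add"
  assumes "\<And>a b z w w'. f a b z (w + w') = f a b z w + f a b z w'"
  shows "(\<Sum>a\<in>Poly_Mapping.keys u. \<Sum>b\<in>Poly_Mapping.keys (v + v').
      f a b (Poly_Mapping.lookup u a) (Poly_Mapping.lookup (v + v') b)) =
    (\<Sum>a\<in>Poly_Mapping.keys u. \<Sum>b\<in>Poly_Mapping.keys v.
      f a b (Poly_Mapping.lookup u a) (Poly_Mapping.lookup v b)) +
    (\<Sum>a\<in>Poly_Mapping.keys u. \<Sum>b\<in>Poly_Mapping.keys v'.
      f a b (Poly_Mapping.lookup u a) (Poly_Mapping.lookup v' b))"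
proof -
  have "(\<Sum>b\<in>Poly_Mapping.keys (v + v'). f a b z (Poly_Mapping.lookup (v + v') b)) =
    (\<Sum>b\<in>Poly_Mapping.keys v. f a b z (Poly_Mapping.lookup v b)) +
    (\<Sum>b\<in>Poly_Mapping.keys v'. f a b z (Poly_Mapping.lookup v' b))" for a z
    by (rule sum_keys_add) (simp add: assms)
  then show ?thesis
    by (simp add: sum.distrib)
qed

lemma pairing_add_left: "pairing (d + e) a = pairing d a + pairing e a"
  by (simp add: pairing_def distrib_right sum.distrib)

lemma pairing_add_right: "pairing d (a + b) = pairing d a + pairing d b"
  by (simp add: pairing_def distrib_left sum.distrib)

lemma pairing_scale: "pairing (c *s d) a = c * pairing d a"
  by (simp add: pairing_def sum_distrib_left mult.assoc)

lemma KA_deriv_add_right: "KA_deriv d (k + l) = KA_deriv d k + KA_deriv d l"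
  by transfer (simp add: Omega_deriv_add Omega.subspace_0[OF subspace_dA])

lemma KA_deriv_scale_right: "KA_deriv d (KA_scale c k) = KA_scale c (KA_deriv d k)"
  by transfer (simp add: Omega_deriv_scale Omega.subspace_0[OF subspace_dA])

lemma Omega_deriv_add_left: "Omega_deriv (d + e) u = Omega_deriv d u + Omega_deriv e u"
  by (simp add: Omega_deriv_def vec_eq_iff poly_mapping_eq_iff fun_eq_iff lookup_mapp' lookup_add
      pairing_add_left algebra_simps)

lemma Omega_deriv_scale_left: "Omega_deriv (c *s d) u = Omega_scale c (Omega_deriv d u)"
  by (simp add: Omega_deriv_def Omega_scale_def vec_eq_iff poly_mapping_eq_iff fun_eq_iff
      lookup_mapp' lookup_single_mult pairing_scale)

lemma Omega_deriv_commute: "Omega_deriv d (Omega_deriv e u) = Omega_deriv e (Omega_deriv d u)"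
  by (simp add: Omega_deriv_def vec_eq_iff poly_mapping_eq_iff fun_eq_iff lookup_mapp')

lemma KA_deriv_add_left: "KA_deriv (d + e) k = KA_deriv d k + KA_deriv e k"
  by transfer (simp add: Omega_deriv_add_left Omega.subspace_0[OF subspace_dA])

lemma KA_deriv_scale_left: "KA_deriv (c *s d) k = KA_scale c (KA_deriv d k)"
  by transfer (simp add: Omega_deriv_scale_left Omega.subspace_0[OF subspace_dA])

lemma KA_deriv_commute: "KA_deriv d (KA_deriv e k) = KA_deriv e (KA_deriv d k)"
  by transfer (subst Omega_deriv_commute, simp add: Omega.subspace_0[OF subspace_dA])

lemma KA_deriv_gen: "KA_deriv d (KA_gen a j) = KA_scale (pairing d a) (KA_gen a j)"
  by transfer (simp add: Omega_deriv_gen Omega.subspace_0[OF subspace_dA])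

lemma KA_deriv_0: "KA_deriv d 0 = 0" "KA_deriv 0 k = 0"
  using KA_deriv_add_right[of d 0 0] KA_deriv_add_left[of 0 0 k] by simp_all

lemma KA_deriv_minus: "KA_deriv d (- k) = - KA_deriv d k"
  using KA_deriv_add_right[of d "- k" k] by (simp add: KA_deriv_0 eq_neg_iff_add_eq_0)

lemma KA_deriv_sum: "KA_deriv d (sum f S) = (\<Sum>i\<in>S. KA_deriv d (f i))"
  by (induction S rule: infinite_finite_induct) (simp_all add: KA_deriv_add_right KA_deriv_0)

definition KA_lin :: "int^'n \<Rightarrow> int^'n \<Rightarrow> 'n::finite KA" where
  "KA_lin a m = (\<Sum>i\<in>UNIV. KA_scale (of_int (a $ i)) (KA_gen m i))"

lemma KA_lin_self: "KA_lin m (m :: int^'n::finite) = 0"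
proof -
  have "(\<Sum>i\<in>S. KA_scale (of_int (a $ i)) (KA_gen m i)) =
    abs_KA (\<Sum>i\<in>S. Omega_scale (of_int (a $ i)) (Omega_gen m i))" for S and a m :: "int^'n"
    by (induction S rule: infinite_finite_induct)
      (simp_all add: zero_KA.abs_eq plus_KA.abs_eq[symmetric] KA_scale.abs_eq KA_gen.abs_eq)
  moreover have "(\<Sum>i\<in>UNIV. Omega_scale (of_int (m $ i)) (Omega_gen m i)) \<in> dA"
    unfolding dA_def by (rule Omega.span_base) blast
  then have "abs_KA (\<Sum>i\<in>UNIV. Omega_scale (of_int (m $ i)) (Omega_gen m i)) = 0"
    by (simp add: zero_KA_def KA.abs_eq_iff)
  ultimately show ?thesis
    by (simp add: KA_lin_def)
qed

lemma KA_lin_add: "KA_lin (a + b) m = KA_lin a m + KA_lin b m"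
  by (simp add: KA_lin_def KA.scale_left_distrib sum.distrib)

lemma KA_deriv_lin: "KA_deriv d (KA_lin a m) = KA_scale (pairing d m) (KA_lin a m)"
  by (simp add: KA_lin_def KA_deriv_sum KA_deriv_scale_right KA_deriv_gen KA.scale_sum_right mult.commute)

lemma poly_mapping_additive_induct [case_names single add]:
  fixes u :: "'i \<Rightarrow>\<^sub>0 'g::ab_group_add"
  assumes single: "\<And>a z. P (Poly_Mapping.single a z)"
    and add: "\<And>u v. P u \<Longrightarrow> P v \<Longrightarrow> P (u + v)"
  shows "P u"
proof (induction u rule: update_induct)
  case const
  show ?case using single[of undefined 0] by simp
next
  case (update f a b)
  have "Poly_Mapping.update a b f = f + Poly_Mapping.single a b"
    using update by (auto simp: poly_mapping_eq_iff fun_eq_iff lookup_update lookup_add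
        lookup_single in_keys_iff)
  then show ?case using add[OF update.IH single] by simp
qed

lemma toroidal_additive_induct [case_names loop center deriv add]:
  fixes X :: "('g::ab_group_add, 'n::finite) toroidal"
  assumes loop: "\<And>z a. P (loop z a)" and center: "\<And>k. P (0, k, 0)" and deriv: "\<And>d. P (0, 0, d)"
    and add: "\<And>X Y. P X \<Longrightarrow> P Y \<Longrightarrow> P (X + Y)"
  shows "P X"
proof -
  obtain u k d where X: "X = (u, k, d)" by (cases X) auto
  have "P (u, 0, 0)"
  proof (induction u rule: poly_mapping_additive_induct)
    case (single a z)
    show ?case using loop[of z a] by (simp add: loop_def)
  next
    case (add u v)
    then show ?case using assms(4)[OF add] by simp
  qed
  from add[OF add[OF this center[of k]] deriv[of d]] show ?thesis
    by (simp add: X)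
qed

lemma vec_scale_zero: "c *s (0 :: complex^'n) = 0"
  by (simp add: vec_eq_iff)

context lie_algebra
begin

lemma bracket_0 [simp]: "bracket 0 u = 0" "bracket u 0 = 0"
  using bracket_add_left[of 0 0 u] bracket_add_right[of u 0 0] by simp_all

lemma bracket_antisym: "bracket v u = - bracket u v"
proof -
  have "bracket u v + bracket v u = bracket (u + v) (u + v)"
    by (simp add: bracket_add_left bracket_add_right bracket_self[of u] bracket_self[of v])
  then show ?thesis
    by (simp add: bracket_self eq_neg_iff_add_eq_0 add.commute)
qed

lemma bracket_minus: "bracket (- u) v = - bracket u v" "bracket u (- v) = - bracket u v"
  using bracket_add_left[of "- u" u v] bracket_add_right[of u "- v" v]
  by (simp_all add: eq_neg_iff_add_eq_0)

lemma bracket_diff: "bracket (u - w) v = bracket u v - bracket w v"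
    "bracket u (v - w) = bracket u v - bracket u w"
  using bracket_add_left[of u "- w" v] bracket_add_right[of u v "- w"] by (simp_all add: bracket_minus)

lemma loop_deriv_add_left: "loop_deriv (d + e) u = loop_deriv d u + loop_deriv e u"
  by (simp add: loop_deriv_def poly_mapping_eq_iff fun_eq_iff lookup_mapp' lookup_add
      pairing_add_left scale_left_distrib)

lemma loop_deriv_add_right: "loop_deriv d (u + v) = loop_deriv d u + loop_deriv d v"
  by (simp add: loop_deriv_def poly_mapping_eq_iff fun_eq_iff lookup_mapp' lookup_add
      scale_right_distrib)

lemma loop_deriv_0 [simp]: "loop_deriv d 0 = 0" "loop_deriv 0 u = 0"
  using loop_deriv_add_right[of d 0 0] loop_deriv_add_left[of 0 0 u] by simp_all

lemma loop_deriv_single: "loop_deriv d (Poly_Mapping.single a z) =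
    Poly_Mapping.single a (scale (pairing d a) z)"
  by (auto simp add: loop_deriv_def poly_mapping_eq_iff fun_eq_iff lookup_mapp' lookup_single when_def)

lemma toroidal_scale_simps:
  "toroidal_scale c (u, k, d) = (Poly_Mapping.map (scale c) u, KA_scale c k, c *s d)"
  "toroidal_scale c (loop z a) = loop (scale c z) a"
  by (auto simp: toroidal_scale_def loop_def vec_scale_zero poly_mapping_eq_iff fun_eq_iff lookup_map'
      lookup_single when_def)

lemma map_scale: 
  "Poly_Mapping.map (scale c) (u + v) = Poly_Mapping.map (scale c) u + Poly_Mapping.map (scale c) v"
  "Poly_Mapping.map (scale (b + c)) u = Poly_Mapping.map (scale b) u + Poly_Mapping.map (scale c) u"
  "Poly_Mapping.map (scale b) (Poly_Mapping.map (scale c) u) = Poly_Mapping.map (scale (b * c)) u"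
  "Poly_Mapping.map (scale 1) u = u"
  by (auto simp: poly_mapping_eq_iff fun_eq_iff lookup_map' lookup_add scale_left_distrib
    scale_right_distrib)

lemma toroidal_vector_space:
  "vector_space (toroidal_scale :: complex \<Rightarrow> ('g, 'n::finite) toroidal \<Rightarrow> _)"
  by unfold_locales
    (auto simp: toroidal_scale_def map_scale KA.scale_right_distrib KA.scale_left_distrib
       vec_eq_iff algebra_simps)

end

context fd_lie_algebra
begin

lemma ex_trace_basis: "\<exists>B. finite B \<and> independent B \<and> span B = UNIV \<and>
    (\<forall>f. linear_trace f = (\<Sum>b\<in>B. representation B (f b) b))"
proof -
  define B where "B = (SOME B. independent B \<and> span B = UNIV)"
  have "\<exists>B. independent B \<and> span B = UNIV"
    using maximal_independent_subset[of UNIV] by (metis top.extremum_unique)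
  then have B: "independent B" "span B = UNIV"
    unfolding B_def by (smt (verit) someI_ex)+
  moreover have "finite B"
    using finite_dim independent_span_bound B by (metis subset_UNIV)
  ultimately show ?thesis
    by (auto simp: linear_trace_def B_def[symmetric] intro!: exI[of _ B])
qed

lemma linear_trace_commute:
  assumes f: "Vector_Spaces.linear scale scale f" and g: "Vector_Spaces.linear scale scale g"
  shows "linear_trace (\<lambda>w. f (g w)) = linear_trace (\<lambda>w. g (f w))"
proof -
  obtain B where fin: "finite B" and B: "independent B" "span B = UNIV"
    and tr: "\<And>f. linear_trace f = (\<Sum>b\<in>B. representation B (f b) b)"
    using ex_trace_basis by auto
  have *: "representation B (p (q b)) b = (\<Sum>c\<in>B. representation B (q b) c * representation B (p c) b)"
    if "Vector_Spaces.linear scale scale p" for p q :: "'a \<Rightarrow> 'a" and b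
  proof -
    interpret p: Vector_Spaces.linear scale scale p by fact
    have "q b = (\<Sum>c\<in>B. scale (representation B (q b) c) c)"
      using sum_representation_eq[OF B(1) _ fin order_refl, of "q b"] B(2) by simp
    then have "p (q b) = (\<Sum>c\<in>B. scale (representation B (q b) c) (p c))"
      by (metis (no_types, lifting) p.scale p.sum sum.cong)
    then show ?thesis
      using B by (simp add: representation_sum representation_scale)
  qed
  show ?thesis
    unfolding tr *[OF f, of g] *[OF g, of f]
    by (subst sum.swap) (simp add: mult.commute)
qed

lemma linear_trace_diff: "linear_trace (\<lambda>w. f w - g w) = linear_trace f - linear_trace g"
  using ex_trace_basis by (auto simp: representation_diff sum_subtractf)

lemma linear_trace_add: "linear_trace (\<lambda>w. f w + g w) = linear_trace f + linear_trace g"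
  using ex_trace_basis by (auto simp: representation_add sum.distrib)

lemma linear_trace_scale: "linear_trace (\<lambda>w. scale c (f w)) = c * linear_trace f"
  using ex_trace_basis by (auto simp: representation_scale sum_distrib_left)

lemma linear_bracket: "Vector_Spaces.linear scale scale (bracket u)"
  by unfold_locales (simp_all add: bracket_add_right bracket_scale_right)

lemma bracket_bracket: "bracket (bracket u v) w = bracket u (bracket v w) - bracket v (bracket u w)"
  using jacobi[of u v w] bracket_antisym[of w u] bracket_antisym[of w "bracket u v"]
  by (simp add: bracket_minus algebra_simps eq_neg_iff_add_eq_0)

lemma killing_commute: "killing u v = killing v u"
  unfolding killing_def by (rule linear_trace_commute) (rule linear_bracket)+

lemma killing_bracket: "killing (bracket u v) w = killing u (bracket v w)"
proof -
  have "Vector_Spaces.linear scale scale (\<lambda>z. bracket u (bracket w z))"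
    by unfold_locales (simp_all add: bracket_add_right bracket_scale_right)
  from linear_trace_commute[OF linear_bracket this, of v]
  show ?thesis
    by (simp add: killing_def bracket_bracket bracket_diff linear_trace_diff)
qed

lemma killing_add: "killing (u + v) w = killing u w + killing v w"
    "killing u (v + w) = killing u v + killing u w"
  by (simp_all add: killing_def bracket_add_left bracket_add_right linear_trace_add)

lemma killing_scale: "killing (scale c u) w = c * killing u w"
    "killing u (scale c w) = c * killing u w"
  by (simp_all add: killing_def bracket_scale_left bracket_scale_right linear_trace_scale)

lemma killing_0: "killing 0 w = 0" "killing u 0 = 0"
  using killing_add[of 0 0 w] killing_add(2)[of u 0 0] by simp_all

lemma toroidal_bracket_eq:
  "toroidal_bracket (u, k, d) (v, l, e) =
     ((\<Sum>a\<in>Poly_Mapping.keys u. \<Sum>b\<in>Poly_Mapping.keys v.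
         Poly_Mapping.single (a + b)
           (bracket (Poly_Mapping.lookup u a) (Poly_Mapping.lookup v b)))
        + loop_deriv d v - loop_deriv e u,
      (\<Sum>a\<in>Poly_Mapping.keys u. \<Sum>b\<in>Poly_Mapping.keys v.
         KA_scale (killing (Poly_Mapping.lookup u a) (Poly_Mapping.lookup v b)) (KA_lin a (a + b)))
        + KA_deriv d l - KA_deriv e k,
      0)"
  by (simp add: toroidal_bracket_def KA_lin_def)

lemma toroidal_bracket_add_left:
  "toroidal_bracket (X + X') Y = toroidal_bracket X Y + toroidal_bracket X' Y"
proof -
  obtain u k d u' k' d' v l e where [simp]: "X = (u, k, d)" "X' = (u', k', d')" "Y = (v, l, e)"
    by (cases X, cases X', cases Y) auto
  show ?thesis
    by (simp add: toroidal_bracket_eq bisum_add_left[where f = "\<lambda>a b z w. Poly_Mapping.single (a + b) (bracket z w)"]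
      bisum_add_left[where f = "\<lambda>a b z w. KA_scale (killing z w) (KA_lin a (a + b))"]
      bracket_add_left single_add killing_add KA.scale_left_distrib loop_deriv_add_left
      loop_deriv_add_right KA_deriv_add_left KA_deriv_add_right)
qed

lemma toroidal_bracket_add_right:
  "toroidal_bracket Y (X + X') = toroidal_bracket Y X + toroidal_bracket Y X'"
proof -
  obtain u k d u' k' d' v l e where [simp]: "X = (u, k, d)" "X' = (u', k', d')" "Y = (v, l, e)"
    by (cases X, cases X', cases Y) auto
  show ?thesis
    by (simp add: toroidal_bracket_eq bisum_add_right[where f = "\<lambda>a b z w. Poly_Mapping.single (a + b) (bracket z w)"]
      bisum_add_right[where f = "\<lambda>a b z w. KA_scale (killing z w) (KA_lin a (a + b))"]
      bracket_add_right single_add killing_add KA.scale_left_distrib loop_deriv_add_left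
      loop_deriv_add_right KA_deriv_add_left KA_deriv_add_right)
qed

lemma toroidal_bracket_loop_loop:
  "toroidal_bracket (loop z a) (loop w b) =
     loop (bracket z w) (a + b) +
     toroidal_scale (killing z w) (\<Sum>i\<in>UNIV. toroidal_scale (of_int (a $ i)) (central (a + b) i))"
proof -
  have *: "(\<Sum>i\<in>S. toroidal_scale (f i) (central m i)) = (0, \<Sum>i\<in>S. KA_scale (f i) (KA_gen m i), 0)"
    for S :: "'n::finite set" and f and m :: "int^'n"
    by (induction S rule: infinite_finite_induct)
      (simp_all add: central_def toroidal_scale_def vec_scale_zero zero_prod_def)
  show ?thesis unfolding *
    by (auto simp: loop_def toroidal_bracket_eq killing_0 KA_deriv_0 toroidal_scale_def vec_scale_zero KA_lin_def)
qed

lemma toroidal_bracket_loop_loop':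
  "toroidal_bracket (loop z a) (loop w b) =
     loop (bracket z w) (a + b) + (0, KA_scale (killing z w) (KA_lin a (a + b)), 0)"
    by (auto simp: loop_def toroidal_bracket_eq killing_0 KA_deriv_0)

lemma toroidal_bracket_center [simp]:
  "toroidal_bracket (loop z a) (0, k, 0) = 0" "toroidal_bracket (0, k, 0) (loop z a) = 0"
  "toroidal_bracket (0, k, 0) (0, l, 0) = 0"
  "toroidal_bracket (0, 0, d) (0, k, 0) = (0, KA_deriv d k, 0)"
  "toroidal_bracket (0, k, 0) (0, 0, d) = (0, - KA_deriv d k, 0)"
  by (simp_all add: loop_def toroidal_bracket_eq KA_deriv_0 zero_prod_def)

lemma toroidal_bracket_deriv [simp]:
  "toroidal_bracket (0, 0, d) (loop z a) = loop (scale (pairing d a) z) a"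
  "toroidal_bracket (loop z a) (0, 0, d) = loop (- scale (pairing d a) z) a"
  "toroidal_bracket (0, 0, d) (0, 0, e) = 0"
  by (simp_all add: loop_def toroidal_bracket_eq KA_deriv_0 zero_prod_def loop_deriv_single single_uminus)

lemma toroidal_bracket_deg_deriv:
  "toroidal_bracket (deg_deriv i) (loop z a) = toroidal_scale (of_int (a $ i)) (loop z a)"
  "toroidal_bracket (deg_deriv i) (central a j) = toroidal_scale (of_int (a $ i)) (central a j)"
  "toroidal_bracket (deg_deriv i) (deg_deriv j) = 0"
  "toroidal_bracket (loop z a) (central b j) = 0"
  "toroidal_bracket (central a i) (central b j) = 0"
proof -
  have "pairing (axis i 1) a = of_int (a $ i)"
    by (simp add: pairing_def axis_def if_distrib[of "\<lambda>x. x * _"] cong: if_cong)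
  then show "toroidal_bracket (deg_deriv i) (loop z a) = toroidal_scale (of_int (a $ i)) (loop z a)"
    "toroidal_bracket (deg_deriv i) (central a j) = toroidal_scale (of_int (a $ i)) (central a j)"
    by (auto simp: deg_deriv_def central_def toroidal_scale_simps KA_deriv_gen vec_scale_zero)
qed (auto simp: deg_deriv_def central_def)


lemma toroidal_bracket_scale:
  "toroidal_bracket (toroidal_scale c X) Y = toroidal_scale c (toroidal_bracket X Y)"
  "toroidal_bracket X (toroidal_scale c Y) = toroidal_scale c (toroidal_bracket X Y)"
proof -
  interpret T: vector_space "toroidal_scale :: complex \<Rightarrow> ('a, 'b::finite) toroidal \<Rightarrow> _"
    by (rule toroidal_vector_space)
  have s: "toroidal_scale c (0, k, 0) = (0, KA_scale c k, 0)"
    "toroidal_scale c (0, 0, d) = (0, 0, c *s d)" for c k and d :: "complex^'n::finite"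
    by (simp_all add: toroidal_scale_def vec_scale_zero)
  have *: "toroidal_bracket (toroidal_scale c X) Y = toroidal_scale c (toroidal_bracket X Y) \<and>
    toroidal_bracket X (toroidal_scale c Y) = toroidal_scale c (toroidal_bracket X Y)"
  proof (induction X rule: toroidal_additive_induct)
    case (loop z a)
    show ?case
      by (induction Y rule: toroidal_additive_induct)
        (auto simp: s toroidal_scale_simps toroidal_bracket_loop_loop' T.scale_right_distrib
          toroidal_bracket_add_right bracket_scale_left bracket_scale_right killing_scale
          pairing_scale mult.commute)
  next
    case (center k)
    show ?case
      by (induction Y rule: toroidal_additive_induct)
        (auto simp: s toroidal_scale_simps T.scale_right_distrib toroidal_bracket_add_right
          KA_deriv_scale_left KA_deriv_scale_right)
  next
    case (deriv d)
    show ?case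
      by (induction Y rule: toroidal_additive_induct)
        (auto simp: s toroidal_scale_simps T.scale_right_distrib toroidal_bracket_add_right
          KA_deriv_scale_left KA_deriv_scale_right pairing_scale mult.commute)
  next
    case (add X X')
    then show ?case
      by (simp add: T.scale_right_distrib toroidal_bracket_add_left)
  qed
  then show "toroidal_bracket (toroidal_scale c X) Y = toroidal_scale c (toroidal_bracket X Y)"
    "toroidal_bracket X (toroidal_scale c Y) = toroidal_scale c (toroidal_bracket X Y)"
    by auto
qed

lemma loop_add: "loop (z + w) a = loop z a + loop w a"
  and loop_minus: "loop (- z) a = - loop z a"
  and loop_diff: "loop (z - w) a = loop z a - loop w a"
  and loop_0: "loop 0 a = 0"
  by (simp_all add: loop_def single_add single_uminus single_diff zero_prod_def)

lemma KA_lin_commute: "KA_lin b (a + b) = - KA_lin a (a + b)"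
  using KA_lin_self[of "a + b"] unfolding KA_lin_add[of a b] by (simp add: eq_neg_iff_add_eq_0 add.commute)

lemma toroidal_bracket_antisym:
  "toroidal_bracket Y X = - toroidal_bracket X Y"
proof (induction X rule: toroidal_additive_induct)
  case (loop z a)
  show ?case
    by (induction Y rule: toroidal_additive_induct)
      (simp_all add: toroidal_bracket_loop_loop' toroidal_bracket_add_right toroidal_bracket_add_left
        bracket_antisym[of z] killing_commute[of z] loop_minus KA_lin_commute add.commute)
next
  case (center k)
  show ?case
    by (induction Y rule: toroidal_additive_induct)
      (simp_all add: toroidal_bracket_add_right toroidal_bracket_add_left add.commute)
next
  case (deriv d)
  show ?case
    by (induction Y rule: toroidal_additive_induct)
      (simp_all add: toroidal_bracket_add_right toroidal_bracket_add_left loop_minus add.commute)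
next
  case (add X X')
  then show ?case
    by (simp add: toroidal_bracket_add_left toroidal_bracket_add_right)
qed


theorem lie_algebra_toroidal:
  "lie_algebra (toroidal_scale :: complex \<Rightarrow> ('a, 'n::finite) toroidal \<Rightarrow> _) toroidal_bracket"
proof -
  interpret T: vector_space "toroidal_scale :: complex \<Rightarrow> ('a, 'n::finite) toroidal \<Rightarrow> _"
    by (rule toroidal_vector_space)
  define J where "J X Y Z = toroidal_bracket X (toroidal_bracket Y Z) +
     toroidal_bracket Y (toroidal_bracket Z X) + toroidal_bracket Z (toroidal_bracket X Y)"
    for X Y Z :: "('a, 'n) toroidal"
  have Jadd: "J (X + X') Y Z = J X Y Z + J X' Y Z" "J Y (X + X') Z = J Y X Z + J Y X' Z"
    "J Y Z (X + X') = J Y Z X + J Y Z X'" for X X' Y Z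
    by (simp_all add: J_def toroidal_bracket_add_left toroidal_bracket_add_right)
  have cycle: "J X Y Z = J Y Z X" for X Y Z
    by (simp add: J_def add_ac)
  have brk: "toroidal_bracket (X + X') Y = toroidal_bracket X Y + toroidal_bracket X' Y"
     "toroidal_bracket Y (X + X') = toroidal_bracket Y X + toroidal_bracket Y X'" for X X' Y :: "('a, 'n) toroidal"
    by (simp_all add: toroidal_bracket_add_left toroidal_bracket_add_right)
  have tb0: "toroidal_bracket X 0 = 0" "toroidal_bracket 0 X = 0" for X :: "('a, 'n) toroidal"
    using toroidal_bracket_add_left[of 0 0 X] toroidal_bracket_add_right[of X 0 0] by simp_all
  have LLL: "J (loop z a) (loop w b) (loop v c) = 0" for z w v and a b c :: "int^'n"
  proof -
    have k: "killing w (bracket v z) = killing z (bracket w v)"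
      "killing v (bracket z w) = killing z (bracket w v)"
      using killing_bracket[of z w v] killing_bracket[of w v z]
      by (simp_all add: killing_commute)
    have "J (loop z a) (loop w b) (loop v c) =
       loop (bracket z (bracket w v) + bracket w (bracket v z) + bracket v (bracket z w)) (a + b + c)
       + (0, KA_scale (killing z (bracket w v)) (KA_lin (a + b + c) (a + b + c)), 0)"
      by (simp add: J_def toroidal_bracket_loop_loop' toroidal_bracket_add_right k loop_add
          KA.scale_right_distrib KA_lin_add add_ac)
    then show ?thesis
      by (simp add: jacobi KA_lin_self loop_0 zero_prod_def)
  qed
  have LLC: "J (loop z a) (loop w b) (0, k, 0) = 0" for z w k and a b :: "int^'n"
    by (simp add: J_def brk tb0 toroidal_bracket_loop_loop')
  have LLD: "J (loop z a) (loop w b) (0, 0, d) = 0" for z w d and a b :: "int^'n"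
  proof -
    have *: "bracket w z = - bracket z w" "killing w z = killing z w" "b + a = a + b"
      "KA_lin b (a + b) = - KA_lin a (a + b)"
      by (rule bracket_antisym killing_commute KA_lin_commute add.commute)+
    have m: "killing z (- u) = - killing z u" for u
      using killing_scale(2)[of z "-1" u] by simp
    have "J (loop z a) (loop w b) (0, 0, d) =
       loop (scale (- pairing d b + - pairing d a + pairing d (a + b)) (bracket z w)) (a + b)
       + (0, KA_scale ((- pairing d b + - pairing d a + pairing d (a + b)) * killing z w)
            (KA_lin a (a + b)), 0)"
      by (simp only: J_def brk toroidal_bracket_loop_loop' toroidal_bracket_deriv
          toroidal_bracket_center KA_deriv_scale_right KA_deriv_lin *)
        (simp add: * m bracket_minus bracket_scale_right killing_scale
          scale_left_distrib scale_left_diff_distrib loop_add loop_minus loop_diff KA.scale_left_distrib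
          KA.scale_left_diff_distrib algebra_simps)
    then show ?thesis
      by (simp add: pairing_add_right loop_0 zero_prod_def)
  qed
  have LCC: "J (loop z a) (0, k, 0) (0, l, 0) = 0" for z k l and a :: "int^'n"
    by (simp add: J_def brk tb0)
  have LCD: "J (loop z a) (0, k, 0) (0, 0, d) = 0" "J (loop z a) (0, 0, d) (0, k, 0) = 0"
    for z k d and a :: "int^'n"
    by (simp_all add: J_def brk tb0)
  have LDD: "J (loop z a) (0, 0, d) (0, 0, e) = 0" for z d e and a :: "int^'n"
    by (simp add: J_def brk tb0 loop_0 mult.commute flip: loop_add)
  have CCC: "J (0, k, 0) (0, l, 0) (0, m, 0) = 0" for k l m
    by (simp add: J_def brk tb0)
  have CCD: "J (0, k, 0) (0, l, 0) (0, 0, d) = 0" for k l d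
    by (simp add: J_def brk tb0)
  have CDD: "J (0, k, 0) (0, 0, d) (0, 0, e) = 0" for k d e
    by (simp add: J_def brk tb0 KA_deriv_minus KA_deriv_commute[of d e] zero_prod_def)
  have DDD: "J (0, 0, d) (0, 0, e) (0, 0, f) = 0" for d e f
    by (simp add: J_def brk tb0)
  have rot: "J Y Z X = 0 \<and> J Z X Y = 0" if "J X Y Z = 0" for X Y Z
    using that cycle by metis
  note all = LLL LLC LLD LCC LCD LDD CCC CCD CDD DDD
  note all = all all[THEN rot]
  have "J X Y Z = 0" for X Y Z
  proof (induction X arbitrary: Y Z rule: toroidal_additive_induct)
    case (loop z a)
    show ?case
    proof (induction Y arbitrary: Z rule: toroidal_additive_induct)
      case (loop w b)
      show ?case
        by (induction Z rule: toroidal_additive_induct) (simp_all add: all Jadd)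
    next
      case (center k)
      show ?case
        by (induction Z rule: toroidal_additive_induct) (simp_all add: all Jadd)
    next
      case (deriv d)
      show ?case
        by (induction Z rule: toroidal_additive_induct) (simp_all add: all Jadd)
    qed (simp add: Jadd)
  next
    case (center k)
    show ?case
    proof (induction Y arbitrary: Z rule: toroidal_additive_induct)
      case (loop w b)
      show ?case
        by (induction Z rule: toroidal_additive_induct) (simp_all add: all Jadd)
    next
      case (center k)
      show ?case
        by (induction Z rule: toroidal_additive_induct) (simp_all add: all Jadd)
    next
      case (deriv d)
      show ?case
        by (induction Z rule: toroidal_additive_induct) (simp_all add: all Jadd)
    qed (simp add: Jadd)
  next
    case (deriv d)
    show ?case
    proof (induction Y arbitrary: Z rule: toroidal_additive_induct)
      case (loop w b)
      show ?case
        by (induction Z rule: toroidal_additive_induct) (simp_all add: all Jadd)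
    next
      case (center k)
      show ?case
        by (induction Z rule: toroidal_additive_induct) (simp_all add: all Jadd)
    next
      case (deriv d)
      show ?case
        by (induction Z rule: toroidal_additive_induct) (simp_all add: all Jadd)
    qed (simp add: Jadd)
  qed (simp add: Jadd)
  moreover have "toroidal_bracket X X = 0" for X :: "('a, 'n) toroidal"
  proof -
    have "toroidal_bracket X X + toroidal_bracket X X = 0"
      using toroidal_bracket_antisym[of X X] by (simp add: eq_neg_iff_add_eq_0)
    then have "toroidal_scale 2 (toroidal_bracket X X) = 0"
      using T.scale_left_distrib[of 1 1 "toroidal_bracket X X"] by simp
    then show ?thesis by simp
  qed
  ultimately show ?thesis
    by (intro lie_algebra.intro toroidal_vector_space lie_algebra_axioms.intro)
      (auto simp: J_def toroidal_bracket_add_left toroidal_bracket_add_right toroidal_bracket_scale)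
qed

end

end

theory Submission
  imports Defs
begin


text \<open>
  Loops on root vectors, loops on Cartan elements and central elements are weight vectors for the
  abelian subalgebra that acts by multiplication. Hence each of them acts by a shift of the
  variables followed by multiplication with one polynomial, its value at \<open>1\<close>
  (\<open>weight_vector_action\<close>). An object of the category thus amounts to families of
  polynomials \<open>X\<^sub>i(a)\<close>, \<open>Y\<^sub>i(a)\<close>, \<open>G\<^sub>i(a)\<close>, the values at \<open>1\<close> of \<open>x\<^sub>i(a)\<close>, \<open>y\<^sub>i(a)\<close>,
  \<open>h\<^sub>i(a)\<close>, and the brackets become polynomial identities between them.

  The heart of the matter is a rank one rigidity statement, \<open>sl2_line.rigid\<close>: \<open>X\<^sub>i(0)\<close> and
  \<open>Y\<^sub>i(0)\<close> do not involve the degree variables \<open>d\<^sub>j\<close>, and \<open>G\<^sub>i(b)\<close> is affine in \<open>H\<^sub>i\<close>. For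
  fixed \<open>i\<close> and \<open>b\<close>, all polynomials are restricted to lines in direction \<open>b\<close> on which the
  other \<open>H\<^sub>j\<close> are constant; they become polynomials in \<open>H = H\<^sub>i\<close> over \<open>\<complex>[t]\<close>, on which \<open>\<tau>\<^bsup>Nb\<^esup>\<close>
  is the translation \<open>t \<mapsto> t - N\<close>. The relation \<open>[x, y] = h\<close> makes \<open>X(H) Y(H - 1)\<close> a quadratic
  polynomial in \<open>H\<close> with leading coefficient \<open>-1\<close>, so the degrees of \<open>X\<close> and \<open>Y\<close> add up to
  \<open>2\<close> and their leading coefficients are complex numbers.
  If \<open>X = c (H + u(t))\<close>, then \<open>[x(0), x(N)] = 0\<close> gives \<open>u(t - N) - u(t) = 1 - deg X\<^sub>N\<close>; these
  integers are additive in \<open>N\<close> and never exceed \<open>1\<close>, so they vanish.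
  If \<open>X\<close> is constant, let \<open>\<delta>\<^sub>N\<close> be the change of \<open>X Y\<close> under the translation by \<open>N\<close>. The brackets
  show that \<open>(\<delta>\<^sub>N - 1)\<^sup>2\<close> is the same polynomial for all \<open>N\<close> with \<open>\<delta>\<^sub>N \<noteq> 0\<close>, and comparing
  \<open>N = -1, 1, 2\<close> leaves only \<open>\<delta> = 0\<close>. If \<open>Y\<close> is constant, the Chevalley involution reduces to
  the previous case.

  After that, \<open>x\<^sub>i(b)\<close>, \<open>y\<^sub>i(b)\<close> and \<open>h\<^sub>i(b)\<close> differ from their values at \<open>b = 0\<close> by one
  multiplier. Comparing the brackets \<open>[x\<^sub>i(b), y\<^sub>i(c)]\<close> and \<open>[h\<^sub>i(b), h\<^sub>i(c)]\<close>, in which the central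
  term has two different coefficients, gives the multiplicativity of the multiplier and the
  vanishing of the centre (\<open>m_mult\<close>, \<open>K_eq_0\<close>); here the Killing form is not zero on
  \<open>h\<^sub>i\<close>. A multiplicative multiplier is an invertible polynomial, hence a complex number, and
  becomes a character of \<open>\<int>\<^sup>n\<close>. Adjacent nodes of the Dynkin diagram have the same
  character, and the diagrams of types A and C are connected. This gives \<open>\<lambda>\<close>, and the
  restriction of the action of \<open>\<gg> \<otimes> 1\<close> to \<open>U(\<hh>)\<close> gives the module over \<open>\<gg>\<close>.

  Conversely, \<open>z(a)\<close> acts on \<open>U(\<hh>) \<otimes> \<complex>[d\<^sub>1, \<dots>, d\<^sub>n]\<close> by \<open>\<lambda>\<^sup>a z \<otimes> \<tau>\<^sup>a\<close>, which is visibly a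
  module; the action is determined by the prescribed formulas because the elements for which they
  are given generate the toroidal Lie algebra (\<open>is_toroidal_module_unique\<close>).
\<close>

section \<open>Homomorphisms out of a polynomial ring\<close>

lemma Const_0 [simp]: "Const 0 = 0"
  and Const_1 [simp]: "Const 1 = 1"
  and Const_add: "Const (a + b) = Const a + Const b"
  and Const_minus: "Const (- a) = - Const a"
  and Const_mult: "Const (a * b) = Const a * Const b"
  by (simp_all add: Const_def single_add mult_single single_uminus)

lemma Const_of_int: "Const (of_int k) = of_int k"
  by (simp add: Const_def)

lemma Const_numeral: "Const (numeral k) = numeral k"
  by (simp add: Const_def)

lemma Const_sum: "Const (sum f S) = (\<Sum>i\<in>S. Const (f i))"
  by (induction S rule: infinite_finite_induct) (simp_all add: Const_add)

lemma Const_eq_iff [simp]: "Const a = Const b \<longleftrightarrow> a = b"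
  by (metis Const_def lookup_single_eq)

lemma vector_space_poly_scale: "vector_space (poly_scale :: complex \<Rightarrow> 'v cpoly \<Rightarrow> _)"
  by unfold_locales (simp_all add: poly_scale_def Const_add Const_mult algebra_simps)

lemma Var_power: "Var v ^ k = Poly_Mapping.single (Poly_Mapping.single v k) 1"
  by (induction k) (simp_all add: Var_def mult_single single_add[symmetric])

lemma monomial_eq_prod:
  "Poly_Mapping.single m (1 :: complex) =
    (\<Prod>v\<in>UNIV. Var v ^ Poly_Mapping.lookup m (v :: 'v::finite))"
proof -
  have *: "(\<Prod>v\<in>S. Var v ^ Poly_Mapping.lookup m v) =
      Poly_Mapping.single (\<Sum>v\<in>S. Poly_Mapping.single v (Poly_Mapping.lookup m v)) 1" for S
    by (induction S rule: infinite_finite_induct)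
      (simp_all add: Var_power mult_single)
  have "(\<Sum>v\<in>UNIV. Poly_Mapping.single v (Poly_Mapping.lookup m v)) = m"
    by (rule poly_mapping_eqI) (simp add: lookup_sum lookup_single when_def)
  then show ?thesis
    by (simp add: *)
qed

lemma monomial_eq_Const_mult: "Poly_Mapping.single m c = Const c * Poly_Mapping.single m 1"
  by (simp add: Const_def mult_single)

lemma cpoly_induct [case_names const var add mult]:
  fixes p :: "'v::finite cpoly"
  assumes const: "\<And>c. P (Const c)" and var: "\<And>v. P (Var v)"
    and add: "\<And>p q. P p \<Longrightarrow> P q \<Longrightarrow> P (p + q)" and mult: "\<And>p q. P p \<Longrightarrow> P q \<Longrightarrow> P (p * q)"
  shows "P p"
proof (induction p rule: poly_mapping_additive_induct)
  case (single m c)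
  have pow: "P (Var v ^ k)" for v k
    by (induction k) (use const[of 1] in \<open>auto intro: var mult\<close>)
  have "P (\<Prod>v\<in>S. Var v ^ Poly_Mapping.lookup m v)" for S
    by (induction S rule: infinite_finite_induct) (use const[of 1] in \<open>auto intro: mult pow\<close>)
  then show ?case
    by (subst monomial_eq_Const_mult) (auto simp: monomial_eq_prod intro: mult const)
qed (rule add)

text \<open>The effect \<open>\<kappa>\<close> on constants is a parameter because three kinds of targets occur: polynomial
  rings, the complex numbers, and polynomials over a line.\<close>

locale cpoly_hom =
  fixes \<kappa> :: "complex \<Rightarrow> 'r::comm_ring_1" and \<phi> :: "'v::finite cpoly \<Rightarrow> 'r"
  assumes add: "\<phi> (p + q) = \<phi> p + \<phi> q"
    and mult: "\<phi> (p * q) = \<phi> p * \<phi> q"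
    and const: "\<phi> (Const c) = \<kappa> c"
    and one: "\<phi> 1 = 1"
begin

lemma zero: "\<phi> 0 = 0"
  using add[of 0 0] by simp

lemma minus: "\<phi> (- p) = - \<phi> p"
  using add[of "- p" p] by (simp add: zero eq_neg_iff_add_eq_0)

lemma diff: "\<phi> (p - q) = \<phi> p - \<phi> q"
  using add[of p "- q"] by (simp add: minus)

lemma sum: "\<phi> (sum f S) = (\<Sum>i\<in>S. \<phi> (f i))"
  by (induction S rule: infinite_finite_induct) (simp_all add: zero add)

lemma prod: "\<phi> (prod f S) = (\<Prod>i\<in>S. \<phi> (f i))"
  by (induction S rule: infinite_finite_induct) (simp_all add: one mult)

lemma power: "\<phi> (p ^ k) = \<phi> p ^ k"
  by (induction k) (simp_all add: one mult)

lemma of_nat: "\<phi> (of_nat k) = of_nat k"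
  by (induction k) (simp_all add: zero one add)

lemma of_int: "\<phi> (of_int k) = of_int k"
  by (cases k) (simp_all add: of_nat minus one add diff)

lemma numeral: "\<phi> (numeral k) = numeral k"
  using of_nat[of "numeral k"] by simp

lemmas simps = zero one add mult const minus diff sum prod power of_nat of_int numeral

end

lemma cpoly_hom_eqI:
  assumes "cpoly_hom \<kappa> \<phi>" "cpoly_hom \<kappa> \<psi>" "\<And>v. \<phi> (Var v) = \<psi> (Var v)"
  shows "\<phi> p = \<psi> p"
proof -
  interpret \<phi>: cpoly_hom \<kappa> \<phi> by fact
  interpret \<psi>: cpoly_hom \<kappa> \<psi> by fact
  show ?thesis
    by (induction p rule: cpoly_induct) (simp_all add: \<phi>.simps \<psi>.simps assms(3))
qed

definition insertion :: "(complex \<Rightarrow> 'r::comm_ring_1) \<Rightarrow> ('v::finite \<Rightarrow> 'r) \<Rightarrow> 'v cpoly \<Rightarrow> 'r" where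
  "insertion \<kappa> f p = (\<Sum>m\<in>Poly_Mapping.keys p.
     \<kappa> (Poly_Mapping.lookup p m) * (\<Prod>v\<in>UNIV. f v ^ Poly_Mapping.lookup m v))"

locale scalar_hom =
  fixes \<kappa> :: "complex \<Rightarrow> 'r::comm_ring_1"
  assumes add: "\<kappa> (a + b) = \<kappa> a + \<kappa> b"
    and mult: "\<kappa> (a * b) = \<kappa> a * \<kappa> b"
    and one: "\<kappa> 1 = 1"
begin

lemma zero: "\<kappa> 0 = 0"
  using add[of 0 0] by simp

lemma insertion_add: "insertion \<kappa> f (p + q) = insertion \<kappa> f p + insertion \<kappa> f q"
  unfolding insertion_def
  by (rule sum_keys_add[where f = "\<lambda>m c. \<kappa> c * (\<Prod>v\<in>UNIV. f v ^ Poly_Mapping.lookup m v)"])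
    (simp add: add algebra_simps)

lemma insertion_single: "insertion \<kappa> f (Poly_Mapping.single m c) =
    \<kappa> c * (\<Prod>v\<in>UNIV. f v ^ Poly_Mapping.lookup m v)"
  by (simp add: insertion_def zero)

sublocale insertion: cpoly_hom \<kappa> "insertion \<kappa> f" for f :: "'v::finite \<Rightarrow> 'r"
proof
  show "insertion \<kappa> f (p + q) = insertion \<kappa> f p + insertion \<kappa> f q" for p q
    by (rule insertion_add)
  show "insertion \<kappa> f (p * q) = insertion \<kappa> f p * insertion \<kappa> f q" for p q
  proof (induction p rule: poly_mapping_additive_induct)
    case (single m c)
    show ?case
    proof (induction q rule: poly_mapping_additive_induct)
      case (single n d)
      show ?case
        by (simp add: insertion_single mult_single mult lookup_add power_add prod.distrib mult_ac)
    qed (simp add: insertion_add algebra_simps)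
  qed (simp add: insertion_add algebra_simps)
  show "insertion \<kappa> f (Const c) = \<kappa> c" for c
    by (simp add: Const_def insertion_single)
  then show "insertion \<kappa> f 1 = 1"
    using one by (metis Const_1)
qed

lemma insertion_Var: "insertion \<kappa> f (Var v) = f v"
proof -
  have "(\<Prod>w\<in>UNIV. f w ^ Poly_Mapping.lookup (Poly_Mapping.single v 1) w) =
      (\<Prod>w\<in>UNIV. if w = v then f w else 1)"
    by (rule prod.cong) (auto simp: lookup_single when_def)
  then show ?thesis
    by (simp add: Var_def insertion_single one)
qed

end

interpretation Const: scalar_hom "Const :: complex \<Rightarrow> 'w cpoly"
  by unfold_locales (simp_all add: Const_add Const_mult)

interpretation ident: scalar_hom "\<lambda>c. c"
  by unfold_locales simp_all

lemma poly_subst_eq_insertion: "poly_subst f = insertion Const f"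
  by (simp add: fun_eq_iff poly_subst_def insertion_def)

lemma cpoly_hom_poly_subst: "cpoly_hom Const (poly_subst f)"
  unfolding poly_subst_eq_insertion by (rule Const.insertion.cpoly_hom_axioms)

lemma poly_subst_Var [simp]: "poly_subst f (Var v) = f v"
  by (simp add: poly_subst_eq_insertion Const.insertion_Var)

lemma cpoly_hom_comp:
  assumes "cpoly_hom Const \<phi>" "cpoly_hom \<kappa> \<psi>"
  shows "cpoly_hom \<kappa> (\<lambda>p. \<psi> (\<phi> p))"
proof -
  interpret \<phi>: cpoly_hom Const \<phi> by fact
  interpret \<psi>: cpoly_hom \<kappa> \<psi> by fact
  show ?thesis
    by unfold_locales (simp_all add: \<phi>.simps \<psi>.simps)
qed

lemma cpoly_hom_ident: "cpoly_hom Const (\<lambda>p. p)"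
  by unfold_locales simp_all

section \<open>Polynomials as functions\<close>

definition eval :: "('v::finite \<Rightarrow> complex) \<Rightarrow> 'v cpoly \<Rightarrow> complex" where
  "eval x = insertion (\<lambda>c. c) x"

interpretation eval: cpoly_hom "\<lambda>c. c" "eval x"
  unfolding eval_def by (rule ident.insertion.cpoly_hom_axioms)

lemma eval_Var [simp]: "eval x (Var v) = x v"
  by (simp add: eval_def ident.insertion_Var)

lemma eval_poly_subst: "eval x (poly_subst f p) = eval (\<lambda>v. eval x (f v)) p"
  by (rule cpoly_hom_eqI[OF cpoly_hom_comp[OF cpoly_hom_poly_subst] eval.cpoly_hom_axioms])
    (auto intro: eval.cpoly_hom_axioms)

text \<open>Some polynomial vanishes at all nodes \<open>N n\<close> except \<open>N m\<close>, and the power sums determine the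
  sum of its values with weights \<open>c\<close>.\<close>

lemma power_sums_eq_0:
  fixes N :: "'m \<Rightarrow> complex"
  assumes fin: "finite S" and inj: "inj_on N S" and zero: "\<And>k. (\<Sum>m\<in>S. c m * N m ^ k) = 0"
    and m: "m \<in> S"
  shows "c m = 0"
proof -
  define q where "q = (\<Prod>n\<in>S - {m}. [:- N n, 1:])"
  have "(\<Sum>n\<in>S. c n * poly q (N n)) = (\<Sum>n\<in>S. \<Sum>k\<le>Polynomial.degree q. coeff q k * (c n * N n ^ k))"
    by (simp add: poly_altdef sum_distrib_left mult_ac)
  also have "\<dots> = (\<Sum>k\<le>Polynomial.degree q. coeff q k * (\<Sum>n\<in>S. c n * N n ^ k))"
    by (subst sum.swap) (simp add: sum_distrib_left)
  also have "\<dots> = 0"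
    by (simp add: zero)
  finally have *: "(\<Sum>n\<in>S. c n * poly q (N n)) = 0" .
  have "poly q (N n) = 0" if "n \<in> S - {m}" for n
    using that fin by (auto simp: q_def poly_prod)
  then have "(\<Sum>n\<in>S. c n * poly q (N n)) = (\<Sum>n\<in>S. if n = m then c m * poly q (N m) else 0)"
    by (intro sum.cong) auto
  then have "c m * poly q (N m) = 0"
    using * fin m by simp
  moreover have "poly q (N m) \<noteq> 0"
    using inj m fin by (auto simp: q_def poly_prod inj_on_def)
  ultimately show ?thesis
    by simp
qed

lemma ex_distinct_primes: "\<exists>f :: 'v::finite \<Rightarrow> nat. inj f \<and> (\<forall>v. prime (f v))"
proof -
  obtain S :: "nat set" where S: "S \<subseteq> {p. prime p}" "finite S" "card S = CARD('v)"
    using infinite_arbitrarily_large[OF primes_infinite] by blast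
  then obtain f :: "'v \<Rightarrow> nat" where "bij_betw f UNIV S"
    by (metis finite_same_card_bij finite_class.finite_UNIV)
  then show ?thesis
    using S(1) by (auto simp: bij_betw_def intro!: exI[of _ f])
qed

text \<open>Substituting powers of distinct primes for the variables, the monomials become powers of
  integers that are pairwise distinct by unique factorization, so that the coefficients are
  separated by \<open>power_sums_eq_0\<close>.\<close>

lemma eval_eq_0_imp_eq_0:
  fixes p :: "'v::finite cpoly"
  assumes "\<And>x. eval x p = 0"
  shows "p = 0"
proof -
  obtain pr :: "'v \<Rightarrow> nat" where pr: "inj pr" "\<And>v. prime (pr v)"
    using ex_distinct_primes by blast
  define N where "N m = (\<Prod>v\<in>UNIV. pr v ^ Poly_Mapping.lookup m v)" for m :: "'v \<Rightarrow>\<^sub>0 nat"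
  have "multiplicity (pr v) (N m) = Poly_Mapping.lookup m v" for v m
  proof -
    have "N m = (\<Prod>p\<in>range pr. p ^ Poly_Mapping.lookup m (inv pr p))"
      unfolding N_def by (subst prod.reindex) (use pr in auto)
    also have "multiplicity (pr v) \<dots> = Poly_Mapping.lookup m v"
      by (subst multiplicity_prod_prime_powers) (use pr in auto)
    finally show ?thesis .
  qed
  then have inj: "inj N"
    by (metis injI poly_mapping_eqI)
  have inj': "inj_on (\<lambda>m. of_nat (N m) :: complex) (Poly_Mapping.keys p)"
    using inj by (auto simp: inj_on_def)
  have "(\<Sum>m\<in>Poly_Mapping.keys p. Poly_Mapping.lookup p m * of_nat (N m) ^ k) = 0" for k
    using assms[of "\<lambda>v. of_nat (pr v) ^ k"]
    by (simp add: eval_def insertion_def N_def power_mult[symmetric] mult.commute prod_power_distrib)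
  note * = power_sums_eq_0[OF finite_keys inj' this]
  show ?thesis
    by (rule poly_mapping_eqI) (use * in \<open>auto simp: in_keys_iff\<close>)
qed

lemma cpoly_eqI:
  fixes p :: "'v::finite cpoly"
  assumes "\<And>x. eval x p = eval x q"
  shows "p = q"
  using eval_eq_0_imp_eq_0[of "p - q"] assms by (simp add: eval.diff)

lemma line_polynomial:
  fixes p :: "'v::finite cpoly" and x u :: "'v \<Rightarrow> complex"
  shows "\<exists>q :: complex poly. \<forall>t. poly q t = eval (\<lambda>v. x v + t * u v) p"
proof (induction p rule: cpoly_induct)
  case (const c)
  show ?case by (intro exI[of _ "[:c:]"]) (simp add: eval.const)
next
  case (var v)
  show ?case by (intro exI[of _ "[:x v, u v:]"]) simp
next
  case (add p q)
  then obtain p' q' where "\<forall>t. poly p' t = eval (\<lambda>v. x v + t * u v) p"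
    "\<forall>t. poly q' t = eval (\<lambda>v. x v + t * u v) q" by blast
  then show ?case by (intro exI[of _ "p' + q'"]) (simp add: eval.add)
next
  case (mult p q)
  then obtain p' q' where "\<forall>t. poly p' t = eval (\<lambda>v. x v + t * u v) p"
    "\<forall>t. poly q' t = eval (\<lambda>v. x v + t * u v) q" by blast
  then show ?case by (intro exI[of _ "p' * q'"]) (simp add: eval.mult)
qed

text \<open>On the line through a point where \<open>p\<close> does not vanish and one where \<open>q\<close> does not vanish,
  both become nonzero polynomials in one variable. Working with lines avoids an order on the
  variables, which an arbitrary finite index type does not have.\<close>

lemma cpoly_mult_eq_0:
  fixes p q :: "'v::finite cpoly"
  assumes "p * q = 0"
  shows "p = 0 \<or> q = 0"
proof (rule ccontr)
  assume "\<not> ?thesis"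
  then obtain x y where x: "eval x p \<noteq> 0" and y: "eval y q \<noteq> 0"
    by (metis eval_eq_0_imp_eq_0)
  obtain p' where p': "\<And>t. poly p' t = eval (\<lambda>v. x v + t * (y v - x v)) p"
    using line_polynomial[where u = "\<lambda>v. y v - x v"] by blast
  obtain q' where q': "\<And>t. poly q' t = eval (\<lambda>v. x v + t * (y v - x v)) q"
    using line_polynomial[where u = "\<lambda>v. y v - x v"] by blast
  have "poly (p' * q') t = 0" for t
    by (simp add: p' q' assms eval.zero flip: eval.mult)
  then have "p' * q' = 0"
    using poly_all_0_iff_0 by blast
  moreover have "poly p' 0 \<noteq> 0" "poly q' 1 \<noteq> 0"
    using x y by (simp_all add: p' q')
  ultimately show False
    by auto
qed

text \<open>A unit of \<open>\<complex>[t]\<close> is constant, so a unit takes the same value at any point as at the origin.\<close>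

lemma cpoly_unit_imp_Const:
  fixes p q :: "'v::finite cpoly"
  assumes "p * q = 1"
  obtains c where "p = Const c" "c \<noteq> 0"
proof -
  have "eval x p = eval (\<lambda>_. 0) p" for x
  proof -
    obtain p' where p': "\<And>t. poly p' t = eval (\<lambda>v. 0 + t * x v) p"
      using line_polynomial[of "\<lambda>_. 0" x p] by blast
    obtain q' where q': "\<And>t. poly q' t = eval (\<lambda>v. 0 + t * x v) q"
      using line_polynomial[of "\<lambda>_. 0" x q] by blast
    have "poly (p' * q') t = poly 1 t" for t
      by (simp add: p' q' assms eval.one flip: eval.mult)
    then have "p' * q' = 1"
      using poly_eq_poly_eq_iff by blast
    then have "p' dvd 1"
      by (metis dvd_triv_left)
    then obtain c where "p' = [:c:]"
      by (rule is_unit_polyE) auto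
    then have "poly p' 1 = poly p' 0"
      by simp
    then show ?thesis
      by (simp add: p')
  qed
  then have "p = Const (eval (\<lambda>_. 0) p)"
    by (intro cpoly_eqI) (simp add: eval.const)
  moreover from this have "eval (\<lambda>_. 0) p \<noteq> 0"
    using assms by (metis Const_0 mult_zero_left zero_neq_one)
  ultimately show ?thesis
    using that by blast
qed


section \<open>Polynomials in one variable over a line\<close>

text \<open>The two highest coefficients of a shifted polynomial are all that enters the comparison of
  degrees below.\<close>

lemma coeff_shift_down_top:
  fixes p :: "'a::comm_ring_1 poly"
  assumes "Polynomial.degree p \<le> Suc n"
  shows "coeff (pcompose p [:-1, 1:]) n = coeff p n - of_nat (Suc n) * coeff p (Suc n)"
  using assms
proof (induction p arbitrary: n)
  case 0
  then show ?case by simp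
next
  case (pCons a p)
  have deg: "Polynomial.degree p \<le> n"
    using pCons.prems by (cases "p = 0") auto
  show ?case
  proof (cases n)
    case 0
    then obtain b where "p = [:b:]"
      using deg degree_0_id[of p] by (metis le_zero_eq)
    then show ?thesis
      using 0 by (simp add: pcompose_pCons)
  next
    case (Suc m)
    have "coeff (pcompose p [:-1, 1:]) n = coeff p n"
      using pCons.IH[of n] deg by (simp add: coeff_eq_0)
    moreover have "coeff (pcompose p [:-1, 1:]) m = coeff p m - of_nat (Suc m) * coeff p (Suc m)"
      using pCons.IH[of m] deg Suc by simp
    ultimately show ?thesis
      using Suc by (simp add: pcompose_pCons coeff_pCons algebra_simps)
  qed
qed

text \<open>A shift invariant polynomial takes the value \<open>p(0)\<close> at all natural numbers.\<close>

lemma shift_invariant_imp_const: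
  fixes p :: "'a::{idom,ring_char_0} poly"
  assumes "pcompose p [:1, 1:] = p"
  shows "p = [:coeff p 0:]"
proof -
  have step: "poly p (1 + x) = poly p x" for x
    using assms by (metis poly_pcompose poly_pCons poly_0 add_0_right mult_zero_right mult_1_right
        add.right_neutral)
  have *: "poly p (of_nat n) = poly p 0" for n
    by (induction n) (simp_all add: step)
  have "infinite (range (of_nat :: nat \<Rightarrow> 'a))"
    by (rule range_inj_infinite) (simp add: inj_def)
  moreover have "range of_nat \<subseteq> {x. poly (p - [:poly p 0:]) x = 0}"
    using * by auto
  ultimately have "p - [:poly p 0:] = 0"
    using poly_roots_finite finite_subset by blast
  then show ?thesis
    by (simp add: poly_0_coeff_0)
qed

text \<open>In \<open>complex poly poly\<close>, the outer variable stands for \<open>H\<^sub>i\<close> and the inner one for the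
  parameter \<open>t\<close> of a line. Then \<open>hdown\<close> and \<open>hup\<close> are \<open>\<sigma>\<^sub>i\<close> and its inverse, and
  \<open>tshift N\<close> is \<open>\<tau>\<^bsup>Nb\<^esup>\<close>.\<close>

abbreviation hdown :: "complex poly poly \<Rightarrow> complex poly poly" where
  "hdown p \<equiv> pcompose p [:-1, 1:]"

abbreviation hup :: "complex poly poly \<Rightarrow> complex poly poly" where
  "hup p \<equiv> pcompose p [:1, 1:]"

definition tshift :: "int \<Rightarrow> complex poly poly \<Rightarrow> complex poly poly" where
  "tshift N = map_poly (\<lambda>q. pcompose q [:- of_int N, 1:])"

lemma hdown_hup [simp]: "hdown (hup p) = p" "hup (hdown p) = p"
  by (simp_all add: pcompose_assoc[symmetric] pcompose_pCons)

lemma coeff_tshift: "coeff (tshift N p) n = pcompose (coeff p n) [:- of_int N, 1:]"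
  by (simp add: tshift_def coeff_map_poly)

lemma tshift_add: "tshift N (p + q) = tshift N p + tshift N q"
  and tshift_diff: "tshift N (p - q) = tshift N p - tshift N q"
  and tshift_minus: "tshift N (- p) = - tshift N p"
  and tshift_mult: "tshift N (p * q) = tshift N p * tshift N q"
  by (simp_all add: poly_eq_iff coeff_tshift pcompose_add pcompose_diff pcompose_uminus coeff_mult
      pcompose_sum pcompose_mult)

lemma tshift_smult: "tshift N (smult a p) = smult (pcompose a [:- of_int N, 1:]) (tshift N p)"
  by (simp add: poly_eq_iff coeff_tshift pcompose_mult)

lemma tshift_tshift: "tshift N (tshift M p) = tshift (N + M) p"
  by (simp add: poly_eq_iff coeff_tshift pcompose_assoc[symmetric] pcompose_pCons algebra_simps)

lemma tshift_0 [simp]: "tshift 0 p = p"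
  by (simp add: poly_eq_iff coeff_tshift)

lemma tshift_pCons [simp]:
  "tshift N (pCons a p) = pCons (pcompose a [:- of_int N, 1:]) (tshift N p)"
  by (simp add: poly_eq_iff coeff_tshift coeff_pCons split: nat.split)

lemma tshift_zero [simp]: "tshift N 0 = 0"
  by (simp add: tshift_def)

lemma pcompose_numeral [simp]: "pcompose (numeral k) q = numeral k"
  by (simp add: numeral_poly)

lemma tshift_numeral [simp]: "tshift N (numeral k) = numeral k"
  by (simp add: numeral_poly)

lemma tshift_one [simp]: "tshift N 1 = 1"
  by (simp add: one_pCons)

lemma pcompose_of_int [simp]: "pcompose (of_int k) q = of_int k"
  by (simp add: of_int_poly)

lemma tshift_pcompose:
  "tshift N (pcompose p [:of_int a, of_int b:]) = pcompose (tshift N p) [:of_int a, of_int b:]"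
  by (induction p) (simp_all add: pcompose_pCons tshift_add tshift_mult tshift_smult)

lemma tshift_hup: "tshift N (hup p) = hup (tshift N p)"
  using tshift_pcompose[of N p 1 1] by simp

text \<open>A translation preserves leading coefficients.\<close>

lemma tshift_eq_uminus:
  assumes "tshift N p = - p"
  shows "p = 0"
proof (rule poly_eqI)
  fix n
  have "pcompose (coeff p n) [:- of_int N, 1:] = - coeff p n"
    using assms by (metis coeff_tshift coeff_minus)
  then have "lead_coeff (coeff p n) = - lead_coeff (coeff p n)"
    using lead_coeff_comp[of "[:- of_int N, 1:]" "coeff p n"] by simp
  then show "coeff p n = coeff 0 n"
    by (simp add: eq_neg_iff_add_eq_0)
qed

section \<open>The rank one case along a line\<close>

text \<open>\<open>X N\<close>, \<open>Y N\<close>, \<open>G N\<close> stand for the values at \<open>1\<close> of \<open>x\<^sub>i(Nb)\<close>, \<open>y\<^sub>i(Nb)\<close>, \<open>h\<^sub>i(Nb)\<close> on a line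
  in direction \<open>b\<close>. The assumptions are brackets without central term: \<open>[x(0), x(N)]\<close>,
  \<open>[y(0), y(N)]\<close>, \<open>[x(0), y(N)]\<close>, \<open>[x(N), y(0)]\<close>, \<open>[h(N), x(M)]\<close> and \<open>[h(N), y(M)]\<close>.\<close>

locale sl2_line =
  fixes X Y G :: "int \<Rightarrow> complex poly poly" and r :: complex
  assumes G0: "G 0 = [:[:r:], 2:]"
    and xx: "X 0 * hdown (X N) = X N * hdown (tshift N (X 0))"
    and yy: "Y 0 * hup (Y N) = Y N * hup (tshift N (Y 0))"
    and xy: "X 0 * hdown (Y N) - Y N * hup (tshift N (X 0)) = G N"
    and yx: "X N * hdown (tshift N (Y 0)) - Y 0 * hup (X N) = G N"
    and hx: "G N * tshift N (X M) - X M * hdown (tshift M (G N)) = 2 * X (M + N)"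
    and hy: "G N * tshift N (Y M) - Y M * hup (tshift M (G N)) = - 2 * Y (M + N)"
begin

text \<open>The products \<open>xy\<close> and \<open>yx\<close> act by \<open>F = X \<sigma>(Y)\<close> and by \<open>\<sigma>\<^sup>-\<^sup>1(F)\<close>. So \<open>[x, y] = h\<close> fixes
  \<open>F - \<sigma>\<^sup>-\<^sup>1(F)\<close>, and thereby \<open>F\<close> up to a term that does not involve \<open>H\<close>.\<close>

lemma casimir:
  obtains c where "X 0 * hdown (Y 0) = [:c, [:1 - r:], -1:]"
proof -
  define F where "F = X 0 * hdown (Y 0)"
  \<comment> \<open>A particular solution of the difference equation for \<open>F\<close>.\<close>
  define Q :: "complex poly poly" where "Q = [:0, [:1 - r:], -1:]"
  have "hup F = hup (X 0) * Y 0"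
    by (simp add: F_def pcompose_mult)
  then have "F - hup F = [:[:r:], 2:]"
    using xy[of 0] by (simp add: F_def G0 mult.commute)
  moreover have "Q - hup Q = [:[:r:], 2:]"
    by (simp add: Q_def pcompose_pCons one_pCons numeral_poly)
  ultimately have "F - hup F = Q - hup Q"
    by simp
  then have "F - Q - hup (F - Q) = 0"
    by (simp add: pcompose_diff algebra_simps)
  then have "F - Q = [:coeff (F - Q) 0:]"
    by (intro shift_invariant_imp_const) simp
  then have "F = Q + [:coeff (F - Q) 0:]"
    by (metis diff_eq_eq add.commute)
  then show ?thesis
    using that[of "coeff (F - Q) 0"] by (simp add: F_def Q_def)
qed

lemma nonzero: "X 0 \<noteq> 0" "Y 0 \<noteq> 0"
proof -
  obtain c where c: "X 0 * hdown (Y 0) = [:c, [:1 - r:], -1:]"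
    by (rule casimir)
  show "X 0 \<noteq> 0" "Y 0 \<noteq> 0"
    using c by auto
qed

lemma degree_sum: "Polynomial.degree (X 0) + Polynomial.degree (Y 0) = 2"
  and lead_coeff_X: "\<exists>a. a \<noteq> 0 \<and> lead_coeff (X 0) = [:a:]"
proof -
  obtain c where c: "X 0 * hdown (Y 0) = [:c, [:1 - r:], -1:]"
    by (rule casimir)
  have "hdown (Y 0) \<noteq> 0"
    using c by auto
  then have "Polynomial.degree (X 0 * hdown (Y 0)) = Polynomial.degree (X 0) + Polynomial.degree (Y 0)"
    using nonzero by (simp add: degree_mult_eq degree_pcompose)
  then show "Polynomial.degree (X 0) + Polynomial.degree (Y 0) = 2"
    using c by simp
  have "lead_coeff (X 0) * lead_coeff (hdown (Y 0)) = lead_coeff (X 0 * hdown (Y 0))"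
    by (rule lead_coeff_mult[symmetric])
  also have "\<dots> = -1"
    by (simp add: c)
  finally have "lead_coeff (X 0) * (- lead_coeff (hdown (Y 0))) = 1"
    by simp
  then have "lead_coeff (X 0) dvd 1"
    by (metis dvd_triv_left)
  then show "\<exists>a. a \<noteq> 0 \<and> lead_coeff (X 0) = [:a:]"
    by (rule is_unit_polyE) auto
qed

lemma X_nonzero: "X N \<noteq> 0"
  using hx[of "- N" N] nonzero by auto

lemma G_nonzero: "G N \<noteq> 0"
  using hx[of N "- N"] nonzero by auto

text \<open>Here \<open>X\<close> is a complex number, and \<open>Z = X Y\<close> is the product that may depend on \<open>t\<close>; its
  increments \<open>d N\<close> along the line have to vanish. All \<open>X N\<close>, \<open>Y N\<close>, \<open>G N\<close> are expressed
  through \<open>Z\<close>, \<open>d N\<close> and the difference \<open>m N\<close> of \<open>G N\<close>, and then \<open>[y(0), y(N)] = 0\<close>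
  becomes the quadratic equation \<open>key\<close> for \<open>d N\<close>.\<close>

lemma rigid_const:
  assumes deg: "Polynomial.degree (X 0) = 0"
  shows "tshift 1 (X 0) = X 0" "tshift 1 (Y 0) = Y 0" 
    "hdown (G 1 - hdown (G 1)) = G 1 - hdown (G 1)"
proof -
  define C where "C = X 0"
  obtain a where "C = [:[:a:]:]"
    using lead_coeff_X deg degree_0_id[of "X 0"] by (metis C_def)
  then have C: "hdown C = C" "hup C = C" "tshift N C = C" for N
    by simp_all
  have C0: "C \<noteq> 0"
    using nonzero by (simp add: C_def)
  show "tshift 1 (X 0) = X 0"
    using C by (simp add: C_def)
  define h where "h = G 0"
  define Z where "Z = C * Y 0"
  define m where "m N = G N - hdown (G N)" for N
  define d where "d N = tshift N Z - Z" for N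
  have h: "hup h = h + 2" "tshift N h = h" for N
    by (simp_all add: h_def G0 pcompose_pCons numeral_poly)
  have hup_prod: "hup (p * q) = hup p * hup q" for p q
    by (rule pcompose_mult)
  have SX: "hdown (X N) = X N" for N
    using xx[of N] C0 by (simp add: C C_def[symmetric])
  have X2: "2 * X N = C * m N" for N
    using hx[of N 0] by (simp add: C C_def[symmetric] m_def algebra_simps)
  have Sm: "hdown (m N) = m N" for N
  proof -
    have "C * hdown (m N) = hdown (2 * X N)"
      by (simp only: X2 pcompose_mult C)
    also have "\<dots> = C * m N"
      by (simp only: X2[symmetric] pcompose_mult SX pcompose_numeral)
    finally show ?thesis
      using C0 by simp
  qed
  then show "hdown (G 1 - hdown (G 1)) = G 1 - hdown (G 1)"
    by (simp add: m_def)
  have S'm: "hup (m N) = m N" for N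
    using Sm by (metis hdown_hup(2))
  have SZ: "hdown Z - Z = h"
    using xy[of 0] by (simp add: C C_def[symmetric] h_def Z_def pcompose_mult mult.commute)
  have S'Z: "hup Z = Z - h - 2"
  proof -
    have "hup (hdown Z - Z) = h + 2"
      by (simp only: SZ h)
    then show ?thesis
      by (simp add: pcompose_diff algebra_simps)
  qed
  have S'd: "hup (d N) = d N" for N
    by (simp add: d_def pcompose_diff S'Z tshift_hup[symmetric] tshift_diff h)
  then have Sd: "hdown (d N) = d N" for N
    by (metis hdown_hup(1))
  have TZ: "tshift N Z = Z + d N" for N
    by (simp add: d_def)
  have S'G: "hup (G N) = G N + m N" for N
    using S'm[of N] by (simp add: m_def pcompose_diff algebra_simps)
  have ZN: "2 * (C * Y N) = m N * Z - G N * d N" for N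
  proof -
    have "G N * tshift N Z - Z * hup (G N) = C * (G N * tshift N (Y 0) - Y 0 * hup (G N))"
      by (simp add: Z_def tshift_mult C algebra_simps)
    also have "\<dots> = - 2 * (C * Y N)"
      using hy[of N 0] by simp
    finally have "G N * tshift N Z - Z * hup (G N) = - 2 * (C * Y N)" .
    then show ?thesis
      by (simp add: S'G TZ algebra_simps)
  qed
  have G2: "2 * G N = m N * (h + d N)" for N
  proof -
    have "hdown (C * Y N) - C * Y N = G N"
      using xy[of N] by (simp add: C C_def[symmetric] pcompose_mult mult.commute)
    then have "2 * G N = 2 * (hdown (C * Y N) - C * Y N)"
      by simp
    also have "\<dots> = hdown (2 * (C * Y N)) - 2 * (C * Y N)"
      by (simp add: pcompose_mult right_diff_distrib)
    also have "\<dots> = m N * (hdown Z - Z) + (G N - hdown (G N)) * d N"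
      by (simp only: ZN pcompose_diff pcompose_mult Sm Sd) (simp add: algebra_simps)
    also have "\<dots> = m N * (h + d N)"
      by (simp add: SZ m_def[symmetric] algebra_simps)
    finally show ?thesis .
  qed
  have m0: "m N \<noteq> 0" for N
    using G2[of N] G_nonzero[of N] by auto
  have Z4: "4 * (C * Y N) = m N * (2 * Z - (h + d N) * d N)" for N
  proof -
    have "4 * (C * Y N) = 2 * (m N * Z) - 2 * G N * d N"
    proof -
      have "4 * (C * Y N) = 2 * (2 * (C * Y N))"
        by simp
      then show ?thesis
        by (simp only: ZN) (simp add: algebra_simps)
    qed
    then show ?thesis
      by (simp only: G2) (simp add: algebra_simps)
  qed
  have key: "4 * Z + (h + 1) * (h + 1) = (d N - 1) * (d N - 1)" if "d N \<noteq> 0" for N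
  proof -
    let ?d = "d N"
    have "C * C * (Y 0 * hup (Y N)) = C * C * (Y N * hup (tshift N (Y 0)))"
      by (simp add: yy[of N])
    then have "Z * hup (C * Y N) = C * Y N * hup (tshift N Z)"
      by (simp add: Z_def pcompose_mult tshift_mult C mult_ac)
    then have "Z * hup (4 * (C * Y N)) = 4 * (C * Y N) * hup (tshift N Z)"
      by (simp add: pcompose_mult)
    then have "Z * (m N * (2 * (Z - h - 2) - (h + 2 + ?d) * ?d)) =
        m N * (2 * Z - (h + ?d) * ?d) * (Z - h - 2 + ?d)"
      by (simp only: Z4 pcompose_mult pcompose_diff pcompose_add pcompose_numeral TZ S'm S'd S'Z h)
    then have "m N * (?d * ((h + ?d) * (Z - h - 2 + ?d) - (h + ?d + 4) * Z)) = 0"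
      by (simp add: algebra_simps)
    then have "(h + ?d) * (Z - h - 2 + ?d) - (h + ?d + 4) * Z = 0"
      using m0 that by auto
    then show ?thesis
      by (simp add: algebra_simps)
  qed
  \<comment> \<open>The left hand side of \<open>key\<close> does not depend on \<open>N\<close>, while \<open>d\<close> is a cocycle.\<close>
  have cocycle: "d (M + N) = tshift M (d N) + d M" for M N
    by (simp add: d_def tshift_diff tshift_tshift)
  have "d 1 = 0"
  proof (rule ccontr)
    assume d1: "d 1 \<noteq> 0"
    let ?e = "d (- 1)"
    have e: "d 1 = - tshift 1 ?e"
      using cocycle[of 1 "- 1"] by (simp add: d_def eq_neg_iff_add_eq_0 add.commute)
    then have e0: "?e \<noteq> 0"
      using d1 by auto
    have te: "tshift 1 ?e = - d 1"
      using e by simp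
    \<comment> \<open>The squares for \<open>1\<close> and \<open>-1\<close> agree, which leaves two signs.\<close>
    have "(d 1 - 1) * (d 1 - 1) = (?e - 1) * (?e - 1)"
      using key[OF d1] key[OF e0] by simp
    then have "(d 1 - ?e) * (d 1 + ?e - 2) = 0"
      by (simp add: algebra_simps)
    then consider "d 1 - ?e = 0" | "d 1 + ?e - 2 = 0"
      by (auto simp only: mult_eq_0_iff)
    then show False
    proof cases
      case 1
      then show False
        using te tshift_eq_uminus[of 1 "d 1"] d1 by simp
    next
      case 2
      have "?e = (d 1 + ?e - 2) + (2 - d 1)"
        by simp
      then have "?e = 2 - d 1"
        by (simp only: 2 add_0_left)
      then have "d 1 = 2 - ?e"
        by simp
      then have "tshift 1 (d 1) = 2 - tshift 1 ?e"
        by (metis tshift_diff tshift_numeral)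
      then have T: "tshift 1 (d 1) = d 1 + 2"
        by (simp add: te)
      then have d2: "d 2 = 2 * d 1 + 2"
        using cocycle[of 1 1] by simp
      have "d 1 + 1 \<noteq> 0"
      proof
        assume "d 1 + 1 = 0"
        then have "d 1 = - 1"
          by (simp add: eq_neg_iff_add_eq_0)
        with T show False
          by (simp add: tshift_minus)
      qed
      then have "d 2 \<noteq> 0"
        using d2 by (metis mult_eq_0_iff distrib_left mult_1_right zero_neq_numeral)
      from key[OF this] key[OF d1] have "(d 2 - 1) * (d 2 - 1) = (d 1 - 1) * (d 1 - 1)"
        by simp
      then have "3 * (d 1 * (d 1 + 2)) = 0"
        by (simp add: d2 algebra_simps)
      then have "d 1 = - 2"
        using d1 by (simp add: eq_neg_iff_add_eq_0)
      with T show False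
        by (simp add: tshift_minus)
    qed
  qed
  then have "C * tshift 1 (Y 0) = C * Y 0"
    by (simp add: d_def Z_def tshift_mult C)
  then show "tshift 1 (Y 0) = Y 0"
    using C0 by simp
qed

text \<open>Write \<open>X = c (H + u)\<close> with \<open>u \<in> \<complex>[t]\<close>. The two highest coefficients of
  \<open>[x(0), x(N)] = 0\<close> show that \<open>u\<close> changes by the integer \<open>s N = 1 - deg (X N)\<close> under the translation
  by \<open>N\<close>. These integers are additive in \<open>N\<close> and at most \<open>1\<close>; hence \<open>s 1 = 0\<close>.\<close>

lemma rigid_linear:
  assumes deg: "Polynomial.degree (X 0) = 1"
  shows "tshift 1 (X 0) = X 0" "hdown (G 1 - hdown (G 1)) = G 1 - hdown (G 1)"
proof -
  obtain c where c: "c \<noteq> 0" "coeff (X 0) 1 = [:c:]"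
    using lead_coeff_X deg by auto
  define u where "u = smult (1 / c) (coeff (X 0) 0)"
  define t where "t N q = pcompose q [:- of_int N, 1:]" for N and q :: "complex poly"
  have X0: "X 0 = smult [:c:] [:u, 1:]"
  proof -
    have "X 0 = [:coeff (X 0) 0, coeff (X 0) 1:]"
      using deg by (auto simp: poly_eq_iff coeff_pCons coeff_eq_0 split: nat.split)
    then show ?thesis
      using c by (simp add: u_def)
  qed
  have TX0: "tshift N (X 0) = smult [:c:] [:t N u, 1:]" for N
    by (simp add: X0 t_def pcompose_smult)
  have shift: "t N u = u + of_int (1 - int (Polynomial.degree (X N)))" for N
  proof -
    let ?q = "X N" and ?w = "t N u"
    let ?p = "Polynomial.degree ?q"
    have "[:c:] \<noteq> 0"
      using c by simp
    moreover have "hdown (tshift N (X 0)) = smult [:c:] [:?w - 1, 1:]"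
      by (simp add: TX0 pcompose_pCons smult_diff_right one_pCons)
    then have "smult [:c:] ([:u, 1:] * hdown ?q) = smult [:c:] (?q * [:?w - 1, 1:])"
      using xx[of N] by (simp only: X0 mult_smult_left mult_smult_right)
    ultimately have eq: "[:u, 1:] * hdown ?q = [:?w - 1, 1:] * ?q"
      by (metis smult_cancel mult.commute)
    have top: "coeff (hdown ?q) ?p = coeff ?q ?p"
      using coeff_shift_down_top[of ?q ?p] by (simp add: coeff_eq_0)
    have beyond: "coeff ?q (Suc ?p) = 0"
      by (simp add: coeff_eq_0)
    have "coeff ([:u, 1:] * hdown ?q) ?p = coeff ([:?w - 1, 1:] * ?q) ?p"
      by (simp only: eq)
    then have "coeff ?q ?p * ?w = coeff ?q ?p * (u + of_int (1 - int ?p))"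
      by (cases ?p) (use top beyond in \<open>simp_all add: coeff_pCons coeff_shift_down_top algebra_simps\<close>)
    moreover have "coeff ?q ?p \<noteq> 0"
      using X_nonzero by simp
    ultimately show ?thesis
      by simp
  qed
  define s where "s N = 1 - int (Polynomial.degree (X N))" for N
  have s: "t N u = u + of_int (s N)" for N
    by (simp add: shift s_def)
  have tadd: "t M (t N u) = t (M + N) u" for M N
    by (simp add: t_def pcompose_assoc[symmetric] pcompose_pCons algebra_simps)
  have "s (M + N) = s M + s N" for M N
  proof -
    have "t M (u + of_int (s N)) = u + of_int (s M) + of_int (s N)"
      using s[of M] by (simp add: t_def pcompose_add)
    then have "u + of_int (s (M + N)) = u + of_int (s M + s N)"
      using tadd[of M N] s[of "M + N"] s[of N] by (simp add: algebra_simps)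
    then show ?thesis
      by (metis add_left_cancel of_int_eq_iff)
  qed
  from this[of 1 1] this[of "- 1" "- 1"] this[of 0 0] this[of 1 "- 1"]
  have "s 2 = 2 * s 1" "s (- 2) = - 2 * s 1"
    by simp_all
  \<comment> \<open>The bound is used at \<open>2\<close> and \<open>-2\<close>, where \<open>s\<close> takes the values \<open>2 s 1\<close> and \<open>-2 s 1\<close>.\<close>
  moreover have "s N \<le> 1" for N
    by (simp add: s_def)
  from this[of 2] this[of "- 2"] have "s 2 \<le> 1" "s (- 2) \<le> 1" .
  ultimately have s1: "s 1 = 0"
    by linarith
  have "tshift 1 (X 0) = smult [:c:] [:t 1 u, 1:]"
    by (rule TX0)
  also have "\<dots> = X 0"
    using s[of 1] s1 by (simp add: X0)
  finally show T: "tshift 1 (X 0) = X 0" .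
  have "2 * X 1 = X 0 * (G 1 - hdown (G 1))"
    using hx[of 1 0] by (simp add: T algebra_simps)
  moreover have "Polynomial.degree (2 * X 1) = 1"
    using s1 degree_mult_eq[of 2 "X 1"] X_nonzero[of 1] by (simp add: s_def numeral_poly)
  ultimately have "Polynomial.degree (G 1 - hdown (G 1)) = 0"
    using deg nonzero degree_mult_eq[of "X 0" "G 1 - hdown (G 1)"]
    by (cases "G 1 - hdown (G 1) = 0") auto
  then obtain b where "G 1 - hdown (G 1) = [:b:]"
    by (metis degree_0_id)
  then show "hdown (G 1 - hdown (G 1)) = G 1 - hdown (G 1)"
    by simp
qed

end

text \<open>The effect of the Chevalley involution on polynomials; it exchanges the roles of \<open>X\<close> and
  \<open>Y\<close>.\<close>

definition hflip :: "complex poly poly \<Rightarrow> complex poly poly" where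
  "hflip p = pcompose p [:0, -1:]"

lemma hflip_simps:
  "hflip (p + q) = hflip p + hflip q" "hflip (p - q) = hflip p - hflip q"
  "hflip (p * q) = hflip p * hflip q" "hflip (- p) = - hflip p" "hflip (numeral k) = numeral k"
  "hflip (hflip p) = p"
  "hflip (hdown p) = hup (hflip p)" "hflip (hup p) = hdown (hflip p)"
  "hflip (tshift N p) = tshift N (hflip p)"
  using tshift_pcompose[of N p 0 "-1"]
  by (simp_all add: hflip_def pcompose_add pcompose_diff pcompose_mult pcompose_uminus
      pcompose_assoc[symmetric] pcompose_pCons)

lemma hflip_eq_iff: "hflip p = hflip q \<longleftrightarrow> p = q"
  by (metis hflip_simps(6))

lemma sl2_line_hflip:
  assumes "sl2_line X Y G r"
  shows "sl2_line (\<lambda>N. hflip (Y N)) (\<lambda>N. hflip (X N)) (\<lambda>N. - hflip (G N)) (- r)"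
proof -
  interpret sl2_line X Y G r by fact
  note [simp] = hflip_simps(7-9)[symmetric] hflip_simps(3)[symmetric] 
  show ?thesis
  proof
    show "- hflip (G 0) = [:[:- r:], 2:]"
      by (simp add: G0 hflip_def pcompose_pCons)
  next
    fix N
    show "hflip (Y 0) * hdown (hflip (Y N)) = hflip (Y N) * hdown (tshift N (hflip (Y 0)))"
      by (simp add: hflip_eq_iff yy)
    show "hflip (X 0) * hup (hflip (X N)) = hflip (X N) * hup (tshift N (hflip (X 0)))"
      by (simp add: hflip_eq_iff xx)
    show "hflip (Y 0) * hdown (hflip (X N)) - hflip (X N) * hup (tshift N (hflip (Y 0))) = - hflip (G N)"
      by (simp add: yx[symmetric] hflip_simps(2) mult.commute)
    show "hflip (Y N) * hdown (tshift N (hflip (X 0))) - hflip (X 0) * hup (hflip (Y N)) = - hflip (G N)"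
      by (simp add: xy[symmetric] hflip_simps(2) mult.commute)
  next
    fix N M
    have "hflip (G N * tshift N (Y M) - Y M * hup (tshift M (G N))) = hflip (- 2 * Y (M + N))"
      by (simp only: hy)
    then show "- hflip (G N) * tshift N (hflip (Y M)) -
        hflip (Y M) * hdown (tshift M (- hflip (G N))) = 2 * hflip (Y (M + N))"
      by (simp only: hflip_simps tshift_minus pcompose_uminus) (simp add: algebra_simps)
    have "hflip (G N * tshift N (X M) - X M * hdown (tshift M (G N))) = hflip (2 * X (M + N))"
      by (simp only: hx)
    then show "- hflip (G N) * tshift N (hflip (X M)) -
        hflip (X M) * hup (tshift M (- hflip (G N))) = - 2 * hflip (X (M + N))"
      by (simp only: hflip_simps tshift_minus pcompose_uminus) (simp add: algebra_simps)
  qed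
qed

text \<open>The degrees of \<open>X 0\<close> and \<open>Y 0\<close> add up to \<open>2\<close>; up to the Chevalley involution this leaves
  \<open>rigid_const\<close> and \<open>rigid_linear\<close>.\<close>

lemma (in sl2_line) rigid:
  "tshift 1 (X 0) = X 0" "tshift 1 (Y 0) = Y 0" "hdown (G 1 - hdown (G 1)) = G 1 - hdown (G 1)"
proof -
  interpret flip: sl2_line "\<lambda>N. hflip (Y N)" "\<lambda>N. hflip (X N)" "\<lambda>N. - hflip (G N)" "- r"
    by (rule sl2_line_hflip) (rule sl2_line_axioms)
  have deg: "Polynomial.degree (hflip p) = Polynomial.degree p" for p
    by (simp add: hflip_def degree_pcompose)
  have T: "tshift 1 p = p" if "tshift 1 (hflip p) = hflip p" for p
    using that by (simp add: hflip_simps(9)[symmetric] hflip_eq_iff)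
  consider "Polynomial.degree (X 0) = 0" | "Polynomial.degree (X 0) = 1" "Polynomial.degree (Y 0) = 1"
    | "Polynomial.degree (Y 0) = 0"
    using degree_sum by linarith
  then have "tshift 1 (X 0) = X 0 \<and> tshift 1 (Y 0) = Y 0 \<and> 
     hdown (G 1 - hdown (G 1)) = G 1 - hdown (G 1)"
  proof cases
    case 1
    then show ?thesis using rigid_const by blast
  next
    case 2
    then show ?thesis
      using rigid_linear T flip.rigid_linear(1) by (auto simp: deg)
  next
    case 3
    then have f: "tshift 1 (hflip (Y 0)) = hflip (Y 0)" "tshift 1 (hflip (X 0)) = hflip (X 0)"
      "hdown (- hflip (G 1) - hdown (- hflip (G 1))) = - hflip (G 1) - hdown (- hflip (G 1))"
      using flip.rigid_const by (auto simp: deg)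
    have "hdown (hdown (hflip (G 1))) = 2 * hdown (hflip (G 1)) - hflip (G 1)"
      using f(3) by (simp add: pcompose_diff pcompose_uminus algebra_simps)
    then have "hflip (hup (hup (G 1))) = hflip (2 * hup (G 1) - G 1)"
      by (simp add: hflip_simps)
    then have "hup (hup (G 1)) = 2 * hup (G 1) - G 1"
      by (simp add: hflip_eq_iff)
    then have "hdown (hdown (hup (hup (G 1)))) = hdown (hdown (2 * hup (G 1) - G 1))"
      by simp
    then have "hdown (G 1 - hdown (G 1)) = G 1 - hdown (G 1)"
      by (simp add: pcompose_diff pcompose_mult algebra_simps)
    then show ?thesis
      using f T by blast
  qed
  then show "tshift 1 (X 0) = X 0" "tshift 1 (Y 0) = Y 0"
    "hdown (G 1 - hdown (G 1)) = G 1 - hdown (G 1)" by blast+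
qed


section \<open>Shifts of the variables\<close>

definition shift :: "('v::finite \<Rightarrow> int) \<Rightarrow> 'v cpoly \<Rightarrow> 'v cpoly" where
  "shift c = poly_subst (\<lambda>v. Var v - of_int (c v))"

interpretation shift: cpoly_hom Const "shift c"
  unfolding shift_def by (rule cpoly_hom_poly_subst)

lemma shift_Var [simp]: "shift c (Var v) = Var v - of_int (c v)"
  by (simp add: shift_def)

lemma shift_shift: "shift c (shift d p) = shift (\<lambda>v. c v + d v) p"
  by (rule cpoly_hom_eqI[OF cpoly_hom_comp[OF shift.cpoly_hom_axioms shift.cpoly_hom_axioms]
        shift.cpoly_hom_axioms]) (simp add: shift.simps)

lemma shift_zero [simp]: "shift (\<lambda>_. 0) p = p"
  by (rule cpoly_hom_eqI[OF shift.cpoly_hom_axioms cpoly_hom_ident]) simp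

lemma eval_shift: "eval x (shift c p) = eval (\<lambda>v. x v - of_int (c v)) p"
  by (simp add: shift_def eval_poly_subst eval.simps)

text \<open>The weight of \<open>x\<^sub>i(a)\<close> for \<open>k = 1\<close>, of \<open>y\<^sub>i(a)\<close> for \<open>k = -1\<close>, and of the loops on Cartan
  elements and the central elements of degree \<open>a\<close> for \<open>k = 0\<close>.\<close>

definition wt :: "'l \<Rightarrow> int \<Rightarrow> int^'n \<Rightarrow> 'l + 'n \<Rightarrow> int" where
  "wt i k a = case_sum (\<lambda>j. if j = i then k else 0) (\<lambda>j. a $ j)"

lemma wt_add: "wt i (k + m) (a + b) v = wt i k a v + wt i m b v"
  by (auto simp: wt_def split: sum.split)

lemma wt_zero: "wt i 0 0 = (\<lambda>_. 0)"
  by (auto simp: wt_def fun_eq_iff split: sum.split)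

lemma shift_wt_wt: "shift (wt i k a) (shift (wt i m b) p) = shift (wt i (k + m) (a + b)) p"
proof -
  have "(\<lambda>v. wt i k a v + wt i m b v) = wt i (k + m) (a + b)"
    by (simp add: fun_eq_iff wt_add)
  then show ?thesis
    by (simp add: shift_shift)
qed

lemma sigma_eq_shift: "sigma i = shift (wt i 1 (0 :: int^'n::finite))"
  unfolding sigma_def shift_def
  by (rule arg_cong[where f = poly_subst]) (auto simp: wt_def fun_eq_iff split: sum.split)

lemma tau_eq_shift: "tau a = shift (wt i 0 a)"
  unfolding tau_def shift_def
  by (rule arg_cong[where f = poly_subst]) (auto simp: wt_def fun_eq_iff split: sum.split)

lemma inv_sigma_eq_shift: "inv (sigma i) = shift (wt i (- 1) (0 :: int^'n::finite))"
proof (rule inv_unique_comp)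
  show "sigma i \<circ> shift (wt i (- 1) 0) = id" "shift (wt i (- 1) 0) \<circ> sigma i = id"
    by (simp_all add: sigma_eq_shift fun_eq_iff shift_wt_wt wt_zero)
qed

lemma shift_wt_eq_sigma_tau:
  "shift (wt i 1 a) p = sigma i (tau a p)"
  "shift (wt i (- 1) a) p = inv (sigma i) (tau a p)"
  unfolding inv_sigma_eq_shift tau_eq_shift[of _ i]
  by (simp_all add: sigma_eq_shift shift_wt_wt)

lemma cpoly_hom_tau: "cpoly_hom Const (tau a)"
  unfolding tau_def by (rule cpoly_hom_poly_subst)

interpretation tau: cpoly_hom Const "tau a"
  by (rule cpoly_hom_tau)

lemma tau_Var [simp]: "tau a (Var (Inl i)) = Var (Inl i)"
  "tau a (Var (Inr j)) = Var (Inr j) - of_int (a $ j)"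
  by (simp_all add: tau_def)

lemma tau_tau: "tau a (tau b p) = tau (a + b) p"
  by (simp add: tau_eq_shift[of _ undefined] shift_wt_wt)

lemma tau_0 [simp]: "tau 0 p = p"
  by (simp add: tau_eq_shift[of _ undefined] wt_zero)

section \<open>Polynomials in the Cartan variables alone\<close>

lemma cpoly_hom_embed: "cpoly_hom Const embed"
  unfolding embed_def by (rule cpoly_hom_poly_subst)

interpretation embed: cpoly_hom Const embed
  by (rule cpoly_hom_embed)

lemma embed_Var [simp]: "embed (Var i) = Var (Inl i)"
  by (simp add: embed_def)

definition at_zero :: "('l::finite + 'n::finite) cpoly \<Rightarrow> 'l cpoly" where
  "at_zero = poly_subst (case_sum Var (\<lambda>_. 0))"

interpretation at_zero: cpoly_hom Const at_zero
  unfolding at_zero_def by (rule cpoly_hom_poly_subst)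

lemma at_zero_Var [simp]: "at_zero (Var (Inl i)) = Var i" "at_zero (Var (Inr j)) = 0"
  by (simp_all add: at_zero_def)

lemma at_zero_embed [simp]: "at_zero (embed p) = p"
  by (rule cpoly_hom_eqI[OF cpoly_hom_comp[OF embed.cpoly_hom_axioms at_zero.cpoly_hom_axioms]
        cpoly_hom_ident]) simp

lemma embed_eq_iff [simp]: "embed p = embed q \<longleftrightarrow> p = q"
  by (metis at_zero_embed)

lemma tau_embed [simp]: "tau a (embed p) = embed p"
  by (rule cpoly_hom_eqI[OF cpoly_hom_comp[OF embed.cpoly_hom_axioms tau.cpoly_hom_axioms]
        embed.cpoly_hom_axioms]) simp

lemma shift_embed: "shift (wt i k 0) (embed p) = embed (shift (\<lambda>j. if j = i then k else 0) p)"
  by (rule cpoly_hom_eqI[OF cpoly_hom_comp[OF embed.cpoly_hom_axioms shift.cpoly_hom_axioms]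
        cpoly_hom_comp[OF shift.cpoly_hom_axioms embed.cpoly_hom_axioms]])
    (simp add: wt_def embed.simps)

text \<open>Along each coordinate line of a degree variable, the polynomial takes the same value at
  infinitely many points.\<close>

lemma tau_invariant_imp_embed:
  fixes p :: "('l::finite + 'n::finite) cpoly"
  assumes inv: "\<And>a. tau a p = p"
  shows "p = embed (at_zero p)"
proof -
  have one: "eval (x(Inr j := y)) p = eval x p" for x j y
  proof -
    define u :: "'l + 'n \<Rightarrow> complex" where "u v = (if v = Inr j then 1 else 0)" for v
    obtain q where q: "\<And>t. poly q t = eval (\<lambda>v. x v + t * u v) p"
      using line_polynomial by blast
    have "poly q (- of_nat n) = poly q 0" for n :: nat
    proof -
      have "eval x p = eval x (tau (axis j (int n)) p)"
        by (simp add: inv)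
      also have "\<dots> = eval (\<lambda>v. x v + (- of_nat n) * u v) p"
        unfolding tau_eq_shift[of _ undefined] eval_shift
        by (rule arg_cong[where f = "\<lambda>x. eval x p"])
          (auto simp: fun_eq_iff wt_def u_def axis_def split: sum.split)
      finally show ?thesis
        by (simp add: q)
    qed
    then have "range (\<lambda>n. - of_nat n) \<subseteq> {t. poly (q - [:poly q 0:]) t = 0}"
      by auto
    moreover have "infinite (range (\<lambda>n. - of_nat n :: complex))"
      by (rule range_inj_infinite) (simp add: inj_def)
    ultimately have "q - [:poly q 0:] = 0"
      using poly_roots_finite finite_subset by blast
    then have q0: "poly q t = poly q 0" for t
      by (metis eq_iff_diff_eq_0 poly_pCons poly_0 mult_zero_right add.right_neutral)
    have "x(Inr j := y) = (\<lambda>v. x v + (y - x (Inr j)) * u v)"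
      by (auto simp: fun_eq_iff u_def)
    then show ?thesis
      using q0[of "y - x (Inr j)"] by (simp add: q)
  qed
  have "eval (\<lambda>v. if v \<in> Inr ` S then 0 else x v) p = eval x p" if "finite S" for x and S :: "'n set"
    using that
  proof induction
    case empty
    then show ?case by simp
  next
    case (insert j S)
    have "(\<lambda>v. if v \<in> Inr ` insert j S then 0 else x v) =
        (\<lambda>v. if v \<in> Inr ` S then 0 else x v)(Inr j := 0)"
      by (auto simp: fun_eq_iff)
    then show ?case
      by (simp only: one insert.IH)
  qed
  from this[of UNIV] have zero: "eval (\<lambda>v. if v \<in> range Inr then 0 else x v) p = eval x p" for x
    by simp
  show ?thesis
  proof (rule cpoly_eqI)
    fix x
    have "eval x (embed (at_zero p)) = eval (\<lambda>v. if v \<in> range Inr then 0 else x v) p"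
      unfolding embed_def at_zero_def eval_poly_subst
      by (rule arg_cong[where f = "\<lambda>x. eval x p"])
        (auto simp: fun_eq_iff eval.simps split: sum.split)
    then show "eval x p = eval x (embed (at_zero p))"
      by (simp add: zero)
  qed
qed

section \<open>Restriction to lines\<close>

interpretation const2: scalar_hom "\<lambda>c :: complex. [:[:c:]:]"
  by unfold_locales (simp_all add: one_pCons)

text \<open>The restriction to the lines \<open>t \<mapsto> x + t b\<close> in the degree variables, where \<open>H\<^sub>i\<close> stays a variable
  and the other \<open>H\<^sub>j\<close> take their values at \<open>x\<close>. On it, \<open>\<tau>\<^bsup>Nb\<^esup>\<close> is the translation
  \<open>t \<mapsto> t - N\<close>.\<close>

definition line :: "('l + 'n \<Rightarrow> complex) \<Rightarrow> 'l \<Rightarrow> int^'n \<Rightarrow> ('l::finite + 'n::finite) cpoly \<Rightarrow>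
    complex poly poly" where
  "line x i b = insertion (\<lambda>c. [:[:c:]:])
     (case_sum (\<lambda>j. if j = i then [:0, 1:] else [:[:x (Inl j):]:])
       (\<lambda>j. [:[:x (Inr j), of_int (b $ j):]:]))"

interpretation line: cpoly_hom "\<lambda>c. [:[:c:]:]" "line x i b"
  unfolding line_def by (rule const2.insertion.cpoly_hom_axioms)

lemma line_Var [simp]: "line x i b (Var (Inl j)) = (if j = i then [:0, 1:] else [:[:x (Inl j):]:])"
  "line x i b (Var (Inr k)) = [:[:x (Inr k), of_int (b $ k):]:]"
  by (simp_all add: line_def const2.insertion_Var)

lemma line_shift:
  "line x i b (shift (wt i k (N *s b)) p) = pcompose (tshift N (line x i b p)) [:- of_int k, 1:]"
proof (rule cpoly_hom_eqI)
  show "cpoly_hom (\<lambda>c. [:[:c:]:]) (\<lambda>p. line x i b (shift (wt i k (N *s b)) p))"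
    by (rule cpoly_hom_comp[OF shift.cpoly_hom_axioms line.cpoly_hom_axioms])
  show "cpoly_hom (\<lambda>c. [:[:c:]:]) (\<lambda>p. pcompose (tshift N (line x i b p)) [:- of_int k, 1:])"
    by unfold_locales (simp_all add: line.simps tshift_add tshift_mult pcompose_add pcompose_mult pcompose_1)
  show "line x i b (shift (wt i k (N *s b)) (Var v)) =
      pcompose (tshift N (line x i b (Var v))) [:- of_int k, 1:]" for v
    by (cases v) (auto simp: wt_def line.simps pcompose_pCons of_int_poly pcompose_1 mult.commute)
qed

lemma line_shift_simps:
  "line x i b (shift (wt i 0 (N *s b)) p) = tshift N (line x i b p)"
  "line x i b (shift (wt i 1 (N *s b)) p) = hdown (tshift N (line x i b p))"
  "line x i b (shift (wt i (- 1) (N *s b)) p) = hup (tshift N (line x i b p))"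
  using line_shift[of x i b 0 N p] line_shift[of x i b 1 N p] line_shift[of x i b "-1" N p]
  by simp_all

lemma eval_line: "poly (poly (line x i b p) [:x (Inl i):]) 0 = eval x p"
proof (rule cpoly_hom_eqI[OF _ eval.cpoly_hom_axioms])
  show "cpoly_hom (\<lambda>c. c) (\<lambda>p. poly (poly (line x i b p) [:x (Inl i):]) 0)"
    by unfold_locales (simp_all add: line.simps)
  show "poly (poly (line x i b (Var v)) [:x (Inl i):]) 0 = eval x (Var v)" for v
    by (cases v) auto
qed

text \<open>Identities may be checked line by line, with \<open>i\<close> and \<open>b\<close> fixed.\<close>

lemma line_eqI:
  assumes "\<And>x. line x i b p = line x i b q"
  shows "p = q"
  by (rule cpoly_eqI) (metis assms eval_line)

section \<open>Lie modules with a polynomial weight action\<close>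

text \<open>A weight vector commutes with multiplication by a variable up to an additive constant in that
  variable, so it intertwines multiplication by \<open>p\<close> and by the shifted \<open>p\<close>.\<close>

lemma weight_vector_action:
  fixes act :: "'a::ab_group_add \<Rightarrow> 'v::finite cpoly \<Rightarrow> 'v cpoly"
  assumes "lie_module scl br poly_scale act"
    and b: "\<And>v p. act (b v) p = Var v * p"
    and w: "\<And>v. br (b v) w = scl (of_int (c v)) w"
  shows "act w p = shift c p * act w 1"
proof -
  interpret lie_module scl br poly_scale act by fact
  have "act w (p * q) = shift c p * act w q" for q
  proof (induction p arbitrary: q rule: cpoly_induct)
    case (const k)
    then show ?case
      using act_scale_right[of w k q] by (simp add: poly_scale_def shift.simps)
  next
    case (var v)
    have "poly_scale (of_int (c v)) (act w q) = Var v * act w q - act w (Var v * q)"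
      using act_bracket[of "b v" w q] by (simp add: b w act_scale_left)
    then show ?case
      by (simp add: poly_scale_def Const_of_int algebra_simps)
  next
    case (add p p')
    then show ?case
      by (simp add: distrib_right act_add_right shift.simps)
  next
    case (mult p p')
    then show ?case
      by (simp add: mult.assoc shift.simps)
  qed
  from this[of 1] show ?thesis
    by simp
qed


section \<open>Chevalley generators and the Killing form\<close>

context lie_algebra
begin

lemma bracket_sum_left: "bracket (sum f S) v = (\<Sum>i\<in>S. bracket (f i) v)"
  by (induction S rule: infinite_finite_induct) (simp_all add: bracket_add_left)

lemma bracket_eigenvectors:
  assumes u: "bracket k u = scale a u" and v: "bracket k v = scale b v"
  shows "bracket k (bracket u v) = scale (a + b) (bracket u v)"
proof -
  have "bracket k (bracket u v) = - bracket u (bracket v k) - bracket v (bracket k u)"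
    using jacobi[of k u v] by (simp add: algebra_simps eq_neg_iff_add_eq_0)
  also have "bracket v k = - scale b v"
    using bracket_antisym[of v k] v by simp
  also have "bracket v (bracket k u) = - scale a (bracket u v)"
    using bracket_antisym[of v u] by (simp add: u bracket_scale_right)
  finally show ?thesis
    by (simp add: bracket_minus bracket_scale_right scale_left_distrib add.commute)
qed

end

context fd_lie_algebra
begin

text \<open>Each eigenvector is expanded in the basis behind \<open>linear_trace\<close>, and each vector of that basis
  in eigenvectors.\<close>

lemma linear_trace_eigenbasis:
  assumes C: "independent C" "span C = UNIV" and f: "Vector_Spaces.linear scale scale f"
    and eig: "\<And>c. c \<in> C \<Longrightarrow> f c = scale (l c) c"
  shows "finite C" "linear_trace f = (\<Sum>c\<in>C. l c)"
proof -
  interpret f: Vector_Spaces.linear scale scale f by fact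
  show finC: "finite C"
    using finite_dim independent_span_bound C by (metis subset_UNIV)
  obtain B where fin: "finite B" and B: "independent B" "span B = UNIV"
    and tr: "\<And>f. linear_trace f = (\<Sum>b\<in>B. representation B (f b) b)"
    using ex_trace_basis by auto
  have "representation B (f b) b =
      (\<Sum>c\<in>C. l c * (representation C b c * representation B c b))" for b
  proof -
    have "b = (\<Sum>c\<in>C. scale (representation C b c) c)"
      using sum_representation_eq[OF C(1) _ finC order_refl, of b] C(2) by simp
    then have "f b = (\<Sum>c\<in>C. scale (representation C b c) (f c))"
      by (metis (no_types, lifting) f.scale f.sum sum.cong)
    then have "f b = (\<Sum>c\<in>C. scale (representation C b c * l c) c)"
      by (simp add: eig)
    then show ?thesis
      using B by (simp add: representation_sum representation_scale mult_ac)
  qed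
  then have "linear_trace f =
      (\<Sum>b\<in>B. \<Sum>c\<in>C. l c * (representation C b c * representation B c b))"
    by (simp only: tr)
  also have "\<dots> = (\<Sum>c\<in>C. l c * (\<Sum>b\<in>B. representation B c b * representation C b c))"
    by (subst sum.swap) (simp add: sum_distrib_left mult_ac)
  also have "\<dots> = (\<Sum>c\<in>C. l c)"
  proof (rule sum.cong[OF refl])
    fix c assume c: "c \<in> C"
    have "c = (\<Sum>b\<in>B. scale (representation B c b) b)"
      using sum_representation_eq[OF B(1) _ fin order_refl, of c] B(2) by simp
    then have "representation C c c = (\<Sum>b\<in>B. representation B c b * representation C b c)"
      using C representation_sum[OF C(1), of B "\<lambda>b. scale (representation B c b) b"]
      by (simp add: representation_scale)
    then show "l c * (\<Sum>b\<in>B. representation B c b * representation C b c) = l c"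
      using representation_basis[OF C(1) c] by simp
  qed
  finally show "linear_trace f = (\<Sum>c\<in>C. l c)" .
qed

end

context chevalley_lie_algebra
begin

lemma generated_induct [case_names x y add scale bracket]:
  assumes "\<And>i. Q (x i)" "\<And>i. Q (y i)" "\<And>u v. Q u \<Longrightarrow> Q v \<Longrightarrow> Q (u + v)"
    "\<And>c u. Q u \<Longrightarrow> Q (scale c u)" "\<And>u v. Q u \<Longrightarrow> Q v \<Longrightarrow> Q (bracket u v)"
  shows "Q z"
proof -
  have "Q 0"
    using assms(4)[OF assms(1), of 0] by simp
  then have "subalgebra (Collect Q)"
    using assms(3-5) by (auto simp: subalgebra_def subspace_def)
  moreover have "range x \<union> range y \<subseteq> Collect Q"
    using assms(1,2) by auto
  ultimately have "generated_subalgebra (range x \<union> range y) \<subseteq> Collect Q"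
    by (auto simp: generated_subalgebra_def)
  then show ?thesis
    using generators by auto
qed

lemma h_in_cartan: "h i \<in> cartan" and H_in_cartan: "H i \<in> cartan"
  using h_basis H_basis span_base[of "h i" "range h"] span_base[of "H i" "range H"]
  by (auto simp: basis_family_def)

lemma h_nonzero: "h i \<noteq> 0"
  using h_basis dependent_zero[of "range h"] by (metis basis_family_def rangeI)

lemma x_nonzero: "x i \<noteq> 0"
  using x_y[of i i] h_nonzero by auto

abbreviation coord :: "'g \<Rightarrow> 'l \<Rightarrow> complex" where
  "coord u j \<equiv> representation (range H) u (H j)"

lemma cartan_expand:
  assumes "u \<in> cartan"
  shows "u = (\<Sum>j\<in>UNIV. scale (coord u j) (H j))"
proof -
  have "(\<Sum>b\<in>range H. scale (representation (range H) u b) b) = u"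
    using H_basis assms by (intro sum_representation_eq) (auto simp: basis_family_def)
  then show ?thesis
    using H_basis by (simp add: basis_family_def sum.reindex)
qed

lemma bracket_cartan_x:
  assumes "u \<in> cartan"
  shows "bracket u (x j) = scale (coord u j) (x j)"
proof -
  have "bracket u (x j) = (\<Sum>k\<in>UNIV. scale (coord u k) (bracket (H k) (x j)))"
    by (subst cartan_expand[OF assms]) (simp add: bracket_sum_left bracket_scale_left)
  also have "\<dots> = (\<Sum>k\<in>UNIV. if k = j then scale (coord u j) (x j) else 0)"
    by (rule sum.cong) (auto simp: H_x)
  finally show ?thesis
    by simp
qed

lemma coord_h: "coord (h i) j = of_int (A i j)"
  using bracket_cartan_x[OF h_in_cartan, of i j] x_nonzero[of j] by (simp add: h_x)

text \<open>A bracket of Cartan elements kills every \<open>x\<^sub>j\<close>, since these are common eigenvectors; but a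
  Cartan element is determined by its eigenvalues on the \<open>x\<^sub>j\<close>.\<close>

lemma cartan_abelian:
  assumes "u \<in> cartan" "v \<in> cartan"
  shows "bracket u v = 0"
proof -
  have w: "bracket u v \<in> cartan"
    using cartan assms by (auto simp: cartan_subalgebra_def subalgebra_def)
  have "coord (bracket u v) j = 0" for j
  proof -
    have "bracket (bracket u v) (x j) = 0"
      unfolding bracket_bracket
      by (simp add: bracket_cartan_x assms bracket_scale_right mult.commute)
    then show ?thesis
      using x_nonzero by (simp add: bracket_cartan_x[OF w])
  qed
  then show ?thesis
    by (subst cartan_expand[OF w]) simp
qed

lemma killing_h_x:
  assumes "A i j \<noteq> 0"
  shows "killing (h i) (x j) = 0"
proof -
  have "killing (bracket (h i) (h i)) (x j) = of_int (A i j) * killing (h i) (x j)"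
    unfolding killing_bracket by (simp add: h_x killing_scale)
  then show ?thesis
    using assms by (simp add: bracket_self killing_0)
qed

lemma killing_h_y:
  assumes "A i j \<noteq> 0"
  shows "killing (h i) (y j) = 0"
proof -
  have "killing (bracket (h i) (h i)) (y j) = - of_int (A i j) * killing (h i) (y j)"
    unfolding killing_bracket h_y by (rule killing_scale(2))
  then show ?thesis
    using assms by (simp add: bracket_self killing_0)
qed

lemma killing_h_h: "killing (h i) (h i) = of_int (A i i) * killing (x i) (y i)"
proof -
  have "killing (h i) (h i) = killing (x i) (bracket (y i) (h i))"
    using killing_bracket[of "x i" "y i" "h i"] by (simp add: x_y)
  also have "bracket (y i) (h i) = scale (of_int (A i i)) (y i)"
    using bracket_antisym[of "y i" "h i"] by (simp add: h_y)
  finally show ?thesis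
    by (simp add: killing_scale)
qed

text \<open>The algebra is spanned by eigenvectors of \<open>ad h\<^sub>i\<close> with integral eigenvalues, since it is
  generated by such vectors. So \<open>(h\<^sub>i, h\<^sub>i)\<close> is a sum of squares of integers, one of which belongs to
  \<open>x\<^sub>i\<close>.\<close>

lemma killing_h_h_nonzero:
  assumes "A i i \<noteq> 0"
  shows "killing (h i) (h i) \<noteq> 0"
proof -
  define W where "W = {u. \<exists>k :: int. bracket (h i) u = scale (of_int k) u}"
  have "z \<in> span W" for z
  proof (induction z rule: generated_induct)
    case (x j)
    have "x j \<in> W"
      unfolding W_def using h_x[of i j] by blast
    then show ?case by (rule span_base)
  next
    case (y j)
    have "y j \<in> W"
      unfolding W_def using h_y[of i j] by (auto intro: exI[of _ "- A i j"])
    then show ?case by (rule span_base)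
  next
    case (bracket u v)
    have W: "bracket u v \<in> W" if uv: "u \<in> W" "v \<in> W" for u v
    proof -
      obtain k m :: int where "bracket (h i) u = scale (of_int k) u" "bracket (h i) v = scale (of_int m) v"
        using uv unfolding W_def by blast
      from bracket_eigenvectors[OF this] show ?thesis
        by (auto simp: W_def intro: exI[of _ "k + m"])
    qed
    have WW: "bracket u v \<in> span W" if u: "u \<in> W" and v: "v \<in> span W" for u v
      using v
    proof (induction v rule: span_induct_alt)
      case base
      show ?case by (simp add: span_zero)
    next
      case (step c v w)
      then show ?case
        using W[OF u step(1)]
        by (simp add: bracket_add_right bracket_scale_right span_add span_scale span_base)
    qed
    from bracket.IH(1) show ?case
    proof (induction u rule: span_induct_alt)
      case base
      show ?case by (simp add: span_zero)
    next
      case (step c u w)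
      then show ?case
        using WW[OF step(1) bracket.IH(2)]
        by (simp add: bracket_add_left bracket_scale_left span_add span_scale)
    qed
  qed (auto intro: span_add span_scale)
  then have W: "span W = UNIV"
    by auto
  have xW: "{x i} \<subseteq> W"
    unfolding W_def using h_x[of i i] by blast
  obtain C where C: "{x i} \<subseteq> C" "C \<subseteq> W" "independent C" "W \<subseteq> span C"
  proof -
    have "independent {x i}"
      using x_nonzero[of i] by simp
    from maximal_independent_subset_extend[OF xW this] that show thesis
      by blast
  qed
  have spanC: "span C = UNIV"
    using span_mono[OF C(4)] W by (simp add: span_span top.extremum_unique)
  have "\<forall>c\<in>C. \<exists>k :: int. bracket (h i) c = scale (of_int k) c"
    using C(2) by (auto simp: W_def)
  then obtain l :: "'g \<Rightarrow> int" where l: "\<And>c. c \<in> C \<Longrightarrow> bracket (h i) c = scale (of_int (l c)) c"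
    by (auto dest!: bchoice)
  have lin: "Vector_Spaces.linear scale scale (\<lambda>w. bracket (h i) (bracket (h i) w))"
    by unfold_locales (simp_all add: bracket_add_right bracket_scale_right)
  have eig: "bracket (h i) (bracket (h i) c) = scale (of_int ((l c)\<^sup>2)) c" if "c \<in> C" for c
    using l[OF that] by (simp add: bracket_scale_right power2_eq_square)
  have fin: "finite C" and tr: "killing (h i) (h i) = of_int (\<Sum>c\<in>C. (l c)\<^sup>2)"
    using linear_trace_eigenbasis[OF C(3) spanC lin eig] by (simp_all add: killing_def)
  have "l (x i) = A i i"
    using l[of "x i"] C(1) x_nonzero[of i] by (simp add: h_x)
  then have "0 < (l (x i))\<^sup>2"
    using assms by simp
  also have "\<dots> \<le> (\<Sum>c\<in>C. (l c)\<^sup>2)"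
    using fin C(1) by (intro member_le_sum) auto
  finally show ?thesis
    by (metis less_irrefl of_int_eq_0_iff tr)
qed

lemma KA_lin_0 [simp]: "KA_lin 0 m = 0"
  by (simp add: KA_lin_def)

lemma KA_lin_axis: "KA_lin (axis j 1) m = KA_gen m j"
proof -
  have "KA_lin (axis j 1) m = (\<Sum>i\<in>UNIV. if i = j then KA_gen m i else 0)"
    unfolding KA_lin_def by (rule sum.cong) (auto simp: axis_def)
  then show ?thesis
    by simp
qed

text \<open>These are the elements to which \<open>weight_vector_action\<close> is applied.\<close>

lemma toroidal_weights:
  "toroidal_bracket (toroidal_basis v) (loop (x i) a) =
    toroidal_scale (of_int (wt i 1 a v)) (loop (x i) a)"
  "toroidal_bracket (toroidal_basis v) (loop (y i) a) =
    toroidal_scale (of_int (wt i (- 1) a v)) (loop (y i) a)"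
  "u \<in> cartan \<Longrightarrow> toroidal_bracket (toroidal_basis v) (loop u a) =
    toroidal_scale (of_int (wt i 0 a v)) (loop u a)"
  "toroidal_bracket (toroidal_basis v) (0, KA_lin b a, 0) =
    toroidal_scale (of_int (wt i 0 a v)) (0, KA_lin b a, 0)"
proof -
  have pair: "pairing (axis j 1) a = of_int (a $ j)" for j
    by (simp add: pairing_def axis_def if_distrib[of "\<lambda>x. x * _"] cong: if_cong)
  note [simp] = toroidal_basis_def wt_def toroidal_bracket_loop_loop' toroidal_bracket_deg_deriv
    toroidal_scale_simps H_x H_y loop_0 loop_minus zero_prod_def vec_scale_zero
  show "toroidal_bracket (toroidal_basis v) (loop (x i) a) =
    toroidal_scale (of_int (wt i 1 a v)) (loop (x i) a)"
    by (cases v) auto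
  show "toroidal_bracket (toroidal_basis v) (loop (y i) a) =
    toroidal_scale (of_int (wt i (- 1) a v)) (loop (y i) a)"
    by (cases v) auto
  show "toroidal_bracket (toroidal_basis v) (loop u a) =
    toroidal_scale (of_int (wt i 0 a v)) (loop u a)" if "u \<in> cartan"
    by (cases v) (auto simp: cartan_abelian H_in_cartan that)
  show "toroidal_bracket (toroidal_basis v) (0, KA_lin b a, 0) =
    toroidal_scale (of_int (wt i 0 a v)) (0, KA_lin b a, 0)"
    by (cases v) (auto simp: deg_deriv_def KA_deriv_lin pair)
qed

end


section \<open>The structure of an object\<close>

lemma cpoly_mult_left_cancel:
  fixes p q r :: "'v::finite cpoly"
  shows "r * p = r * q \<Longrightarrow> r \<noteq> 0 \<Longrightarrow> p = q"
  using cpoly_mult_eq_0[of r "p - q"] by (simp add: right_diff_distrib)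

locale toroidal_object = chevalley_lie_algebra scale bracket cartan A x y h H
  for scale :: "complex \<Rightarrow> 'g::ab_group_add \<Rightarrow> 'g" and bracket cartan
    and A :: "'l::finite \<Rightarrow> 'l \<Rightarrow> int" and x y h H +
  fixes act :: "('g, 'n::finite) toroidal \<Rightarrow> ('l + 'n) cpoly \<Rightarrow> ('l + 'n) cpoly"
  assumes object: "act \<in> objects_M toroidal_scale toroidal_bracket toroidal_basis"
    and A_diag: "A i i = 2"
begin

lemma is_module: "lie_module toroidal_scale toroidal_bracket poly_scale act"
  using object by (simp add: objects_M_def category_M_def)

lemma act_basis: "act (toroidal_basis v) p = Var v * p"
  using object by (simp add: objects_M_def free_iso_def)

interpretation L: lie_module toroidal_scale toroidal_bracket poly_scale act
  by (rule is_module)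

text \<open>By \<open>weight_vector_action\<close>, the action of the respective elements is determined by these
  polynomials. In the last one, \<open>KA_lin b a\<close> is \<open>\<Sum>\<^sub>j b\<^sub>j t\<^sup>a K\<^sub>j\<close>, the form in which central
  elements occur in brackets.\<close>

definition X :: "'l \<Rightarrow> int^'n \<Rightarrow> ('l + 'n) cpoly" where
  "X i a = act (loop (x i) a) 1"

definition Y :: "'l \<Rightarrow> int^'n \<Rightarrow> ('l + 'n) cpoly" where
  "Y i a = act (loop (y i) a) 1"

definition G :: "'l \<Rightarrow> int^'n \<Rightarrow> ('l + 'n) cpoly" where
  "G i a = act (loop (h i) a) 1"

definition K :: "int^'n \<Rightarrow> int^'n \<Rightarrow> ('l + 'n) cpoly" where
  "K b a = act (0, KA_lin b a, 0) 1"

lemma act_x: "act (loop (x i) a) p = shift (wt i 1 a) p * X i a"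
  and act_y: "act (loop (y i) a) p = shift (wt i (- 1) a) p * Y i a"
  and act_h: "act (loop (h i) a) p = shift (wt j 0 a) p * G i a"
  and act_K: "act (0, KA_lin b a, 0) p = shift (wt j 0 a) p * K b a"
  unfolding X_def Y_def G_def K_def
  by (rule weight_vector_action[OF is_module act_basis] toroidal_weights h_in_cartan)+

lemma act_comm: "act (loop z a) (act (loop w b) p) - act (loop w b) (act (loop z a) p) =
    act (loop (bracket z w) (a + b)) p + Const (killing z w) * act (0, KA_lin a (a + b), 0) p"
proof -
  have "(0, KA_scale k l, 0) = (toroidal_scale k (0, l, 0) :: ('g, 'n) toroidal)" for k l
    by (simp add: toroidal_scale_simps vec_scale_zero)
  then show ?thesis
    using L.act_bracket[of "loop z a" "loop w b" p]
    by (simp add: toroidal_bracket_loop_loop' L.act_add_left L.act_scale_left poly_scale_def)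
qed

lemma act_0: "act 0 p = 0"
  using L.act_add_left[of 0 0 p] by simp

lemma act_0' [simp]: "act (0, 0, 0) p = 0"
  using act_0 by (simp add: zero_prod_def)

lemma act_loop_0: "act (loop 0 a) p = 0"
  by (simp add: loop_0 act_0)

lemma act_loop_add: "act (loop (z + w) a) p = act (loop z a) p + act (loop w a) p"
  by (simp add: loop_add L.act_add_left)

lemma act_loop_scale: "act (loop (scale c z) a) p = Const c * act (loop z a) p"
  using L.act_scale_left[of c "loop z a" p] by (simp add: toroidal_scale_simps poly_scale_def)

lemma K_0 [simp]: "K 0 a = 0" "K a a = 0"
  by (simp_all add: K_def KA_lin_self)

lemma comm_xy: "X i a * shift (wt i 1 a) (Y i b) - Y i b * shift (wt i (- 1) b) (X i a) =
    G i (a + b) + Const (killing (x i) (y i)) * K a (a + b)"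
  using act_comm[of "x i" a "y i" b 1]
  by (simp add: act_x act_y act_h[of _ _ _ i] act_K[of _ _ _ i] x_y shift.simps mult.commute)

lemma comm_hx: "A i j \<noteq> 0 \<Longrightarrow>
    G i a * shift (wt j 0 a) (X j b) - X j b * shift (wt j 1 b) (G i a) = of_int (A i j) * X j (a + b)"
  using act_comm[of "h i" a "x j" b 1]
  by (simp add: act_x act_h[of _ _ _ j] h_x act_loop_scale killing_h_x shift.simps mult.commute
      Const_of_int)

lemma comm_hy: "A i j \<noteq> 0 \<Longrightarrow>
    G i a * shift (wt j 0 a) (Y j b) - Y j b * shift (wt j (- 1) b) (G i a) = - of_int (A i j) * Y j (a + b)"
  using act_comm[of "h i" a "y j" b 1] act_loop_scale[of "- of_int (A i j)" "y j"]
  by (simp add: act_y act_h[of _ _ _ j] h_y killing_h_y shift.simps mult.commute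
      Const_of_int Const_minus)

lemma comm_hh: "G i a * shift (wt i 0 a) (G i b) - G i b * shift (wt i 0 b) (G i a) =
    Const (killing (h i) (h i)) * K a (a + b)"
  using act_comm[of "h i" a "h i" b 1]
  by (simp add: act_h[of _ _ _ i] act_K[of _ _ _ i] bracket_self act_loop_0 shift.simps mult.commute)

lemma comm_xx: "X i 0 * shift (wt i 1 0) (X i a) = X i a * shift (wt i 1 a) (X i 0)"
  using act_comm[of "x i" 0 "x i" a 1]
  by (simp add: act_x bracket_self act_loop_0 shift.simps mult.commute act_K[of _ _ _ i])

lemma comm_yy: "Y i 0 * shift (wt i (- 1) 0) (Y i a) = Y i a * shift (wt i (- 1) a) (Y i 0)"
  using act_comm[of "y i" 0 "y i" a 1]
  by (simp add: act_y bracket_self act_loop_0 shift.simps mult.commute act_K[of _ _ _ i])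

lemma G_0: "G i 0 = (\<Sum>j\<in>UNIV. of_int (A i j) * Var (Inl j))"
proof -
  have aH: "act (loop (H j) 0) 1 = Var (Inl j)" for j
    using act_basis[of "Inl j" 1] by (simp add: toroidal_basis_def)
  have *: "act (loop (\<Sum>j\<in>S. scale (c j) (H j)) 0) 1 = (\<Sum>j\<in>S. Const (c j) * Var (Inl j))" for c S
    by (induction S rule: infinite_finite_induct)
      (simp_all add: act_loop_0 act_loop_add act_loop_scale aH)
  have "h i = (\<Sum>j\<in>UNIV. scale (of_int (A i j)) (H j))"
    by (subst cartan_expand[OF h_in_cartan]) (simp add: coord_h)
  then show ?thesis
    using * by (simp add: G_def Const_of_int)
qed

lemma shift_G_0: "shift (wt j k a) (G i 0) = G i 0 - of_int (k * A i j)"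
proof -
  have "shift (wt j k a) (G i 0) =
      (\<Sum>m\<in>UNIV. of_int (A i m) * Var (Inl m) - of_int (if m = j then k * A i m else 0))"
    unfolding G_0 by (auto simp: shift.simps wt_def right_diff_distrib intro!: sum.cong)
  also have "\<dots> = G i 0 - of_int (\<Sum>m\<in>UNIV. if m = j then k * A i m else 0)"
    by (simp only: sum_subtractf G_0 of_int_sum)
  finally show ?thesis
    by simp
qed

text \<open>The central term of a bracket of elements of degrees \<open>a\<close> and \<open>b\<close> is \<open>KA_lin a (a + b)\<close> up to a
  scalar; it vanishes for \<open>a = 0\<close>, and for \<open>b = 0\<close> because of the relations in \<open>dA\<close>.\<close>

lemma sl2_line_object:
  "sl2_line (\<lambda>N. line pt i b (X i (N *s b))) (\<lambda>N. line pt i b (Y i (N *s b)))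
     (\<lambda>N. line pt i b (G i (N *s b))) (\<Sum>j\<in>UNIV - {i}. of_int (A i j) * pt (Inl j))"
proof -
  have zero: "0 *s b = 0"
    by (simp add: vec_eq_iff)
  have add: "N *s b + M *s b = (M + N) *s b" for M N
    by (simp add: vec_eq_iff algebra_simps)
  have sh0: "line pt i b (shift (wt i 1 0) p) = hdown (line pt i b p)"
    "line pt i b (shift (wt i (- 1) 0) p) = hup (line pt i b p)" 
    "line pt i b (shift (wt i 0 0) p) = line pt i b p" for p
    using line_shift_simps[of pt i b 0 p] by (simp_all add: zero)
  show ?thesis
  proof
    have *: "(\<Sum>j\<in>S. of_int (c j) * [:[:pt (Inl j):]:]) = [:[:\<Sum>j\<in>S. of_int (c j) * pt (Inl j):]:]"
      for S c
      by (induction S rule: infinite_finite_induct) (simp_all add: of_int_poly)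
    have "line pt i b (G i (0 *s b)) =
        (\<Sum>j\<in>UNIV. of_int (A i j) * (if j = i then [:0, 1:] else [:[:pt (Inl j):]:]))"
      by (simp add: zero G_0 line.simps)
    also have "\<dots> = of_int (A i i) * [:0, 1:] +
        (\<Sum>j\<in>UNIV - {i}. of_int (A i j) * [:[:pt (Inl j):]:])"
      by (subst sum.remove[of _ i]) (auto intro: sum.cong)
    also have "\<dots> = [:[:\<Sum>j\<in>UNIV - {i}. of_int (A i j) * pt (Inl j):], 2:]"
      by (simp only: *) (simp add: A_diag numeral_poly)
    finally show "line pt i b (G i (0 *s b)) =
        [:[:\<Sum>j\<in>UNIV - {i}. of_int (A i j) * pt (Inl j):], 2:]" .
  next
    fix N
    show "line pt i b (X i (0 *s b)) * hdown (line pt i b (X i (N *s b))) =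
        line pt i b (X i (N *s b)) * hdown (tshift N (line pt i b (X i (0 *s b))))"
      using arg_cong[where f = "line pt i b", OF comm_xx[of i "N *s b"]]
      by (simp add: zero line.simps line_shift_simps sh0)
    show "line pt i b (Y i (0 *s b)) * hup (line pt i b (Y i (N *s b))) =
        line pt i b (Y i (N *s b)) * hup (tshift N (line pt i b (Y i (0 *s b))))"
      using arg_cong[where f = "line pt i b", OF comm_yy[of i "N *s b"]]
      by (simp add: zero line.simps line_shift_simps sh0)
    show "line pt i b (X i (0 *s b)) * hdown (line pt i b (Y i (N *s b))) -
        line pt i b (Y i (N *s b)) * hup (tshift N (line pt i b (X i (0 *s b)))) =
        line pt i b (G i (N *s b))"
      using arg_cong[where f = "line pt i b", OF comm_xy[of i 0 "N *s b"]]
      by (simp add: zero line.simps line_shift_simps sh0)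
    show "line pt i b (X i (N *s b)) * hdown (tshift N (line pt i b (Y i (0 *s b)))) -
        line pt i b (Y i (0 *s b)) * hup (line pt i b (X i (N *s b))) =
        line pt i b (G i (N *s b))"
      using arg_cong[where f = "line pt i b", OF comm_xy[of i "N *s b" 0]]
      by (simp add: zero line.simps line_shift_simps sh0)
  next
    fix N M
    show "line pt i b (G i (N *s b)) * tshift N (line pt i b (X i (M *s b))) -
        line pt i b (X i (M *s b)) * hdown (tshift M (line pt i b (G i (N *s b)))) =
        2 * line pt i b (X i ((M + N) *s b))"
      using arg_cong[where f = "line pt i b", OF comm_hx[of i i "N *s b" "M *s b", unfolded add A_diag]]
      by (simp add: A_diag line.simps line_shift_simps)
    show "line pt i b (G i (N *s b)) * tshift N (line pt i b (Y i (M *s b))) -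
        line pt i b (Y i (M *s b)) * hup (tshift M (line pt i b (G i (N *s b)))) =
        - 2 * line pt i b (Y i ((M + N) *s b))"
      using arg_cong[where f = "line pt i b", OF comm_hy[of i i "N *s b" "M *s b", unfolded add A_diag]]
      by (simp add: A_diag line.simps line_shift_simps)
  qed
qed

text \<open>As \<open>h\<^sub>i = 2 H\<^sub>i + \<dots>\<close>, this is twice the factor by which \<open>X i b\<close>, \<open>Y i b\<close> and \<open>G i b\<close> differ
  from their values at \<open>b = 0\<close>; see \<open>X_eq\<close>, \<open>Y_eq\<close> and \<open>G_eq\<close>.\<close>

definition m :: "'l \<Rightarrow> int^'n \<Rightarrow> ('l + 'n) cpoly" where
  "m i b = G i b - shift (wt i 1 0) (G i b)"

text \<open>This is \<open>sl2_line.rigid\<close> on all lines of direction \<open>b\<close>.\<close>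

lemma X_invariant: "shift (wt i 0 b) (X i 0) = X i 0"
  and Y_invariant: "shift (wt i 0 b) (Y i 0) = Y i 0"
  and m_invariant: "shift (wt i 1 0) (m i b) = m i b"
proof -
  have b: "0 *s b = 0" "1 *s b = b"
    by (simp_all add: vec_eq_iff)
  have sh: "line pt i b (shift (wt i 1 0) p) = hdown (line pt i b p)"
    "line pt i b (shift (wt i 0 b) p) = tshift 1 (line pt i b p)" for p pt
    using line_shift_simps[of pt i b 0 p] line_shift_simps[of pt i b 1 p] by (simp_all add: b)
  note r = sl2_line.rigid[OF sl2_line_object[where i = i and b = b]]
  show "shift (wt i 0 b) (X i 0) = X i 0" "shift (wt i 0 b) (Y i 0) = Y i 0"
    using r(1,2) by (auto intro!: line_eqI[where b = b and i = i] simp: sh b)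
  show "shift (wt i 1 0) (m i b) = m i b"
    using r(3) by (auto intro!: line_eqI[where b = b and i = i] simp: sh b m_def line.simps)
qed

lemma m_up: "shift (wt i (- 1) 0) (m i b) = m i b"
proof -
  have "shift (wt i (- 1) 0) (shift (wt i 1 0) (m i b)) = m i b"
    by (simp add: shift_wt_wt wt_zero)
  then show ?thesis
    by (simp add: m_invariant)
qed

lemma X_eq: "2 * X i b = m i b * X i 0"
  using comm_hx[of i i b 0] by (simp add: A_diag X_invariant m_def algebra_simps)

lemma Y_eq: "2 * Y i b = m i b * Y i 0"
proof -
  have "shift (wt i (- 1) 0) (G i b) = G i b + m i b"
    using m_up[of i b] by (simp add: m_def shift.simps shift_wt_wt wt_zero algebra_simps)
  then show ?thesis
    using comm_hy[of i i b 0] by (simp add: A_diag Y_invariant algebra_simps)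
qed

lemma casimir_0: "X i 0 * shift (wt i 1 0) (Y i 0) = Y i 0 * shift (wt i (- 1) 0) (X i 0) + G i 0"
  using comm_xy[of i 0 0] by (simp add: algebra_simps)

lemma shift_split: "shift (wt i k b) p = shift (wt i k 0) (shift (wt i 0 b) p)"
  "shift (wt i k b) p = shift (wt i 0 b) (shift (wt i k 0) p)"
  by (simp_all add: shift_wt_wt)

lemma shift_m: "shift (wt i 1 b) (m i c) = shift (wt i 0 b) (m i c)"
  "shift (wt i (- 1) b) (m i c) = shift (wt i 0 b) (m i c)"
  by (subst shift_split(2), simp add: m_invariant m_up)+

lemma shift_XY: "shift (wt i k b) (X i 0) = shift (wt i k 0) (X i 0)"
  "shift (wt i k b) (Y i 0) = shift (wt i k 0) (Y i 0)"
  by (subst shift_split(1), simp add: X_invariant Y_invariant)+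

lemma G_eq: "2 * G i b = m i b * G i 0"
proof -
  have "2 * G i b = X i 0 * shift (wt i 1 0) (2 * Y i b) - 2 * Y i b * shift (wt i (- 1) b) (X i 0)"
    using comm_xy[of i 0 b] by (simp add: shift.simps algebra_simps)
  also have "\<dots> = m i b * (X i 0 * shift (wt i 1 0) (Y i 0) - Y i 0 * shift (wt i (- 1) 0) (X i 0))"
    by (simp only: Y_eq shift.mult shift_XY[of i _ b] m_invariant) (simp add: algebra_simps)
  finally show ?thesis
    by (simp add: casimir_0)
qed

lemma m_0: "m i 0 = 2"
  by (simp add: m_def shift_G_0 A_diag)

text \<open>The brackets \<open>[x\<^sub>i(b), y\<^sub>i(c)]\<close> and \<open>[h\<^sub>i(b), h\<^sub>i(c)]\<close> contain the same central element, the second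
  one with twice the coefficient. Eliminating it leaves an identity \<open>E\<close> between polynomials of
  degree two in \<open>H\<^sub>i\<close> whose coefficients are built from \<open>\<alpha>\<close>, \<open>\<beta>\<close> and \<open>m i (b + c)\<close>. Its
  differences with respect to \<open>\<sigma>\<^sub>i\<close> give \<open>\<alpha> = \<beta>\<close> and \<open>\<alpha> = 2 m i (b + c)\<close>.\<close>

lemma m_mult: "m i b * shift (wt i 0 b) (m i c) = 2 * m i (b + c)"
  and K_eq_0: "K b (b + c) = 0"
proof -
  define S where "S = shift (wt i 1 (0 :: int^'n))"
  define F where "F = Y i 0 * shift (wt i (- 1) 0) (X i 0)"
  define g where "g = G i 0"
  define \<alpha> where "\<alpha> = m i b * shift (wt i 0 b) (m i c)"
  define \<beta> where "\<beta> = m i c * shift (wt i 0 c) (m i b)"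
  define k where "k = killing (x i) (y i)"
  have kh: "killing (h i) (h i) = 2 * k"
    by (simp add: killing_h_h A_diag k_def)
  interpret S: cpoly_hom Const S
    unfolding S_def by (rule shift.cpoly_hom_axioms)
  have inv_tau: "S (shift (wt i 0 d) (m i e)) = shift (wt i 0 d) (m i e)" for d e
    unfolding S_def shift_split(1)[symmetric] by (rule shift_m)
  have inv_m: "S (m i d) = m i d" for d
    unfolding S_def by (rule m_invariant)
  have inv: "S \<alpha> = \<alpha>" "S \<beta> = \<beta>"
    by (simp_all only: \<alpha>_def \<beta>_def S.mult inv_tau inv_m)
  have SF: "S F = F + g"
    using casimir_0[of i] by (simp add: S_def F_def g_def shift.simps shift_wt_wt wt_zero mult.commute)
  have Sg: "S g = g - 2"
    by (simp add: S_def g_def shift_G_0 A_diag)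
  have Fg: "F + g = X i 0 * shift (wt i 1 0) (Y i 0)"
    by (simp add: casimir_0 F_def g_def)
  have eq1: "2 * X i b * shift (wt i 1 b) (2 * Y i c) = \<alpha> * (F + g)"
    by (simp only: X_eq Y_eq shift.mult shift_m shift_XY[of i _ b] Fg \<alpha>_def) (simp add: mult_ac)
  have eq2: "2 * Y i c * shift (wt i (- 1) c) (2 * X i b) = \<beta> * F"
    by (simp only: X_eq Y_eq shift.mult shift_m shift_XY[of i _ c] F_def \<beta>_def) (simp add: mult_ac)
  have "2 * X i b * shift (wt i 1 b) (2 * Y i c) - 2 * Y i c * shift (wt i (- 1) c) (2 * X i b) =
      4 * (X i b * shift (wt i 1 b) (Y i c) - Y i c * shift (wt i (- 1) c) (X i b))"
    by (simp add: shift.simps algebra_simps)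
  also have "\<dots> = 2 * (2 * G i (b + c)) + 4 * (Const k * K b (b + c))"
    by (simp add: comm_xy k_def algebra_simps)
  finally have xy: "\<alpha> * (F + g) - \<beta> * F = 2 * (m i (b + c) * g) + 4 * (Const k * K b (b + c))"
    by (simp only: eq1 eq2 G_eq g_def)
  have "2 * G i b * shift (wt i 0 b) (2 * G i c) - 2 * G i c * shift (wt i 0 c) (2 * G i b) =
      8 * (Const k * K b (b + c))"
  proof -
    have "2 * G i b * shift (wt i 0 b) (2 * G i c) - 2 * G i c * shift (wt i 0 c) (2 * G i b) =
      4 * (G i b * shift (wt i 0 b) (G i c) - G i c * shift (wt i 0 c) (G i b))"
      by (simp add: shift.simps algebra_simps)
    then show ?thesis
      by (simp add: comm_hh kh Const_mult Const_numeral)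
  qed
  then have hh: "(\<alpha> - \<beta>) * (g * g) = 8 * (Const k * K b (b + c))"
    by (simp only: G_eq shift.mult shift_G_0)
      (simp add: \<alpha>_def \<beta>_def g_def algebra_simps)
  define \<delta> where "\<delta> = \<alpha> - \<beta>"
  define \<epsilon> where "\<epsilon> = 2 * \<alpha> - 4 * m i (b + c)"
  have d: "S \<delta> = \<delta>" "S \<epsilon> = \<epsilon>"
    by (simp_all add: \<delta>_def \<epsilon>_def S.simps inv inv_m)
  have E: "2 * \<delta> * F + \<epsilon> * g - \<delta> * (g * g) = 0"
  proof -
    have "2 * (\<alpha> * (F + g) - \<beta> * F) = 4 * (m i (b + c) * g) + (\<alpha> - \<beta>) * (g * g)"
      unfolding hh xy by (simp add: algebra_simps)
    then show ?thesis
      by (simp add: \<delta>_def \<epsilon>_def algebra_simps)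
  qed
  \<comment> \<open>First difference of \<open>E\<close>.\<close>
  have "S (2 * \<delta> * F + \<epsilon> * g - \<delta> * (g * g)) = 0"
    by (simp add: E S.zero)
  then have SE: "2 * \<delta> * (F + g) + \<epsilon> * (g - 2) - \<delta> * ((g - 2) * (g - 2)) = 0"
    by (simp add: S.simps d SF Sg)
  have "6 * \<delta> * g - 2 * \<epsilon> - 4 * \<delta> =
      (2 * \<delta> * (F + g) + \<epsilon> * (g - 2) - \<delta> * ((g - 2) * (g - 2))) -
      (2 * \<delta> * F + \<epsilon> * g - \<delta> * (g * g))"
    by (simp add: algebra_simps)
  then have E1: "6 * \<delta> * g - 2 * \<epsilon> - 4 * \<delta> = 0"
    by (simp only: SE E diff_self)
  \<comment> \<open>Second difference of \<open>E\<close>.\<close>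
  have "S (6 * \<delta> * g - 2 * \<epsilon> - 4 * \<delta>) = 0"
    by (simp add: E1 S.zero)
  then have SE1: "6 * \<delta> * (g - 2) - 2 * \<epsilon> - 4 * \<delta> = 0"
    by (simp add: S.simps d Sg)
  have "12 * \<delta> = (6 * \<delta> * g - 2 * \<epsilon> - 4 * \<delta>) - (6 * \<delta> * (g - 2) - 2 * \<epsilon> - 4 * \<delta>)"
    by (simp add: algebra_simps)
  then have "12 * \<delta> = 0"
    by (simp only: SE1 E1 diff_self)
  then have d0: "\<delta> = 0"
    using cpoly_mult_eq_0[of 12 \<delta>] by simp
  then have "2 * \<epsilon> = 0"
    using E1 by simp
  then have "\<epsilon> = 0"
    using cpoly_mult_eq_0[of 2 \<epsilon>] by simp
  then have "2 * \<alpha> = 2 * (2 * m i (b + c))"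
    by (simp add: \<epsilon>_def)
  then show "m i b * shift (wt i 0 b) (m i c) = 2 * m i (b + c)"
    unfolding \<alpha>_def by (rule cpoly_mult_left_cancel) simp
  have "k \<noteq> 0"
    using killing_h_h_nonzero[of i] by (simp add: kh A_diag)
  moreover have "8 * (Const k * K b (b + c)) = 0"
    using hh d0 by (simp add: \<delta>_def)
  ultimately show "K b (b + c) = 0"
    using cpoly_mult_eq_0[of 8 "Const k * K b (b + c)"] cpoly_mult_eq_0[of "Const k" "K b (b + c)"]
    by (metis Const_0 Const_eq_iff zero_neq_numeral)
qed

text \<open>\<open>t\<^sup>a K\<^sub>j\<close> occurs in brackets of degrees \<open>b\<close> and \<open>a - b\<close>, where \<open>b\<close> is the \<open>j\<close>-th unit
  vector.\<close>

lemma act_central: "act (central a j) p = 0"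
proof -
  have "act (central a j) p = shift (wt undefined 0 a) p * K (axis j 1) (axis j 1 + (a - axis j 1))"
    by (simp add: central_def KA_lin_axis[symmetric] act_K[of _ _ _ undefined])
  then show ?thesis
    by (simp only: K_eq_0 mult_zero_right)
qed

definition chi :: "'l \<Rightarrow> int^'n \<Rightarrow> complex" where
  "chi i b = eval (\<lambda>_. 0) (m i b) / 2"

text \<open>By \<open>m_mult\<close> with \<open>c = - b\<close>, the polynomial \<open>m i b\<close> is invertible.\<close>

lemma m_eq_chi: "m i b = 2 * Const (chi i b)"
proof -
  have "m i b * (shift (wt i 0 b) (m i (- b)) * Const (1 / 4)) = 1"
    using m_mult[of i b "- b"]
    by (simp add: m_0 mult.assoc[symmetric]) (simp flip: Const_numeral Const_mult)
  then obtain c where "m i b = Const c"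
    using cpoly_unit_imp_Const by metis
  then show ?thesis
    by (simp add: chi_def eval.const flip: Const_numeral Const_mult)
qed

lemma chi_add: "chi i (b + c) = chi i b * chi i c"
proof -
  have "Const (4 * (chi i b * chi i c)) = (Const (4 * chi i (b + c)) :: ('l + 'n) cpoly)"
    using m_mult[of i b c] by (simp add: m_eq_chi shift.simps Const_mult Const_numeral mult_ac)
  then show ?thesis
    by simp
qed

lemma chi_0: "chi i 0 = 1"
  by (simp add: chi_def m_0 eval.simps)

lemma X_chi: "X i b = Const (chi i b) * X i 0"
  and Y_chi: "Y i b = Const (chi i b) * Y i 0"
  and G_chi: "G i b = Const (chi i b) * G i 0"
proof -
  show "X i b = Const (chi i b) * X i 0"
    by (rule cpoly_mult_left_cancel[of 2]) (simp_all add: X_eq m_eq_chi)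
  show "Y i b = Const (chi i b) * Y i 0"
    by (rule cpoly_mult_left_cancel[of 2]) (simp_all add: Y_eq m_eq_chi)
  show "G i b = Const (chi i b) * G i 0"
    by (rule cpoly_mult_left_cancel[of 2]) (simp_all add: G_eq m_eq_chi)
qed

lemma X_nonzero: "X i 0 \<noteq> 0"
proof
  assume "X i 0 = 0"
  then have "G i 0 = 0"
    using casimir_0[of i] by (simp add: shift.simps)
  then have "m i 0 = 0"
    by (simp add: m_def shift.simps)
  then show False
    by (simp add: m_0)
qed

text \<open>Both characters appear in \<open>[h\<^sub>i(b), x\<^sub>j] = A\<^sub>i\<^sub>j x\<^sub>j(b)\<close>.\<close>

lemma chi_adjacent:
  assumes "A i j \<noteq> 0"
  shows "chi i b = chi j b"
proof -
  have "of_int (A i j) * X j b =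
      Const (chi i b) * (G i 0 * shift (wt j 0 b) (X j 0) - X j 0 * shift (wt j 1 0) (G i 0))"
    using comm_hx[OF assms, of b 0] G_chi[of i b] by (simp add: shift.simps algebra_simps)
  also have "\<dots> = Const (chi i b) * (of_int (A i j) * X j 0)"
    by (simp add: X_invariant shift_G_0 algebra_simps)
  finally have "(of_int (A i j) * X j 0) * Const (chi j b) = (of_int (A i j) * X j 0) * Const (chi i b)"
    by (simp add: X_chi[of j b] mult_ac)
  moreover have "of_int (A i j) * X j 0 \<noteq> 0"
    using cpoly_mult_eq_0[of "of_int (A i j)" "X j 0"] X_nonzero assms by auto
  ultimately have "Const (chi j b) = (Const (chi i b) :: ('l + 'n) cpoly)"
    by (rule cpoly_mult_left_cancel)
  then show ?thesis
    by simp
qed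

end


section \<open>Multiplicative characters of the lattice\<close>

lemma lam_pow_add:
  assumes "\<And>j. lam $ j \<noteq> 0"
  shows "lam_pow lam (a + b) = lam_pow lam a * lam_pow lam b"
  using assms by (simp add: lam_pow_def power_int_add prod.distrib)

lemma lam_pow_0 [simp]: "lam_pow lam 0 = 1"
  by (simp add: lam_pow_def)

lemma lattice_character_eq_lam_pow:
  fixes ch :: "int^'n::finite \<Rightarrow> complex"
  assumes add: "\<And>a b. ch (a + b) = ch a * ch b" and zero: "ch 0 = 1"
  shows "ch b = lam_pow (\<chi> j. ch (axis j 1)) b"
    and "ch b \<noteq> 0"
proof -
  have inv: "ch b * ch (- b) = 1" for b
    using add[of b "- b"] by (simp add: zero)
  then show nz: "ch b \<noteq> 0" for b
    by (metis mult_zero_left zero_neq_one)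
  have nat: "ch (axis j (int n)) = ch (axis j 1) ^ n" for j n
  proof (induction n)
    case 0
    have "axis j (int 0) = (0 :: int^'n)"
      by (simp add: vec_eq_iff axis_def)
    then show ?case
      by (simp only: zero power_0)
  next
    case (Suc n)
    have "axis j (int (Suc n)) = axis j 1 + axis j (int n)"
      by (simp add: axis_def vec_eq_iff)
    then show ?case
      by (simp add: add Suc)
  qed
  have int: "ch (axis j k) = ch (axis j 1) powi k" for j k
  proof (cases "k \<ge> 0")
    case True
    then show ?thesis
      using nat[of j "nat k"] by (simp add: power_int_def)
  next
    case False
    then have neg: "axis j k = - axis j (int (nat (- k)))"
      by (simp add: axis_def vec_eq_iff)
    have "ch (axis j (int (nat (- k)))) * ch (axis j k) = 1"
      by (simp only: neg inv)
    then have "ch (axis j 1) ^ nat (- k) * ch (axis j k) = 1"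
      by (simp only: nat)
    then have "ch (axis j k) = inverse (ch (axis j 1) ^ nat (- k))"
      by (metis inverse_unique)
    then show ?thesis
      using False by (simp add: power_int_def power_inverse)
  qed
  have sum: "ch (\<Sum>j\<in>S. f j) = (\<Prod>j\<in>S. ch (f j))" for S :: "'n set" and f
    by (induction S rule: infinite_finite_induct) (simp_all add: zero add)
  have "(\<Sum>j\<in>UNIV. axis j (b $ j)) = b"
    by (simp add: vec_eq_iff axis_def)
  then have "ch b = (\<Prod>j\<in>UNIV. ch (axis j (b $ j)))"
    using sum[of "\<lambda>j. axis j (b $ j)" UNIV] by simp
  also have "\<dots> = (\<Prod>j\<in>UNIV. ch (axis j 1) powi (b $ j))"
    by (rule prod.cong[OF refl int])
  finally show "ch b = lam_pow (\<chi> j. ch (axis j 1)) b"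
    by (simp add: lam_pow_def)
qed

section \<open>Connectedness of the Dynkin diagram\<close>

lemma type_A_C_diag: "type_A A \<or> type_C A \<Longrightarrow> A i i = 2"
  by (auto simp: type_A_def type_C_def cartan_A_def cartan_C_def)

text \<open>Consecutive nodes are adjacent, so \<open>f\<close> is constant along the numbering of the nodes.\<close>

lemma type_A_C_connected:
  fixes A :: "'l::finite \<Rightarrow> 'l \<Rightarrow> int"
  assumes A: "type_A A \<or> type_C A" and f: "\<And>i j. A i j \<noteq> 0 \<Longrightarrow> f i = f j"
  shows "f i = f j"
proof -
  obtain e where e: "bij_betw e UNIV {1..CARD('l)}" and adj: "\<And>i j. e j = Suc (e i) \<Longrightarrow> A i j \<noteq> 0"
    using A by (auto simp: type_A_def type_C_def cartan_A_def cartan_C_def)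
  define g where "g n = f (inv e n)" for n
  have inj: "inj e" and ran: "range e = {1..CARD('l)}"
    using e by (auto simp: bij_betw_def)
  have "g (Suc n) = g n" if "1 \<le> n" "Suc n \<le> CARD('l)" for n
  proof -
    have "n \<in> range e" "Suc n \<in> range e"
      using that by (auto simp: ran)
    then have "e (inv e (Suc n)) = Suc (e (inv e n))"
      by (simp add: f_inv_into_f)
    from f[OF adj[OF this]] show ?thesis
      by (simp add: g_def)
  qed
  then have "g (Suc n) = g 1" if "Suc n \<le> CARD('l)" for n
    using that by (induction n) auto
  then have "g (e k) = g 1" for k
    using ran by (metis atLeastAtMost_iff rangeI Suc_pred' One_nat_def Suc_le_eq)
  then show ?thesis
    using inj by (metis g_def inv_f_f)
qed

section \<open>Uniqueness of the action\<close>

lemma KA_induct [case_names gen add scale]: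
  fixes k :: "'n::finite KA"
  assumes gen: "\<And>a j. P (KA_gen a j)" and add: "\<And>k l. P k \<Longrightarrow> P l \<Longrightarrow> P (k + l)"
    and scale: "\<And>c k. P k \<Longrightarrow> P (KA_scale c k)"
  shows "P k"
proof -
  have zero: "P 0"
    using scale[OF gen, of 0] by simp
  have single: "P (abs_KA (axis j q))" for j and q :: "'n laurent"
  proof (induction q rule: poly_mapping_additive_induct)
    case (single a c)
    have "axis j (Poly_Mapping.single a c) = Omega_scale c (Omega_gen a j)"
      by (auto simp: Omega_scale_def Omega_gen_def vec_eq_iff axis_def mult_single)
    then have "abs_KA (axis j (Poly_Mapping.single a c)) = KA_scale c (KA_gen a j)"
      by (simp add: KA_scale.abs_eq KA_gen.abs_eq)
    then show ?case
      using scale gen by simp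
  next
    case (add u v)
    have "axis j (u + v) = axis j u + axis j v"
      by (simp add: vec_eq_iff axis_def)
    then show ?case
      using assms(2)[OF add] by (simp add: plus_KA.abs_eq)
  qed
  have "P (abs_KA (\<Sum>j\<in>S. axis j (w $ j)))" for S and w :: "'n Omega"
    by (induction S rule: infinite_finite_induct)
      (use zero in \<open>simp_all add: add single zero_KA_def flip: plus_KA.abs_eq\<close>)
  moreover have "(\<Sum>j\<in>UNIV. axis j (w $ j)) = w" for w :: "'n Omega"
    by (simp add: vec_eq_iff axis_def)
  ultimately have "P (abs_KA w)" for w
    by metis
  then show ?thesis
    by (induction k) auto
qed

context chevalley_lie_algebra
begin

text \<open>The \<open>z\<close> for which all loops \<open>z(a)\<close> act in the same way form a subalgebra, since
  \<open>[u, v](a) = [u(0), v(a)]\<close> without a central term.\<close>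

lemma is_toroidal_module_unique:
  fixes act act' :: "('g, 'n::finite) toroidal \<Rightarrow> ('l + 'n) cpoly \<Rightarrow> ('l + 'n) cpoly"
  assumes act: "is_toroidal_module lam M act" and act': "is_toroidal_module lam M act'"
  shows "act = act'"
proof -
  interpret L: lie_module toroidal_scale toroidal_bracket poly_scale act
    using act by (simp add: is_toroidal_module_def)
  interpret L': lie_module toroidal_scale toroidal_bracket poly_scale act'
    using act' by (simp add: is_toroidal_module_def)
  have zero: "act 0 p = 0" "act' 0 p = 0" for p
    using L.act_add_left[of 0 0 p] L'.act_add_left[of 0 0 p] by simp_all
  have "act Z p = act' Z p" for Z p
  proof (induction Z arbitrary: p rule: toroidal_additive_induct)
    case (loop z a)
    show ?case
    proof (induction z arbitrary: a p rule: generated_induct)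
      case (x i)
      then show ?case using act act' by (simp add: is_toroidal_module_def)
    next
      case (y i)
      then show ?case using act act' by (simp add: is_toroidal_module_def)
    next
      case (add u v)
      then show ?case by (simp add: loop_add L.act_add_left L'.act_add_left)
    next
      case (scale c u)
      then show ?case
        by (simp add: L.act_scale_left L'.act_scale_left flip: toroidal_scale_simps(2))
    next
      case (bracket u v)
      have "toroidal_bracket (loop u 0) (loop v a) = loop (bracket u v) a"
        by (simp add: toroidal_bracket_loop_loop' flip: zero_prod_def)
      then show ?case
        using L.act_bracket[of "loop u 0" "loop v a" p] L'.act_bracket[of "loop u 0" "loop v a" p]
        by (simp add: bracket)
    qed
  next
    case (center k)
    show ?case
    proof (induction k arbitrary: p rule: KA_induct)
      case (gen a j)
      then show ?case
        using act act' by (simp add: is_toroidal_module_def central_def)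
    next
      case (add k l)
      have "(0, k + l, 0) = (0, k, 0) + ((0, l, 0) :: ('g, 'n) toroidal)"
        by simp
      then show ?case
        by (simp only: L.act_add_left L'.act_add_left add)
    next
      case (scale c k)
      have "(0, KA_scale c k, 0) = (toroidal_scale c (0, k, 0) :: ('g, 'n) toroidal)"
        by (simp add: toroidal_scale_simps vec_scale_zero)
      then show ?case
        by (simp only: L.act_scale_left L'.act_scale_left scale)
    qed
  next
    case (deriv d)
    have "act (\<Sum>j\<in>S. toroidal_scale (d $ j) (deg_deriv j)) p =
        act' (\<Sum>j\<in>S. toroidal_scale (d $ j) (deg_deriv j)) p" for S
      using act act'
      by (induction S rule: infinite_finite_induct)
        (simp_all add: zero L.act_add_left L'.act_add_left L.act_scale_left L'.act_scale_left
          is_toroidal_module_def)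
    moreover have "(\<Sum>j\<in>S. toroidal_scale (d $ j) (deg_deriv j)) =
        ((0, 0, \<Sum>j\<in>S. axis j (d $ j)) :: ('g, 'n) toroidal)" for S
      by (induction S rule: infinite_finite_induct)
        (simp_all add: toroidal_scale_simps deg_deriv_def zero_prod_def vec_eq_iff axis_def)
    moreover have "(\<Sum>j\<in>UNIV. axis j (d $ j)) = d"
      by (simp add: vec_eq_iff axis_def)
    ultimately show ?case
      by metis
  next
    case (add u v)
    then show ?case by (simp add: L.act_add_left L'.act_add_left)
  qed
  then show ?thesis
    by (intro ext)
qed

lemma toroidal_module_eqI: "is_toroidal_module lam M act \<Longrightarrow> toroidal_module lam M = act"
  unfolding toroidal_module_def by (rule the_equality) (auto intro: is_toroidal_module_unique)

lemma cartan_poly_add: "u \<in> cartan \<Longrightarrow> v \<in> cartan \<Longrightarrow>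
    cartan_poly (u + v) = cartan_poly u + cartan_poly v"
  using H_basis by (simp add: cartan_poly_def basis_family_def representation_add Const_add
      distrib_right sum.distrib)

lemma cartan_poly_scale: "u \<in> cartan \<Longrightarrow> cartan_poly (scale c u) = Const c * cartan_poly u"
  using H_basis by (simp add: cartan_poly_def basis_family_def representation_scale Const_mult
      sum_distrib_left mult.assoc)

lemma cartan_poly_h: "cartan_poly (h i) = (\<Sum>j\<in>UNIV. of_int (A i j) * Var (Inl j))"
  by (simp add: cartan_poly_def coord_h Const_of_int)

end

section \<open>Every object is a toroidal module\<close>

context toroidal_object
begin

interpretation L: lie_module toroidal_scale toroidal_bracket poly_scale act
  by (rule is_module)

text \<open>The module over the simple Lie algebra: its copy in degree \<open>0\<close> preserves the polynomials in
  the \<open>H\<^sub>i\<close> alone (\<open>act_embed\<close>), so that setting the degree variables to \<open>0\<close> loses nothing.\<close>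

definition M :: "'g \<Rightarrow> 'l cpoly \<Rightarrow> 'l cpoly" where
  "M z p = at_zero (act (loop z 0) (embed p))"

lemma embed_XY: "embed (at_zero (X i 0)) = X i 0" "embed (at_zero (Y i 0)) = Y i 0"
  by (rule tau_invariant_imp_embed[symmetric]; simp add: tau_eq_shift[of _ i] X_invariant Y_invariant)+

text \<open>The elements that preserve this subspace form a subalgebra; it contains the generators by
  \<open>embed_XY\<close>.\<close>

lemma act_embed: "act (loop z 0) (embed p) = embed (M z p)"
proof -
  have "\<exists>q. act (loop z 0) (embed p) = embed q"
  proof (induction z arbitrary: p rule: generated_induct)
    case (x i)
    have "act (loop (x i) 0) (embed p) =
        embed (shift (\<lambda>j. if j = i then 1 else 0) p * at_zero (X i 0))"
      by (simp add: act_x shift_embed embed.mult embed_XY)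
    then show ?case by blast
  next
    case (y i)
    have "act (loop (y i) 0) (embed p) =
        embed (shift (\<lambda>j. if j = i then - 1 else 0) p * at_zero (Y i 0))"
      by (simp add: act_y shift_embed embed.mult embed_XY)
    then show ?case by blast
  next
    case (add u v)
    then show ?case by (metis act_loop_add embed.add)
  next
    case (scale c u)
    then show ?case by (metis act_loop_scale embed.mult embed.const)
  next
    case (bracket u v)
    have "act (loop (bracket u v) 0) (embed p) =
        act (loop u 0) (act (loop v 0) (embed p)) - act (loop v 0) (act (loop u 0) (embed p))"
      using act_comm[of u 0 v 0 "embed p"] by simp
    then show ?case
      by (metis bracket embed.diff)
  qed
  then show ?thesis
    by (auto simp: M_def)
qed

lemma M_object: "M \<in> objects_M scale bracket H"
proof -
  have "lie_module scale bracket poly_scale M"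
  proof (intro lie_module.intro lie_module_axioms.intro lie_algebra_axioms vector_space_poly_scale)
    fix u w p q c
    show "M (u + w) p = M u p + M w p"
      by (simp add: M_def act_loop_add at_zero.add)
    show "M u (p + q) = M u p + M u q"
      by (simp add: M_def L.act_add_right at_zero.add embed.add)
    show "M (scale c u) p = poly_scale c (M u p)"
      by (simp add: M_def act_loop_scale at_zero.simps poly_scale_def)
    show "M u (poly_scale c p) = poly_scale c (M u p)"
      using L.act_scale_right[of "loop u 0" c "embed p"]
      by (simp add: M_def at_zero.simps embed.simps poly_scale_def)
    show "M (bracket u w) p = M u (M w p) - M w (M u p)"
    proof -
      have "embed (M (bracket u w) p) = (embed (M u (M w p) - M w (M u p)) :: ('l + 'n) cpoly)"
        using act_comm[of u 0 w 0 "embed p"] by (simp add: act_embed embed.simps)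
      then show ?thesis
        by (simp only: embed_eq_iff)
    qed
  qed
  moreover have "M (H i) p = Var i * p" for i p
    using act_basis[of "Inl i" "embed p"] by (simp add: M_def toroidal_basis_def at_zero.simps)
  ultimately show ?thesis
    by (auto simp: objects_M_def category_M_def free_iso_def intro!: exI[of _ id])
qed

lemma act_cartan:
  assumes chi: "\<And>j. chi j = chi i" and k: "k \<in> cartan"
  shows "act (loop k a) p = Const (chi i a) * cartan_poly k * tau a p"
proof -
  have sub: "subspace cartan"
    using cartan by (simp add: cartan_subalgebra_def subalgebra_def)
  have "k \<in> span (range h)"
    using k h_basis by (simp add: basis_family_def)
  then have "k \<in> cartan \<and> act (loop k a) p = Const (chi i a) * cartan_poly k * tau a p"
  proof (induction k rule: span_induct_alt)
    case base
    have "(cartan_poly 0 :: ('l + 'n) cpoly) = 0"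
      using cartan_poly_scale[OF k, of 0] by simp
    then show ?case
      using sub by (simp add: act_loop_0 subspace_0)
  next
    case (step c u v)
    then obtain j where u: "u = h j" by blast
    have "act (loop (h j) a) p = Const (chi i a) * cartan_poly (h j) * tau a p"
      by (simp add: act_h[of _ _ _ j] G_chi[of j a] chi[of j] G_0 cartan_poly_h tau_eq_shift[of _ j] mult_ac)
    moreover have "scale c (h j) \<in> cartan"
      using h_in_cartan sub by (simp add: subspace_scale)
    ultimately show ?case
      using step(2) h_in_cartan sub
      by (simp add: u act_loop_add act_loop_scale cartan_poly_add cartan_poly_scale subspace_add
          algebra_simps)
  qed
  then show ?thesis ..
qed

lemma act_is_toroidal_module:
  assumes chi: "\<And>j. chi j = chi i"
  shows "is_toroidal_module (\<chi> j. chi i (axis j 1)) M act"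
proof -
  have lam: "lam_pow (\<chi> j. chi i (axis j 1)) a = chi i a" for a
    by (rule lattice_character_eq_lam_pow(1)[symmetric]) (simp_all add: chi_add chi_0)
  have M_xy: "embed (M (x k) 1) = X k 0" "embed (M (y k) 1) = Y k 0" for k
    by (simp_all add: M_def embed.one embed_XY flip: X_def Y_def)
  show ?thesis
    unfolding is_toroidal_module_def lam
  proof (intro conjI allI ballI)
    show "act (deg_deriv j) p = Var (Inr j) * p" for j p
      using act_basis[of "Inr j" p] by (simp add: toroidal_basis_def)
    show "act (loop k a) p = Const (chi i a) * cartan_poly k * tau a p" if "k \<in> cartan" for k a p
      using chi that by (rule act_cartan)
    show "act (loop (x k) a) p = Const (chi i a) * sigma k (tau a p) * embed (M (x k) 1)" for k a p
      using chi[of k] by (simp add: act_x X_chi[of k a] M_xy shift_wt_eq_sigma_tau mult_ac)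
    show "act (loop (y k) a) p = Const (chi i a) * inv (sigma k) (tau a p) * embed (M (y k) 1)" for k a p
      using chi[of k] by (simp add: act_y Y_chi[of k a] M_xy shift_wt_eq_sigma_tau mult_ac)
  qed (rule is_module act_central)+
qed

end


section \<open>Extension of scalars from the Cartan variables\<close>

definition embed_deg :: "'n::finite cpoly \<Rightarrow> ('l::finite + 'n) cpoly" where
  "embed_deg = poly_subst (\<lambda>j. Var (Inr j))"

interpretation embed_deg: cpoly_hom Const embed_deg
  unfolding embed_deg_def by (rule cpoly_hom_poly_subst)

lemma embed_deg_Var [simp]: "embed_deg (Var j) = Var (Inr j)"
  by (simp add: embed_deg_def)

lemma tau_embed_deg: "tau a (embed_deg q) = embed_deg (shift (\<lambda>j. a $ j) q)"
  by (rule cpoly_hom_eqI[OF cpoly_hom_comp[OF embed_deg.cpoly_hom_axioms tau.cpoly_hom_axioms]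
        cpoly_hom_comp[OF shift.cpoly_hom_axioms embed_deg.cpoly_hom_axioms]])
    (simp add: embed_deg.simps)

lemma shift_embed_deg: "shift (wt i k 0) (embed_deg q) = embed_deg q"
  by (rule cpoly_hom_eqI[OF cpoly_hom_comp[OF embed_deg.cpoly_hom_axioms shift.cpoly_hom_axioms]
        embed_deg.cpoly_hom_axioms])
    (simp add: wt_def)

definition Inl_monomial :: "('l + 'n \<Rightarrow>\<^sub>0 nat) \<Rightarrow> 'l::finite cpoly" where
  "Inl_monomial m = (\<Prod>i\<in>UNIV. Var i ^ Poly_Mapping.lookup m (Inl i))"

definition Inr_monomial :: "('l + 'n \<Rightarrow>\<^sub>0 nat) \<Rightarrow> 'n::finite cpoly" where
  "Inr_monomial m = (\<Prod>j\<in>UNIV. Var j ^ Poly_Mapping.lookup m (Inr j))"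

text \<open>The polynomial ring is the tensor product of the polynomials in the \<open>H\<^sub>i\<close> and those in the
  \<open>d\<^sub>j\<close>.\<close>

lemma monomial_tensor:
  "Poly_Mapping.single m 1 = embed (Inl_monomial m) * embed_deg (Inr_monomial m)"
proof -
  have "Poly_Mapping.single m 1 = (\<Prod>v\<in>UNIV <+> UNIV. Var v ^ Poly_Mapping.lookup m v)"
    by (simp only: monomial_eq_prod UNIV_Plus_UNIV)
  also have "\<dots> = embed (Inl_monomial m) * embed_deg (Inr_monomial m)"
    by (subst prod.Plus)
      (simp_all add: Inl_monomial_def Inr_monomial_def embed.simps embed_deg.simps)
  finally show ?thesis .
qed

lemma cpoly_tensor_induct [case_names tensor add]:
  fixes p :: "('l::finite + 'n::finite) cpoly"
  assumes tensor: "\<And>f q. P (embed f * embed_deg q)" and add: "\<And>p q. P p \<Longrightarrow> P q \<Longrightarrow> P (p + q)"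
  shows "P p"
proof (induction p rule: poly_mapping_additive_induct)
  case (single m c)
  have "Poly_Mapping.single m c = embed (Const c * Inl_monomial m) * embed_deg (Inr_monomial m)"
    by (subst monomial_eq_Const_mult) (simp add: monomial_tensor embed.simps mult.assoc)
  then show ?case
    by (simp only: tensor)
qed (rule add)

definition linear_op :: "('v cpoly \<Rightarrow> 'v cpoly) \<Rightarrow> bool" where
  "linear_op T \<longleftrightarrow> (\<forall>p q. T (p + q) = T p + T q) \<and> (\<forall>c p. T (Const c * p) = Const c * T p)"

text \<open>The operator \<open>T \<otimes> 1\<close> on the tensor product (\<open>extend_tensor\<close>), written out on monomials to make it
  well defined.\<close>

definition extend :: "('l::finite cpoly \<Rightarrow> 'l cpoly) \<Rightarrow> ('l + 'n::finite) cpoly \<Rightarrow> ('l + 'n) cpoly" where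
  "extend T p = (\<Sum>m\<in>Poly_Mapping.keys p. Const (Poly_Mapping.lookup p m) *
     (embed (T (Inl_monomial m)) * embed_deg (Inr_monomial m)))"

lemma extend_add: "extend T (p + q) = extend T p + extend T q"
  unfolding extend_def
  by (rule sum_keys_add[where
        f = "\<lambda>m c. Const c * (embed (T (Inl_monomial m)) * embed_deg (Inr_monomial m))"])
    (simp add: Const_add algebra_simps)

lemma extend_diff: "extend T (p - q) = extend T p - extend T q"
  using extend_add[of T "p - q" q] by simp

lemma extend_single: "extend T (Poly_Mapping.single m c) =
    Const c * (embed (T (Inl_monomial m)) * embed_deg (Inr_monomial m))"
  by (simp add: extend_def)

lemma lookup_sum_single:
  "Poly_Mapping.lookup ((\<Sum>i\<in>UNIV. Poly_Mapping.single (Inl i) (f i)) +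
     (\<Sum>j\<in>UNIV. Poly_Mapping.single (Inr j) (g j))) v = case_sum f g v"
  for v :: "'l::finite + 'n::finite" and f :: "'l \<Rightarrow> nat"
  by (cases v) (simp_all add: lookup_add lookup_sum lookup_single when_def)

lemma extend_tensor:
  fixes f :: "'l::finite cpoly" and q :: "'n::finite cpoly"
  assumes T: "linear_op T"
  shows "extend T (embed f * embed_deg q) = embed (T f) * embed_deg q"
proof (induction f rule: poly_mapping_additive_induct)
  case (single a c)
  show ?case
  proof (induction q rule: poly_mapping_additive_induct)
    case (single b d)
    define m where "m = (\<Sum>i\<in>UNIV. Poly_Mapping.single (Inl i :: 'l + 'n) (Poly_Mapping.lookup a i)) +
      (\<Sum>j\<in>UNIV. Poly_Mapping.single (Inr j) (Poly_Mapping.lookup b j))"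
    have m: "Inl_monomial m = Poly_Mapping.single a 1" "Inr_monomial m = Poly_Mapping.single b 1"
      by (simp_all add: Inl_monomial_def Inr_monomial_def m_def lookup_sum_single monomial_eq_prod)
    have ac: "Poly_Mapping.single a c = Const c * Poly_Mapping.single a 1"
      and bd: "Poly_Mapping.single b d = Const d * Poly_Mapping.single b 1"
      by (rule monomial_eq_Const_mult)+
    have "embed (Poly_Mapping.single a c) * embed_deg (Poly_Mapping.single b d) =
        Const (c * d) * (embed (Inl_monomial m) * embed_deg (Inr_monomial m))"
      by (simp only: ac bd m embed.mult embed.const embed_deg.mult embed_deg.const Const_mult mult_ac)
    also have "\<dots> = Poly_Mapping.single m (c * d)"
      by (simp only: monomial_eq_Const_mult[of m "c * d"] monomial_tensor)
    finally have "extend T (embed (Poly_Mapping.single a c) * embed_deg (Poly_Mapping.single b d)) =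
        Const (c * d) * (embed (T (Poly_Mapping.single a 1)) * embed_deg (Poly_Mapping.single b 1))"
      by (simp only: extend_single m)
    also have "\<dots> = embed (Const c * T (Poly_Mapping.single a 1)) * embed_deg (Const d * Poly_Mapping.single b 1)"
      by (simp only: embed.mult embed.const embed_deg.mult embed_deg.const Const_mult mult_ac)
    also have "Const c * T (Poly_Mapping.single a 1) = T (Poly_Mapping.single a c)"
      using T by (simp only: ac linear_op_def)
    finally show ?case
      by (simp only: bd)
  qed (simp add: embed_deg.add distrib_left extend_add)
next
  case (add u v)
  then show ?case
    using T by (simp add: embed.add distrib_right extend_add linear_op_def)
qed

lemma extend_embed_deg_mult:
  assumes T: "linear_op T"
  shows "extend T (embed_deg q * p) = embed_deg q * extend T p"
proof (induction p rule: cpoly_tensor_induct)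
  case (tensor f r)
  then show ?case
    using extend_tensor[OF T, of f "q * r"] by (simp add: extend_tensor[OF T] embed_deg.mult mult_ac)
qed (simp add: distrib_left extend_add)

lemma extend_Const_mult: "linear_op T \<Longrightarrow> extend T (Const c * p) = Const c * extend T p"
  using extend_embed_deg_mult[of T "Const c" p] by (simp add: embed_deg.const)

lemma tau_extend:
  assumes T: "linear_op T"
  shows "tau a (extend T p) = extend T (tau a p)"
  by (induction p rule: cpoly_tensor_induct)
    (simp_all add: extend_tensor[OF T] tau.mult tau_embed_deg extend_add tau.add)

section \<open>Toroidal modules are objects\<close>

locale evaluation_module = chevalley_lie_algebra scale bracket cartan A x y h H
  for scale :: "complex \<Rightarrow> 'g::ab_group_add \<Rightarrow> 'g" and bracket cartan
    and A :: "'l::finite \<Rightarrow> 'l \<Rightarrow> int" and x y h H +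
  fixes lam :: "complex^'n::finite" and M :: "'g \<Rightarrow> 'l cpoly \<Rightarrow> 'l cpoly"
  assumes lam: "lam $ j \<noteq> 0" and object: "M \<in> objects_M scale bracket H"
begin

lemma M_module: "lie_module scale bracket poly_scale M"
  using object by (simp add: objects_M_def category_M_def)

lemma M_H: "M (H i) p = Var i * p"
  using object by (simp add: objects_M_def free_iso_def)

interpretation M: lie_module scale bracket poly_scale M
  by (rule M_module)

lemma linear_M: "linear_op (M z)"
  using M.act_scale_right by (simp add: linear_op_def M.act_add_right poly_scale_def)

lemmas extend_simps = extend_tensor[OF linear_M] extend_embed_deg_mult[OF linear_M]
  extend_Const_mult[OF linear_M] tau_extend[OF linear_M] extend_add extend_diff

definition dpoly :: "complex^'n \<Rightarrow> 'n cpoly" where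
  "dpoly d = (\<Sum>j\<in>UNIV. Const (d $ j) * Var j)"

text \<open>The element \<open>z(a)\<close> acts as \<open>\<lambda>\<^sup>a z \<otimes> \<tau>\<^sup>a\<close> for every \<open>z\<close> in the Lie algebra, not only for the
  generators; this makes the module axioms a formal consequence of those for \<open>M\<close>.\<close>

definition act :: "('g, 'n) toroidal \<Rightarrow> ('l + 'n) cpoly \<Rightarrow> ('l + 'n) cpoly" where
  "act = (\<lambda>(u, k, d) p. (\<Sum>a\<in>Poly_Mapping.keys u.
      Const (lam_pow lam a) * extend (M (Poly_Mapping.lookup u a)) (tau a p)) + embed_deg (dpoly d) * p)"

lemma extend_M_add: "extend (M (z + w)) p = extend (M z) p + extend (M w) p"
proof (induction p rule: cpoly_tensor_induct)
  case (tensor f q)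
  show ?case
    by (simp only: extend_tensor[OF linear_M]) (simp add: M.act_add_left embed.add algebra_simps)
qed (simp add: extend_add algebra_simps)

lemma extend_M_scale: "extend (M (scale c z)) p = Const c * extend (M z) p"
proof (induction p rule: cpoly_tensor_induct)
  case (tensor f q)
  show ?case
    by (simp only: extend_tensor[OF linear_M]) (simp add: M.act_scale_left poly_scale_def embed.simps algebra_simps)
qed (simp add: extend_add algebra_simps)

lemma extend_M_bracket: 
  "extend (M (bracket z w)) p = extend (M z) (extend (M w) p) - extend (M w) (extend (M z) p)"
proof (induction p rule: cpoly_tensor_induct)
  case (tensor f q)
  show ?case
    by (simp only: extend_tensor[OF linear_M]) (simp add: M.act_bracket embed.diff algebra_simps)
qed (simp add: extend_add algebra_simps)

lemma extend_M_0: "extend (M 0) p = 0"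
  using extend_M_add[of 0 0 p] by simp

lemma dpoly_add: "dpoly (d + e) = dpoly d + dpoly e"
  by (simp add: dpoly_def Const_add distrib_right sum.distrib)

lemma dpoly_0: "dpoly 0 = 0"
  by (simp add: dpoly_def)

lemma dpoly_scale: "dpoly (c *s d) = Const c * dpoly d"
  by (simp add: dpoly_def Const_mult sum_distrib_left mult.assoc)

lemma tau_dpoly: "tau a (embed_deg (dpoly d)) = embed_deg (dpoly d) - Const (pairing d a)"
  by (simp add: dpoly_def pairing_def tau.simps embed_deg.simps Const_sum Const_mult
      Const_of_int right_diff_distrib sum_subtractf)

lemma act_loop: "act (loop z a) p = Const (lam_pow lam a) * extend (M z) (tau a p)"
  by (simp add: act_def loop_def dpoly_0 embed_deg.zero extend_M_0)

lemma act_center: "act (0, k, 0) p = 0"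
  by (simp add: act_def dpoly_0 embed_deg.zero)

lemma act_deriv: "act (0, 0, d) p = embed_deg (dpoly d) * p"
  by (simp add: act_def)

lemma act_add: "act (U + W) p = act U p + act W p"
proof -
  obtain u k d v l e where UW: "U = (u, k, d)" "W = (v, l, e)"
    by (cases U, cases W) auto
  show ?thesis
    unfolding UW act_def
    by (simp add: dpoly_add embed_deg.add distrib_right
        sum_keys_add[where f = "\<lambda>a z. Const (lam_pow lam a) * extend (M z) (tau a p)"]
        extend_M_add distrib_left)
qed

lemma act_0: "act 0 p = 0"
  using act_add[of 0 0 p] by simp

lemma act_minus: "act (- U) p = - act U p"
  using act_add[of "- U" U p] by (simp add: act_0 eq_neg_iff_add_eq_0)

lemma act_add_right: "act U (p + q) = act U p + act U q"
  by (induction U rule: toroidal_additive_induct)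
    (simp_all add: act_loop act_center act_deriv act_add extend_simps tau.add algebra_simps)

lemma act_right_0: "act U 0 = 0"
  using act_add_right[of U 0 0] by simp

lemma act_deriv_loop:
  "act (0, 0, d) (act (loop z a) p) - act (loop z a) (act (0, 0, d) p) =
    act (loop (scale (pairing d a) z) a) p"
  by (simp only: act_deriv act_loop tau.mult tau_dpoly left_diff_distrib extend_simps extend_M_scale)
    (simp add: algebra_simps)

lemma act_bracket: "act (toroidal_bracket U W) p = act U (act W p) - act W (act U p)"
proof (induction U arbitrary: W rule: toroidal_additive_induct)
  case (loop z a)
  show ?case
  proof (induction W rule: toroidal_additive_induct)
    case (loop w b)
    show ?case
      by (simp add: toroidal_bracket_loop_loop' act_add act_center act_loop extend_M_bracket
          extend_simps tau.simps tau_tau lam_pow_add[OF lam] Const_mult algebra_simps)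
  next
    case (center k)
    show ?case
      by (simp add: act_center act_0 act_right_0)
  next
    case (deriv d)
    show ?case
      using act_deriv_loop[of d z a p] by (simp add: loop_minus act_minus algebra_simps)
  qed (simp add: toroidal_bracket_add_right act_add act_add_right)
next
  case (center k)
  show ?case
    by (induction W rule: toroidal_additive_induct)
      (simp_all add: act_center act_0 act_right_0 toroidal_bracket_add_right act_add act_add_right)
next
  case (deriv d)
  show ?case
  proof (induction W rule: toroidal_additive_induct)
    case (loop z a)
    show ?case
      by (simp add: act_deriv_loop)
  next
    case (deriv e)
    show ?case
      by (simp add: act_deriv act_0 algebra_simps)
  qed (simp_all add: act_center act_right_0 toroidal_bracket_add_right act_add act_add_right)
qed (simp add: toroidal_bracket_add_left act_add act_add_right)

lemma act_module: "lie_module toroidal_scale toroidal_bracket poly_scale act"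
proof (intro lie_module.intro lie_module_axioms.intro lie_algebra_toroidal
    vector_space_poly_scale)
  fix U W p q c
  show "act (U + W) p = act U p + act W p"
    by (rule act_add)
  show "act U (p + q) = act U p + act U q"
    by (rule act_add_right)
  show "act (toroidal_scale c U) p = poly_scale c (act U p)"
  proof (induction U rule: toroidal_additive_induct)
    case (loop z a)
    show ?case
      by (simp add: toroidal_scale_simps act_loop extend_M_scale poly_scale_def mult_ac)
  next
    case (center k)
    show ?case
      by (simp add: toroidal_scale_simps vec_scale_zero act_center poly_scale_def)
  next
    case (deriv d)
    show ?case
      by (simp add: toroidal_scale_simps act_deriv dpoly_scale embed_deg.simps poly_scale_def mult_ac)
  next
    case (add U W)
    interpret T: vector_space "toroidal_scale :: complex \<Rightarrow> ('g, 'n) toroidal \<Rightarrow> _"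
      by (rule toroidal_vector_space)
    show ?case
      using add by (simp add: T.scale_right_distrib act_add poly_scale_def distrib_left)
  qed
  show "act U (poly_scale c p) = poly_scale c (act U p)"
    by (induction U rule: toroidal_additive_induct)
      (simp_all add: act_loop act_center act_deriv act_add extend_simps tau.simps poly_scale_def
        algebra_simps)
  show "act (toroidal_bracket U W) p = act U (act W p) - act W (act U p)"
    by (rule act_bracket)
qed

lemma extend_root_vector:
  assumes w: "\<And>j. bracket (H j) w = scale (of_int (if j = i then k else 0)) w"
  shows "extend (M w) p = shift (wt i k 0) p * embed (M w 1)"
proof -
  have "M w f = shift (\<lambda>j. if j = i then k else 0) f * M w 1" for f
    by (rule weight_vector_action[OF M_module M_H w])
  then have *: "embed (M w f) = shift (wt i k 0) (embed f) * embed (M w 1)" for f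
    by (metis embed.mult shift_embed)
  show ?thesis
  proof (induction p rule: cpoly_tensor_induct)
    case (tensor f q)
    show ?case
      by (simp only: extend_tensor[OF linear_M] *[of f] shift.mult shift_embed_deg mult_ac)
  qed (simp add: extend_add shift.add distrib_right)
qed

lemma extend_cartan:
  assumes k: "k \<in> cartan"
  shows "extend (M k) p = cartan_poly k * p"
proof -
  have sum: "M (sum f S) q = (\<Sum>i\<in>S. M (f i) q)" for f :: "'l \<Rightarrow> 'g" and S q
    using M.act_add_left[of 0 0 q]
    by (induction S rule: infinite_finite_induct) (simp_all add: M.act_add_left)
  have "M k f = (\<Sum>j\<in>UNIV. Const (coord k j) * Var j) * f" for f
    by (subst cartan_expand[OF k])
      (simp add: sum M.act_scale_left M_H poly_scale_def sum_distrib_right mult.assoc)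
  then have *: "embed (M k f) = cartan_poly k * embed f" for f
    by (simp add: cartan_poly_def embed.simps)
  show ?thesis
    by (induction p rule: cpoly_tensor_induct) (simp_all add: extend_simps * algebra_simps)
qed

lemma is_toroidal_module_act: "is_toroidal_module lam M act"
  unfolding is_toroidal_module_def
proof (intro conjI allI ballI)
  show "act (central a j) p = 0" for a j p
    by (simp add: central_def act_center)
  show "act (deg_deriv j) p = Var (Inr j) * p" for j p
  proof -
    have "dpoly (axis j 1) = (\<Sum>i\<in>UNIV. if i = j then Var i else 0)"
      unfolding dpoly_def by (rule sum.cong) (auto simp: axis_def)
    then show ?thesis
      by (simp add: deg_deriv_def act_deriv)
  qed
  show "act (loop k a) p = Const (lam_pow lam a) * cartan_poly k * tau a p" if "k \<in> cartan" for k a p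
    by (simp add: act_loop extend_cartan[OF that] mult.assoc)
  show "act (loop (x i) a) p = Const (lam_pow lam a) * sigma i (tau a p) * embed (M (x i) 1)" for i a p
  proof -
    have "extend (M (x i)) q = shift (wt i 1 0) q * embed (M (x i) 1)" for q :: "('l + 'n) cpoly"
      by (rule extend_root_vector) (auto simp: H_x)
    then show ?thesis
      by (simp add: act_loop sigma_eq_shift mult.assoc)
  qed
  show "act (loop (y i) a) p = Const (lam_pow lam a) * inv (sigma i) (tau a p) * embed (M (y i) 1)" for i a p
  proof -
    have "extend (M (y i)) q = shift (wt i (- 1) 0) q * embed (M (y i) 1)" for q :: "('l + 'n) cpoly"
      by (rule extend_root_vector) (auto simp: H_y)
    then show ?thesis
      by (simp add: act_loop inv_sigma_eq_shift mult.assoc)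
  qed
qed (rule act_module)

lemma act_object: "act \<in> objects_M toroidal_scale toroidal_bracket toroidal_basis"
proof -
  have "act (toroidal_basis v) p = Var v * p" for v p
  proof (cases v)
    case (Inl i)
    have "extend (M (H i)) p = Var (Inl i) * p"
    proof (induction p rule: cpoly_tensor_induct)
      case (tensor f q)
      show ?case
        by (subst extend_tensor[OF linear_M]) (simp add: M_H embed.mult mult.assoc)
    qed (simp add: extend_add distrib_left)
    then show ?thesis
      by (simp add: Inl toroidal_basis_def act_loop)
  next
    case (Inr j)
    then show ?thesis
      using is_toroidal_module_act by (simp add: toroidal_basis_def is_toroidal_module_def)
  qed
  then show ?thesis
    using act_module by (auto simp: objects_M_def category_M_def free_iso_def intro!: exI[of _ id])
qed

end

theorem theorem4p4:
  fixes scale :: "complex \<Rightarrow> 'g::ab_group_add \<Rightarrow> 'g"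
    and bracket :: "'g \<Rightarrow> 'g \<Rightarrow> 'g"
    and cartan :: "'g set"
    and A :: "'l::finite \<Rightarrow> 'l \<Rightarrow> int"
    and x y h H :: "'l \<Rightarrow> 'g"
  assumes "chevalley_lie_algebra scale bracket cartan A x y h H"
    and "type_A A \<or> type_C A"
  shows "objects_M (lie_algebra.toroidal_scale scale) (lie_algebra.toroidal_bracket scale bracket)
      (chevalley_lie_algebra.toroidal_basis H :: 'l + 'n::finite \<Rightarrow> ('g, 'n) toroidal) =
    {chevalley_lie_algebra.toroidal_module scale bracket cartan x y H lam M | lam M.
      (\<forall>j. lam $ j \<noteq> 0) \<and> M \<in> objects_M scale bracket H}"
proof -
  interpret chevalley_lie_algebra scale bracket cartan A x y h H
    by (rule assms(1))
  have "\<exists>lam M. act = toroidal_module lam M \<and> (\<forall>j. lam $ j \<noteq> 0) \<and> M \<in> objects_M scale bracket H"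
    if "act \<in> objects_M toroidal_scale toroidal_bracket toroidal_basis"
    for act :: "('g, 'n) toroidal \<Rightarrow> ('l + 'n) cpoly \<Rightarrow> ('l + 'n) cpoly"
  proof -
    interpret toroidal_object scale bracket cartan A x y h H act
      using that type_A_C_diag[OF assms(2)] by unfold_locales auto
    fix i :: 'l
    have "chi j = chi i" for j
      by (rule type_A_C_connected[OF assms(2)]) (use chi_adjacent in \<open>auto simp: fun_eq_iff\<close>)
    then have "is_toroidal_module (\<chi> j. chi i (axis j 1)) M act"
      by (rule act_is_toroidal_module)
    then have "act = toroidal_module (\<chi> j. chi i (axis j 1)) M"
      by (rule toroidal_module_eqI[symmetric])
    moreover have "\<forall>j. (\<chi> j. chi i (axis j 1)) $ j \<noteq> 0"
      using lattice_character_eq_lam_pow(2)[of "chi i"] by (simp add: chi_add chi_0)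
    ultimately show ?thesis
      using M_object by blast
  qed
  moreover have "toroidal_module lam M \<in> objects_M toroidal_scale toroidal_bracket toroidal_basis"
    if "\<forall>j. lam $ j \<noteq> 0" "M \<in> objects_M scale bracket H"
    for lam :: "complex^'n" and M :: "'g \<Rightarrow> 'l cpoly \<Rightarrow> 'l cpoly"
  proof -
    interpret E: evaluation_module scale bracket cartan A x y h H lam M
      using that by unfold_locales auto
    show ?thesis
      using E.act_object toroidal_module_eqI[OF E.is_toroidal_module_act] by simp
  qed
  ultimately show ?thesis
    by blast
qed

end
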